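(* Fix $a,b>0$. For each $n$ let $V_n$ be the set of vertices of the triangular lattice $\mathbb{T}$ contained in $[0,an]\times[0,bn]$, and let $C_n\subseteq\{0,1\}^{V_n}$ be the event that there is a left-to-right crossing of $[0,an]\times[0,bn]$ by open sites. Then the sequence of events $\{C_n\}_{n\in\mathbb{N}}$ is CGXS.
   Context: $\mathbb{T}$ is the triangular lattice embedded in $\mathbb{R}^2$ with vertex set $\{(m+k/2,\,k\sqrt3/2):m,k\in\mathbb{Z}\}$, two vertices being adjacent when at Euclidean distance $1$. In a configuration $\omega\in\{0,1\}^{V_n}$ a site $v$ is open if $\omega_v=1$. A left-to-right crossing by open sites is a path in $\mathbb{T}$ of open sites of $V_n$ starting at a site having a $\mathbb{T}$-neighbor with first coordinate $<0$ and ending at a site having a $\mathbb{T}$-neighbor with first coordinate $>an$. Complete graph exclusion process on $V_n$: to every unordered pair of distinct elements of $V_n$ associate an independent Poisson clock of rate $1/|V_n|$; when it rings, the two elements are interchanged. $\pi^n_t$ is the random permutation of $V_n$ obtained by composing, in order, all transpositions up to time $t$. With $\eta^n_0$ uniform on $\{0,1\}^{V_n}$ and independent of the clocks, $\eta^n_t(x)=\eta^n_0((\pi^n_t)^{-1}(x))$. A sequence $f_n:\{0,1\}^{V_n}\to\{-1,1\}$ is CGXS (complete graph exclusion sensitive) if for some $t>0$ (equivalently, for all $t>0$), $\lim_{n\to\infty}\mathbb{E}[f_n(\eta^n_0)f_n(\eta^n_t)]-\mathbb{E}[f_n(\eta^n_0)]^2=0$. A sequence of events $C_n$ is CGXS if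 $f_n=2I_{C_n}-1$ is CGXS, where $I_{C_n}$ is the indicator function. *)

theory Defs
  imports "HOL-Probability.Probability" "HOL-Combinatorics.Transposition"
begin

section \<open>Complete graph exclusion process\<close>

text \<open>Elements of \<open>{0,1}\<^sup>V\<close>, with \<open>True\<close> for 1. Functions are extensional outside \<open>V\<close>, so that
  this set is finite for finite \<open>V\<close>.\<close>

definition configs :: "'v set \<Rightarrow> ('v \<Rightarrow> bool) set" where
  "configs V = V \<rightarrow>\<^sub>E UNIV"

definition unordered_pairs :: "'v set \<Rightarrow> 'v set set" where
  "unordered_pairs V = {{x, y} | x y. x \<in> V \<and> y \<in> V \<and> x \<noteq> y}"

definition swap_pair :: "'v set \<Rightarrow> 'v \<Rightarrow> 'v" where
  "swap_pair e z = (if z \<in> e then the_elem (e - {z}) else z)"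

lemma swap_pair_doubleton: "x \<noteq> y \<Longrightarrow> swap_pair {x, y} = Transposition.transpose x y"
  by (auto simp: fun_eq_iff swap_pair_def Transposition.transpose_def insert_Diff_if)

text \<open>The canonical space of the process. The first component is the uniform initial configuration.
  The second one holds, independently of it, the i.i.d. exponential waiting times of parameter
  \<open>1 / |V|\<close>: the coordinate \<open>(e, i)\<close> is the time between the \<open>i\<close>-th and the next ring of the clock
  of the pair \<open>e\<close>, so each clock is a Poisson process of rate \<open>1 / |V|\<close> and the clocks are independent.\<close>

definition clock_space :: "'v set \<Rightarrow> ('v set \<times> nat \<Rightarrow> real) measure" where
  "clock_space V = PiM (unordered_pairs V \<times> UNIV)
     (\<lambda>_. density lborel (exponential_density (1 / real (card V))))"

definition exclusion_space :: "'v set \<Rightarrow> (('v \<Rightarrow> bool) \<times> ('v set \<times> nat \<Rightarrow> real)) measure" where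
  "exclusion_space V = measure_pmf (pmf_of_set (configs V)) \<Otimes>\<^sub>M clock_space V"

definition ring_time :: "('v set \<times> nat \<Rightarrow> real) \<Rightarrow> 'v set \<times> nat \<Rightarrow> real" where
  "ring_time w = (\<lambda>(e, k). \<Sum>i\<le>k. w (e, i))"

definition rings_until :: "'v set \<Rightarrow> real \<Rightarrow> ('v set \<times> nat \<Rightarrow> real) \<Rightarrow> ('v set \<times> nat) set" where
  "rings_until V t w = {r \<in> unordered_pairs V \<times> UNIV. ring_time w r \<le> t}"

text \<open>For finite \<open>V\<close>, almost surely \<open>rings_until V t w\<close> is finite and its ring times are distinct, so the
  list below enumerates it in chronological order. Later transpositions are composed on the left.\<close>

definition exclusion_perm :: "'v set \<Rightarrow> real \<Rightarrow> ('v set \<times> nat \<Rightarrow> real) \<Rightarrow> 'v \<Rightarrow> 'v" where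
  "exclusion_perm V t w =
     fold (\<lambda>(e, k) \<sigma>. swap_pair e \<circ> \<sigma>) (sorted_key_list_of_set (ring_time w) (rings_until V t w)) id"

definition exclusion_config ::
    "'v set \<Rightarrow> real \<Rightarrow> ('v \<Rightarrow> bool) \<times> ('v set \<times> nat \<Rightarrow> real) \<Rightarrow> 'v \<Rightarrow> bool" where
  "exclusion_config V t = (\<lambda>(\<eta>, w). \<lambda>x\<in>V. \<eta> (inv (exclusion_perm V t w) x))"

definition CGXS :: "(nat \<Rightarrow> 'v set) \<Rightarrow> (nat \<Rightarrow> ('v \<Rightarrow> bool) \<Rightarrow> real) \<Rightarrow> bool" where
  "CGXS V f \<longleftrightarrow> (\<exists>t>0.
     (\<lambda>n. (LINT \<omega>|exclusion_space (V n). f n (fst \<omega>) * f n (exclusion_config (V n) t \<omega>))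
          - (LINT \<omega>|exclusion_space (V n). f n (fst \<omega>))\<^sup>2) \<longlonglongrightarrow> 0)"

definition CGXS_events :: "(nat \<Rightarrow> 'v set) \<Rightarrow> (nat \<Rightarrow> ('v \<Rightarrow> bool) set) \<Rightarrow> bool" where
  "CGXS_events V C \<longleftrightarrow> CGXS V (\<lambda>n \<eta>. 2 * indicator (C n) \<eta> - 1)"

section \<open>Crossings in the triangular lattice\<close>

text \<open>Points of the plane are pairs of reals, on which \<open>dist\<close> is the Euclidean distance.\<close>

definition tri_lattice :: "(real \<times> real) set" where
  "tri_lattice = {(of_int m + of_int k / 2, of_int k * sqrt 3 / 2) | m k :: int. True}"

definition tri_adj :: "real \<times> real \<Rightarrow> real \<times> real \<Rightarrow> bool" where
  "tri_adj u v \<longleftrightarrow> u \<in> tri_lattice \<and> v \<in> tri_lattice \<and> dist u v = 1"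

definition box_sites :: "real \<Rightarrow> real \<Rightarrow> nat \<Rightarrow> (real \<times> real) set" where
  "box_sites a b n = tri_lattice \<inter> ({0..a * real n} \<times> {0..b * real n})"

definition lr_crossing :: "real \<Rightarrow> real \<Rightarrow> nat \<Rightarrow> (real \<times> real \<Rightarrow> bool) set" where
  "lr_crossing a b n = {\<eta> \<in> configs (box_sites a b n).
     \<exists>p. p \<noteq> [] \<and> successively tri_adj p \<and> (\<forall>v\<in>set p. v \<in> box_sites a b n \<and> \<eta> v) \<and>
         (\<exists>u. tri_adj (hd p) u \<and> fst u < 0) \<and> (\<exists>u. tri_adj (last p) u \<and> fst u > a * real n)}"

end

theory Submission
  imports Defs "HOL-Real_Asymp.Real_Asymp"
begin

text \<open>Let \<open>f\<close> be the indicator of the crossing and \<open>P\<close> the operator of the exclusion process at time 1.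
  Exploring the open clusters of a random vertical strip decides the crossing, and reveals a given site
  with small probability because the one-arm probability of critical percolation tends to 0
  (Zhang's argument, with uniqueness in the form of Aizenman, Kesten and Newman). By the inequality of
  Schramm and Steif the Fourier weight of \<open>f\<close> at each fixed positive level tends to 0.

  The process conserves the number of ones, so this alone does not decorrelate \<open>f\<close> and \<open>P f\<close>. Let \<open>g\<close> be
  the average of \<open>f\<close> over opening a random number, up to \<open>R\<close>, of further random sites. As \<open>f\<close> is
  monotone, \<open>f \<le> g\<close>, while \<open>g\<close> and \<open>f\<close> have nearly the same mean if \<open>R\<close> is small compared with the square root
  of \<open>card V\<close>. The function \<open>P g\<close> has bounded total influence: \<open>P\<close> makes it smooth under swaps, and the
  average over \<open>R\<close> under opening sites. Its Fourier weight therefore lives at bounded levels, where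
  that of \<open>f\<close> is small.\<close>

section \<open>The discrete cube\<close>

text \<open>The parity of the number of ones shows the obstacle: its Fourier weight sits at the top
  level alone, and yet the process fixes it. Some control of the dependence on the number of ones is
  indispensable, and monotonicity supplies it through the one-sided bound f <= g. One side is
  enough: tested against f it bounds the correlation from above, tested against 1 - f from below.
  The scale R is a small multiple rho of the square root of \<open>card V\<close>; the mean of g
  then exceeds that of f by about rho at most, while the influence of P g is at most of order 1 + 1
  / rho^2, both free of n. Since only fixed levels matter, the one-arm probability has to vanish but
  at no particular rate, so soft arguments replace crossing estimates at all scales. All percolation
  statements live in finite boxes, with the uniform measure on subsets as the probability space. The
  clocks enter through the law of the random permutation, by its semigroup property and by lower
  bounds on the identity and on single transpositions over short times.\<close>

definition cube_avg :: "'v set \<Rightarrow> ('v set \<Rightarrow> real) \<Rightarrow> real" where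
  "cube_avg V g = (\<Sum>A\<in>Pow V. g A) / 2 ^ card V"

definition cube_prob :: "'v set \<Rightarrow> ('v set \<Rightarrow> bool) \<Rightarrow> real" where
  "cube_prob V Q = cube_avg V (\<lambda>A. of_bool (Q A))"

definition flip :: "'v \<Rightarrow> 'v set \<Rightarrow> 'v set" where
  "flip i A = (if i \<in> A then A - {i} else insert i A)"

definition spin :: "'v set \<Rightarrow> 'v \<Rightarrow> real" where
  "spin A i = (if i \<in> A then 1 else - 1)"

definition walsh :: "'v set \<Rightarrow> 'v set \<Rightarrow> real" where
  "walsh S A = (\<Prod>i\<in>S. spin A i)"

definition fourier :: "'v set \<Rightarrow> ('v set \<Rightarrow> real) \<Rightarrow> 'v set \<Rightarrow> real" where
  "fourier V g S = cube_avg V (\<lambda>A. g A * walsh S A)"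

definition level_weight :: "'v set \<Rightarrow> ('v set \<Rightarrow> real) \<Rightarrow> nat \<Rightarrow> real" where
  "level_weight V g k = (\<Sum>S | S \<subseteq> V \<and> card S = k. (fourier V g S)\<^sup>2)"

lemma cube_avg_cong: "(\<And>A. A \<subseteq> V \<Longrightarrow> g A = h A) \<Longrightarrow> cube_avg V g = cube_avg V h"
  unfolding cube_avg_def by (auto intro!: sum.cong)

lemma cube_avg_add: "cube_avg V (\<lambda>A. g A + h A) = cube_avg V g + cube_avg V h"
  by (simp add: cube_avg_def sum.distrib add_divide_distrib)

lemma cube_avg_diff: "cube_avg V (\<lambda>A. g A - h A) = cube_avg V g - cube_avg V h"
  by (simp add: cube_avg_def sum_subtractf diff_divide_distrib)

lemma cube_avg_minus: "cube_avg V (\<lambda>A. - g A) = - cube_avg V g"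
  by (simp add: cube_avg_def sum_negf)

lemma cube_avg_cmult: "cube_avg V (\<lambda>A. c * g A) = c * cube_avg V g"
  by (simp add: cube_avg_def sum_distrib_left)

lemma cube_avg_cmult_right: "cube_avg V (\<lambda>A. g A * c) = cube_avg V g * c"
  by (simp add: cube_avg_def sum_distrib_right)

lemma cube_avg_sum: "cube_avg V (\<lambda>A. \<Sum>x\<in>X. g x A) = (\<Sum>x\<in>X. cube_avg V (g x))"
proof -
  have "(\<Sum>A\<in>Pow V. \<Sum>x\<in>X. g x A) = (\<Sum>x\<in>X. \<Sum>A\<in>Pow V. g x A)"
    by (rule sum.swap)
  then show ?thesis by (simp add: cube_avg_def sum_divide_distrib)
qed

lemma cube_avg_mono: "(\<And>A. A \<subseteq> V \<Longrightarrow> g A \<le> h A) \<Longrightarrow> cube_avg V g \<le> cube_avg V h"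
  unfolding cube_avg_def by (intro divide_right_mono sum_mono) auto

lemma cube_avg_const [simp]: "finite V \<Longrightarrow> cube_avg V (\<lambda>A. c) = c"
  by (simp add: cube_avg_def card_Pow)

lemma cube_avg_nonneg: "(\<And>A. A \<subseteq> V \<Longrightarrow> 0 \<le> g A) \<Longrightarrow> 0 \<le> cube_avg V g"
  unfolding cube_avg_def by (intro divide_nonneg_nonneg sum_nonneg) auto

lemma cube_avg_le_const: "finite V \<Longrightarrow> (\<And>A. A \<subseteq> V \<Longrightarrow> g A \<le> c) \<Longrightarrow> cube_avg V g \<le> c"
  using cube_avg_mono[of V g "\<lambda>_. c"] by simp

lemma cube_avg_Cauchy_Schwarz:
  "(cube_avg V (\<lambda>A. g A * h A))\<^sup>2 \<le> cube_avg V (\<lambda>A. (g A)\<^sup>2) * cube_avg V (\<lambda>A. (h A)\<^sup>2)"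
proof -
  have "(\<Sum>A\<in>Pow V. g A * h A)\<^sup>2 / (2 ^ card V)\<^sup>2
      \<le> (\<Sum>A\<in>Pow V. (g A)\<^sup>2) * (\<Sum>A\<in>Pow V. (h A)\<^sup>2) / (2 ^ card V)\<^sup>2"
    by (intro divide_right_mono Cauchy_Schwarz_ineq_sum) auto
  then show ?thesis
    by (simp add: cube_avg_def power_divide power2_eq_square[of "2 ^ card V :: real"])
qed

lemma cube_avg_bij:
  assumes "bij_betw \<phi> (Pow V) (Pow W)" "card V = card W"
  shows "cube_avg V (\<lambda>A. g (\<phi> A)) = cube_avg W g"
  using sum.reindex_bij_betw[OF assms(1), of g] assms(2) by (simp add: cube_avg_def)

lemma flip_flip [simp]: "flip i (flip i A) = A"
  by (auto simp: flip_def)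

lemma flip_subset: "i \<in> V \<Longrightarrow> A \<subseteq> V \<Longrightarrow> flip i A \<subseteq> V"
  by (auto simp: flip_def)

lemma bij_betw_flip: "i \<in> V \<Longrightarrow> bij_betw (flip i) (Pow V) (Pow V)"
  by (rule bij_betwI[where g = "flip i"]) (auto dest: flip_subset)

lemma cube_avg_flip: "i \<in> V \<Longrightarrow> cube_avg V (\<lambda>A. g (flip i A)) = cube_avg V g"
  by (rule cube_avg_bij[OF bij_betw_flip]) auto

lemma cube_avg_odd:
  assumes "i \<in> V" "\<And>A. A \<subseteq> V \<Longrightarrow> g (flip i A) = - g A"
  shows "cube_avg V g = 0"
proof -
  have "cube_avg V g = cube_avg V (\<lambda>A. g (flip i A))" using assms(1) by (simp add: cube_avg_flip)
  also have "\<dots> = cube_avg V (\<lambda>A. - g A)" by (rule cube_avg_cong) (use assms in auto)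
  finally show ?thesis by (simp add: cube_avg_minus)
qed

lemma cube_avg_compl: "finite V \<Longrightarrow> cube_avg V (\<lambda>A. g (V - A)) = cube_avg V g"
proof (rule cube_avg_bij)
  show "bij_betw (\<lambda>A. V - A) (Pow V) (Pow V)"
    by (rule bij_betwI[where g = "\<lambda>A. V - A"]) auto
qed auto

lemma cube_avg_image:
  assumes "inj_on \<sigma> V"
  shows "cube_avg V (\<lambda>A. g (\<sigma> ` A)) = cube_avg (\<sigma> ` V) g"
  using assms by (intro cube_avg_bij bij_betw_Pow) (auto simp: bij_betw_def card_image)

lemma sum_Pow_Un:
  fixes g :: "'v set \<Rightarrow> real"
  assumes "finite S" "finite T" "S \<inter> T = {}"
  shows "(\<Sum>A\<in>Pow (S \<union> T). g A) = (\<Sum>B\<in>Pow S. \<Sum>C\<in>Pow T. g (B \<union> C))"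
proof -
  have "(\<Sum>B\<in>Pow S. \<Sum>C\<in>Pow T. g (B \<union> C)) = (\<Sum>(B, C)\<in>Pow S \<times> Pow T. g (B \<union> C))"
    by (simp add: sum.cartesian_product)
  also have "\<dots> = (\<Sum>A\<in>Pow (S \<union> T). g A)"
    by (rule sum.reindex_bij_witness[where j = "\<lambda>(B, C). B \<union> C" and i = "\<lambda>A. (A \<inter> S, A \<inter> T)"])
       (use assms in auto)
  finally show ?thesis by simp
qed

lemma cube_avg_Un:
  assumes "finite S" "finite T" "S \<inter> T = {}"
  shows "cube_avg (S \<union> T) g = cube_avg S (\<lambda>B. cube_avg T (\<lambda>C. g (B \<union> C)))"
  using assms
  by (simp add: cube_avg_def sum_Pow_Un card_Un_disjoint power_add sum_divide_distrib mult.commute)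

lemma cube_avg_indep:
  assumes "finite V" "S \<subseteq> V"
    and g: "\<And>A. A \<subseteq> V \<Longrightarrow> g A = g (A \<inter> S)" and h: "\<And>A. A \<subseteq> V \<Longrightarrow> h A = h (A - S)"
  shows "cube_avg V (\<lambda>A. g A * h A) = cube_avg V g * cube_avg V h"
proof -
  have fin: "finite S" "finite (V - S)" "S \<inter> (V - S) = {}" and V: "V = S \<union> (V - S)"
    using assms(1,2) finite_subset by auto
  have gB: "g (B \<union> C) = g B" if "B \<subseteq> S" "C \<subseteq> V - S" for B C
  proof -
    have "(B \<union> C) \<inter> S = B" using that by auto
    then show ?thesis using g[of "B \<union> C"] that assms(2) by auto
  qed
  have hC: "h (B \<union> C) = h C" if "B \<subseteq> S" "C \<subseteq> V - S" for B C
  proof -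
    have "(B \<union> C) - S = C" using that by auto
    then show ?thesis using h[of "B \<union> C"] that assms(2) by auto
  qed
  have "cube_avg V k = cube_avg S (\<lambda>B. cube_avg (V - S) (\<lambda>C. k (B \<union> C)))" for k
    using cube_avg_Un[OF fin, of k] V by simp
  note split = this
  have "cube_avg V (\<lambda>A. g A * h A) = cube_avg S (\<lambda>B. cube_avg (V - S) (\<lambda>C. g B * h C))"
    unfolding split by (intro cube_avg_cong) (simp add: gB hC)
  also have "\<dots> = cube_avg S g * cube_avg (V - S) h"
    by (simp add: cube_avg_cmult cube_avg_cmult_right)
  also have "cube_avg S g = cube_avg V g"
  proof -
    have "cube_avg V g = cube_avg S (\<lambda>B. cube_avg (V - S) (\<lambda>C. g B))"
      unfolding split by (intro cube_avg_cong) (simp add: gB)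
    then show ?thesis using fin by simp
  qed
  also have "cube_avg (V - S) h = cube_avg V h"
  proof -
    have "cube_avg V h = cube_avg S (\<lambda>B. cube_avg (V - S) h)"
      unfolding split by (intro cube_avg_cong) (simp add: hC)
    then show ?thesis using fin by simp
  qed
  finally show ?thesis .
qed

lemma cube_avg_marginal:
  assumes "finite V" "W \<subseteq> V"
  shows "cube_avg V (\<lambda>A. g (A \<inter> W)) = cube_avg W g"
proof -
  have fin: "finite W" "finite (V - W)" "W \<inter> (V - W) = {}" and V: "V = W \<union> (V - W)"
    using assms finite_subset by auto
  have "cube_avg V (\<lambda>A. g (A \<inter> W)) = cube_avg W (\<lambda>B. cube_avg (V - W) (\<lambda>C. g ((B \<union> C) \<inter> W)))"
    using cube_avg_Un[OF fin, of "\<lambda>A. g (A \<inter> W)"] V by simp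
  also have "\<dots> = cube_avg W (\<lambda>B. cube_avg (V - W) (\<lambda>C. g B))"
  proof (intro cube_avg_cong)
    fix B C assume "B \<subseteq> W" "C \<subseteq> V - W"
    then have "(B \<union> C) \<inter> W = B" by auto
    then show "g ((B \<union> C) \<inter> W) = g B" by simp
  qed
  finally show ?thesis using fin by simp
qed

lemma cube_avg_insert:
  assumes "finite V" "i \<notin> V"
  shows "cube_avg (insert i V) g = (cube_avg V g + cube_avg V (\<lambda>A. g (insert i A))) / 2"
proof -
  have "cube_avg ({i} \<union> V) g = cube_avg {i} (\<lambda>B. cube_avg V (\<lambda>C. g (B \<union> C)))"
    using assms by (intro cube_avg_Un) auto
  then show ?thesis by (simp add: cube_avg_def[of "{i}"] Pow_insert)
qed

text \<open>Condition on the coordinate i. The conditional means of g, and those of h, are ordered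
  the same way in the two halves, so the two-point Chebyshev inequality applies; the induction
  hypothesis treats each half. The decreasing form suits its use, on the absence of arms.\<close>

lemma Harris:
  assumes "finite V"
    and "\<And>A B. A \<subseteq> B \<Longrightarrow> B \<subseteq> V \<Longrightarrow> g B \<le> g A" and "\<And>A B. A \<subseteq> B \<Longrightarrow> B \<subseteq> V \<Longrightarrow> h B \<le> h A"
  shows "cube_avg V g * cube_avg V h \<le> cube_avg V (\<lambda>A. g A * h A)"
  using assms
proof (induction V arbitrary: g h rule: finite_induct)
  case empty
  then show ?case by (simp add: cube_avg_def)
next
  case (insert i V)
  define g1 h1 where "g1 A = g (insert i A)" and "h1 A = h (insert i A)" for A
  have anti: "g B \<le> g A" "h B \<le> h A" "g1 B \<le> g1 A" "h1 B \<le> h1 A" if "A \<subseteq> B" "B \<subseteq> V" for A B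
    using insert.prems[of A B] insert.prems[of "insert i A" "insert i B"] that
    by (auto simp: g1_def h1_def)
  have "cube_avg V g1 \<le> cube_avg V g" "cube_avg V h1 \<le> cube_avg V h"
    unfolding g1_def h1_def by (auto intro!: cube_avg_mono insert.prems)
  then have "0 \<le> (cube_avg V g - cube_avg V g1) * (cube_avg V h - cube_avg V h1)" by simp
  then have "(cube_avg V g + cube_avg V g1) / 2 * ((cube_avg V h + cube_avg V h1) / 2)
    \<le> (cube_avg V g * cube_avg V h + cube_avg V g1 * cube_avg V h1) / 2"
    by (simp add: field_simps)
  also have "\<dots> \<le> (cube_avg V (\<lambda>A. g A * h A) + cube_avg V (\<lambda>A. g1 A * h1 A)) / 2"
    by (intro divide_right_mono add_mono insert.IH anti) auto
  finally show ?case
    using insert.hyps by (simp add: cube_avg_insert g1_def[abs_def] h1_def[abs_def])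
qed

section \<open>Walsh characters and Parseval's identity\<close>

lemma spin_flip: "spin (flip i A) j = (if j = i then - spin A j else spin A j)"
  by (cases "j = i"; cases "i \<in> A"; cases "j \<in> A") (simp_all add: spin_def flip_def)

lemma spin_sq [simp]: "spin A i * spin A i = 1"
  by (auto simp: spin_def)

lemma walsh_flip:
  assumes "finite S"
  shows "walsh S (flip i A) = (if i \<in> S then - walsh S A else walsh S A)"
proof -
  have "walsh S (flip i A) = (\<Prod>j\<in>S. (if j = i then - 1 else 1) * spin A j)"
    unfolding walsh_def by (intro prod.cong refl) (simp add: spin_flip)
  also have "\<dots> = (\<Prod>j\<in>S. if j = i then - 1 else 1) * walsh S A"
    by (simp add: walsh_def prod.distrib)
  finally show ?thesis using assms by simp
qed

lemma walsh_sq [simp]: "walsh S A * walsh S A = 1"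
  by (simp add: walsh_def flip: prod.distrib)

lemma walsh_orthogonal:
  assumes "finite V" "S \<subseteq> V" "T \<subseteq> V"
  shows "cube_avg V (\<lambda>A. walsh S A * walsh T A) = of_bool (S = T)"
proof (cases "S = T")
  case True
  then show ?thesis using assms by simp
next
  case False
  then obtain i where i: "i \<in> V" "(i \<in> S) \<noteq> (i \<in> T)" using assms by blast
  have "finite S" "finite T" using assms finite_subset by auto
  then have "cube_avg V (\<lambda>A. walsh S A * walsh T A) = 0"
    using i by (intro cube_avg_odd[of i]) (auto simp: walsh_flip)
  then show ?thesis using False by simp
qed

text \<open>Completeness of the characters: the sum over S is the expansion of the product of
  \<open>1 + spin A i * spin B i\<close>, in which some factor vanishes when A and B differ.\<close>

lemma sum_walsh:
  assumes "finite V" "A \<subseteq> V" "B \<subseteq> V"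
  shows "(\<Sum>S\<in>Pow V. walsh S A * walsh S B) = (if A = B then 2 ^ card V else 0)"
proof -
  have "(\<Sum>S\<in>Pow V. walsh S A * walsh S B) = (\<Sum>S\<in>Pow V. (\<Prod>i\<in>S. spin A i * spin B i) * (\<Prod>i\<in>V-S. 1))"
    by (simp add: walsh_def prod.distrib)
  also have "\<dots> = (\<Prod>i\<in>V. spin A i * spin B i + 1)"
    using assms(1) by (simp only: prod_add)
  also have "\<dots> = (if A = B then 2 ^ card V else 0)"
  proof (cases "A = B")
    case False
    then obtain i where "i \<in> V" "(i \<in> A) \<noteq> (i \<in> B)" using assms by blast
    then have "\<exists>i\<in>V. spin A i * spin B i + 1 = 0" by (intro bexI[of _ i]) (auto simp: spin_def)
    then show ?thesis using False assms(1) by auto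
  qed simp
  finally show ?thesis .
qed

lemma Parseval:
  assumes "finite V"
  shows "cube_avg V (\<lambda>A. g A * h A) = (\<Sum>S\<in>Pow V. fourier V g S * fourier V h S)"
proof -
  let ?n = "2 ^ card V :: real"
  have "(\<Sum>S\<in>Pow V. fourier V g S * fourier V h S)
     = (\<Sum>S\<in>Pow V. \<Sum>A\<in>Pow V. \<Sum>B\<in>Pow V. g A * h B * (walsh S A * walsh S B)) / (?n * ?n)"
    unfolding fourier_def cube_avg_def sum_divide_distrib sum_product
    by (intro sum.cong refl) (simp add: sum_divide_distrib sum_product mult_ac)
  also have "(\<Sum>S\<in>Pow V. \<Sum>A\<in>Pow V. \<Sum>B\<in>Pow V. g A * h B * (walsh S A * walsh S B))
     = (\<Sum>A\<in>Pow V. \<Sum>S\<in>Pow V. \<Sum>B\<in>Pow V. g A * h B * (walsh S A * walsh S B))"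
    by (rule sum.swap)
  also have "\<dots> = (\<Sum>A\<in>Pow V. \<Sum>B\<in>Pow V. \<Sum>S\<in>Pow V. g A * h B * (walsh S A * walsh S B))"
    by (rule sum.cong[OF refl], rule sum.swap)
  also have "\<dots> = (\<Sum>A\<in>Pow V. \<Sum>B\<in>Pow V. if A = B then g A * h A * ?n else 0)"
    unfolding sum_distrib_left[symmetric] using assms
    by (intro sum.cong refl) (auto simp: sum_walsh)
  also have "\<dots> = (\<Sum>A\<in>Pow V. g A * h A * ?n)"
    using assms by (simp add: sum.delta')
  finally show ?thesis
    by (simp add: cube_avg_def flip: sum_distrib_right)
qed

lemma Bessel_walsh:
  assumes "finite V" "\<S> \<subseteq> Pow V"
  shows "(\<Sum>S\<in>\<S>. (fourier V g S)\<^sup>2) \<le> cube_avg V (\<lambda>A. (g A)\<^sup>2)"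
proof -
  have "(\<Sum>S\<in>\<S>. (fourier V g S)\<^sup>2) \<le> (\<Sum>S\<in>Pow V. (fourier V g S)\<^sup>2)"
    using assms by (intro sum_mono2) auto
  then show ?thesis using Parseval[OF assms(1), of g g] by (simp add: power2_eq_square)
qed

section \<open>Revealment\<close>

text \<open>A combinatorial form of the statement that \<open>J A\<close> is the set of coordinates read by an algorithm
  which reads \<open>A\<close> adaptively.\<close>

definition stopping_set :: "'v set \<Rightarrow> ('v set \<Rightarrow> 'v set) \<Rightarrow> bool" where
  "stopping_set V J \<longleftrightarrow> (\<forall>A i. A \<subseteq> V \<longrightarrow> i \<in> V \<longrightarrow> i \<notin> J A \<longrightarrow> J (flip i A) = J A)"

lemma stopping_set_flip: "stopping_set V J \<Longrightarrow> A \<subseteq> V \<Longrightarrow> i \<in> V \<Longrightarrow> i \<notin> J A \<Longrightarrow> J (flip i A) = J A"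
  by (simp add: stopping_set_def)

lemma stopping_set_flip_mem:
  assumes "stopping_set V J" "A \<subseteq> V" "i \<in> V"
  shows "i \<in> J (flip i A) \<longleftrightarrow> i \<in> J A"
  using assms stopping_set_flip[of V J "flip i A" i] stopping_set_flip[of V J A i] flip_subset[of i V A]
  by auto

text \<open>The pairing of A with \<open>flip i A\<close> preserves the event that i is unread, on
  which the two values cancel. The orthogonality relations for stopping sets below all arise in this
  way.\<close>

lemma cube_avg_odd_off:
  assumes J: "stopping_set V J" and "i \<in> V"
    and off: "\<And>A. A \<subseteq> V \<Longrightarrow> i \<notin> J A \<Longrightarrow> g (flip i A) = - g A"
    and on: "\<And>A. A \<subseteq> V \<Longrightarrow> i \<in> J A \<Longrightarrow> g A = 0"
  shows "cube_avg V g = 0"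
proof (rule cube_avg_odd[OF \<open>i \<in> V\<close>])
  fix A assume A: "A \<subseteq> V"
  show "g (flip i A) = - g A"
  proof (cases "i \<in> J A")
    case True
    then show ?thesis
      using on A stopping_set_flip_mem[OF J A \<open>i \<in> V\<close>] flip_subset[OF \<open>i \<in> V\<close> A] by simp
  qed (use off A in auto)
qed

text \<open>The Schramm--Steif inequality for one deterministic algorithm. The function \<open>h\<close> in the proof is
  the part of the level \<open>k\<close> of \<open>f\<close> that the algorithm leaves untouched; it is orthogonal to \<open>f\<close>.\<close>

lemma level_weight_stopping_set:
  assumes "finite V" and J: "stopping_set V J" and "k > 0"
    and f: "\<And>A i. A \<subseteq> V \<Longrightarrow> i \<in> V \<Longrightarrow> i \<notin> J A \<Longrightarrow> f (flip i A) = f A"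
  shows "(level_weight V f k)\<^sup>2 \<le> cube_avg V (\<lambda>A. (f A)\<^sup>2) *
    (\<Sum>S | S \<subseteq> V \<and> card S = k. (fourier V f S)\<^sup>2 * cube_prob V (\<lambda>A. S \<inter> J A \<noteq> {}))"
proof -
  define L where "L = {S. S \<subseteq> V \<and> card S = k}"
  define c where "c S = fourier V f S" for S
  define u where "u S A = walsh S A * of_bool (S \<inter> J A = {})" for S A
  define g where "g A = (\<Sum>S\<in>L. c S * walsh S A)" for A
  define h where "h A = (\<Sum>S\<in>L. c S * u S A)" for A
  have finS: "finite S" if "S \<in> L" for S using that assms(1) finite_subset by (auto simp: L_def)
  have u_off: "u S (flip i A) = - u S A" if "S \<in> L" "i \<in> S" "A \<subseteq> V" "i \<notin> J A" for S i A
  proof -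
    have "i \<in> V" using that by (auto simp: L_def)
    then show ?thesis
      using that by (simp add: u_def walsh_flip[OF finS] stopping_set_flip[OF J])
  qed
  have u_on: "u S A = 0" if "i \<in> S" "i \<in> J A" for S i A
    using that by (auto simp: u_def)
  have uT: "cube_avg V (\<lambda>A. walsh T A * u S A) = of_bool (S = T) * cube_prob V (\<lambda>A. S \<inter> J A = {})"
    if "S \<in> L" "T \<in> L" for S T
  proof (cases "S = T")
    case True
    have "cube_avg V (\<lambda>A. walsh T A * u S A) = cube_prob V (\<lambda>A. S \<inter> J A = {})"
      using True unfolding cube_prob_def u_def by (intro cube_avg_cong) (simp flip: mult.assoc)
    then show ?thesis using True by simp
  next
    case False
    \<comment> \<open>S and T have the same size k, so a coordinate of S outside T exists; flipping
      it while unread changes the sign of \<open>u S\<close> and leaves \<open>walsh T\<close>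
      alone.\<close>
    have "\<not> S \<subseteq> T" using False that finS[of T] card_subset_eq[of T S] by (auto simp: L_def)
    then obtain i where i: "i \<in> S" "i \<notin> T" "i \<in> V" using \<open>S \<in> L\<close> by (auto simp: L_def)
    have "cube_avg V (\<lambda>A. walsh T A * u S A) = 0"
      using i that finS u_off u_on by (intro cube_avg_odd_off[OF J, of i]) (auto simp: walsh_flip)
    then show ?thesis using False by simp
  qed
  have uu: "cube_avg V (\<lambda>A. u T A * u S A) = of_bool (S = T) * cube_prob V (\<lambda>A. S \<inter> J A = {})"
    if "S \<in> L" "T \<in> L" for S T
  proof (cases "S = T")
    case True
    have "cube_avg V (\<lambda>A. u T A * u S A) = cube_prob V (\<lambda>A. S \<inter> J A = {})"
      using True unfolding cube_prob_def u_def by (intro cube_avg_cong) auto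
    then show ?thesis using True by simp
  next
    case False
    have "\<not> S \<subseteq> T" using False that finS[of T] card_subset_eq[of T S] by (auto simp: L_def)
    then obtain i where i: "i \<in> S" "i \<notin> T" "i \<in> V" using \<open>S \<in> L\<close> by (auto simp: L_def)
    have "u T (flip i A) = u T A" if "A \<subseteq> V" "i \<notin> J A" for A
      using that i by (simp add: u_def walsh_flip[OF finS[OF \<open>T \<in> L\<close>]] stopping_set_flip[OF J])
    then have "cube_avg V (\<lambda>A. u T A * u S A) = 0"
      using i that u_off u_on by (intro cube_avg_odd_off[OF J, of i]) auto
    then show ?thesis using False by simp
  qed
  have fg: "cube_avg V (\<lambda>A. f A * g A) = level_weight V f k"
  proof -
    have "cube_avg V (\<lambda>A. f A * g A) = (\<Sum>S\<in>L. cube_avg V (\<lambda>A. c S * (f A * walsh S A)))"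
      unfolding cube_avg_sum[symmetric] g_def by (simp add: sum_distrib_left mult_ac)
    also have "\<dots> = (\<Sum>S\<in>L. c S * c S)"
      by (simp add: cube_avg_cmult c_def fourier_def)
    finally show ?thesis by (simp add: level_weight_def L_def c_def power2_eq_square)
  qed
  \<comment> \<open>Flipping an unread coordinate of S changes the sign of \<open>u S\<close> but
    not f, which is determined by what has been read. Here S is nonempty because k > 0.\<close>
  have fh: "cube_avg V (\<lambda>A. f A * h A) = 0"
  proof -
    have "cube_avg V (\<lambda>A. f A * u S A) = 0" if "S \<in> L" for S
    proof -
      have "S \<noteq> {}" using that \<open>k > 0\<close> by (auto simp: L_def)
      then obtain i where i: "i \<in> S" by auto
      show ?thesis
        using i that u_off u_on f by (intro cube_avg_odd_off[OF J, of i]) (auto simp: L_def)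
    qed
    then have "(\<Sum>S\<in>L. cube_avg V (\<lambda>A. c S * (f A * u S A))) = 0"
      by (simp add: cube_avg_cmult)
    then show ?thesis
      unfolding cube_avg_sum[symmetric] h_def by (simp add: sum_distrib_left mult_ac)
  qed
  have expand: "cube_avg V (\<lambda>A. (\<Sum>T\<in>L. c T * v T A) * (\<Sum>S\<in>L. c S * w S A))
      = (\<Sum>T\<in>L. \<Sum>S\<in>L. c T * c S * cube_avg V (\<lambda>A. v T A * w S A))" for v w
    unfolding cube_avg_sum[symmetric] sum_product cube_avg_cmult[symmetric]
    by (simp add: mult_ac)
  have finL: "finite L" using assms(1) by (auto simp: L_def)
  have diag: "(\<Sum>S\<in>L. c T * c S * (of_bool (S = T) * q S)) = (c T)\<^sup>2 * q T" if "T \<in> L" for q T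
  proof -
    have "(\<Sum>S\<in>L. c T * c S * (of_bool (S = T) * q S)) = (\<Sum>S\<in>L. if S = T then (c T)\<^sup>2 * q T else 0)"
      by (intro sum.cong refl) (auto simp: power2_eq_square)
    then show ?thesis using finL that by simp
  qed
  have Q: "cube_avg V (\<lambda>A. g A * h A) = (\<Sum>S\<in>L. (c S)\<^sup>2 * cube_prob V (\<lambda>A. S \<inter> J A = {}))"
    unfolding g_def h_def expand by (intro sum.cong refl) (simp add: uT diag)
  have Q': "cube_avg V (\<lambda>A. h A * h A) = (\<Sum>S\<in>L. (c S)\<^sup>2 * cube_prob V (\<lambda>A. S \<inter> J A = {}))"
    unfolding h_def expand by (intro sum.cong refl) (simp add: uu diag)
  have "cube_avg V (\<lambda>A. walsh T A * walsh S A) = of_bool (S = T) * 1" if "S \<in> L" "T \<in> L" for S T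
    using that assms(1) by (auto simp: L_def walsh_orthogonal)
  then have W: "cube_avg V (\<lambda>A. g A * g A) = (\<Sum>S\<in>L. (c S)\<^sup>2)"
    unfolding g_def expand using diag[of _ "\<lambda>_. 1"] by (intro sum.cong refl) simp
  have prob: "cube_prob V (\<lambda>A. S \<inter> J A \<noteq> {}) = 1 - cube_prob V (\<lambda>A. S \<inter> J A = {})" for S
  proof -
    have "cube_prob V (\<lambda>A. S \<inter> J A \<noteq> {}) = cube_avg V (\<lambda>A. 1 - of_bool (S \<inter> J A = {}))"
      unfolding cube_prob_def by (intro cube_avg_cong) auto
    then show ?thesis using assms(1) by (simp add: cube_avg_diff cube_prob_def)
  qed
  \<comment> \<open>\<open>Q\<close> and \<open>Q'\<close> agree, so h is orthogonal to g - h, and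
    Pythagoras leaves exactly the squared coefficients weighted by the chance that the algorithm
    touches S.\<close>
  have "cube_avg V (\<lambda>A. (g A - h A)\<^sup>2) = cube_avg V (\<lambda>A. g A * g A - 2 * (g A * h A) + h A * h A)"
    by (intro cube_avg_cong) (simp add: power2_eq_square algebra_simps)
  also have "\<dots> = (\<Sum>S\<in>L. (c S)\<^sup>2) - (\<Sum>S\<in>L. (c S)\<^sup>2 * cube_prob V (\<lambda>A. S \<inter> J A = {}))"
    by (simp add: cube_avg_add cube_avg_diff cube_avg_cmult W Q Q')
  also have "\<dots> = (\<Sum>S\<in>L. (c S)\<^sup>2 * cube_prob V (\<lambda>A. S \<inter> J A \<noteq> {}))"
    unfolding prob by (simp add: sum_subtractf right_diff_distrib)
  finally have "cube_avg V (\<lambda>A. (g A - h A)\<^sup>2) = (\<Sum>S\<in>L. (c S)\<^sup>2 * cube_prob V (\<lambda>A. S \<inter> J A \<noteq> {}))" .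
  moreover have "level_weight V f k = cube_avg V (\<lambda>A. f A * (g A - h A))"
    by (simp add: right_diff_distrib cube_avg_diff fg fh)
  ultimately show ?thesis
    using cube_avg_Cauchy_Schwarz[of V f "\<lambda>A. g A - h A"] by (simp add: L_def c_def)
qed

lemma cube_prob_nonneg: "0 \<le> cube_prob V Q"
  unfolding cube_prob_def by (rule cube_avg_nonneg) simp

lemma cube_prob_mono: "(\<And>A. A \<subseteq> V \<Longrightarrow> Q A \<Longrightarrow> R A) \<Longrightarrow> cube_prob V Q \<le> cube_prob V R"
  unfolding cube_prob_def by (rule cube_avg_mono) simp

lemma cube_prob_le_1: "finite V \<Longrightarrow> cube_prob V Q \<le> 1"
  unfolding cube_prob_def by (rule cube_avg_le_const) auto

lemma cube_prob_not: "finite V \<Longrightarrow> cube_prob V (\<lambda>A. \<not> Q A) = 1 - cube_prob V Q"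
proof -
  assume "finite V"
  have "cube_prob V (\<lambda>A. \<not> Q A) = cube_avg V (\<lambda>A. 1 - of_bool (Q A))"
    unfolding cube_prob_def by (intro cube_avg_cong) auto
  then show ?thesis using \<open>finite V\<close> by (simp add: cube_avg_diff cube_prob_def)
qed

lemma cube_prob_UN:
  assumes "finite X" and "\<And>A. A \<subseteq> V \<Longrightarrow> Q A \<Longrightarrow> \<exists>x\<in>X. R x A"
  shows "cube_prob V Q \<le> (\<Sum>x\<in>X. cube_prob V (R x))"
  unfolding cube_prob_def cube_avg_sum[symmetric]
proof (rule cube_avg_mono)
  fix A assume "A \<subseteq> V"
  show "of_bool (Q A) \<le> (\<Sum>x\<in>X. of_bool (R x A) :: real)"
  proof (cases "Q A")
    case True
    then obtain x where "x \<in> X" "R x A" using assms \<open>A \<subseteq> V\<close> by auto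
    then show ?thesis using member_le_sum[of x X "\<lambda>x. of_bool (R x A) :: real"] assms(1) by auto
  qed (simp add: sum_nonneg)
qed

lemma level_weight_nonneg: "0 \<le> level_weight V f k"
  by (simp add: level_weight_def sum_nonneg)

text \<open>The random algorithm draws c uniformly from C. Averaging the deterministic inequality
  over c bounds the square of the weight W by the squared coefficients times the chance that S is
  hit, which a union bound over the k elements of S makes at most k \<delta>. One factor W then
  cancels.\<close>

lemma level_weight_revealment:
  fixes \<delta> :: real
  assumes "finite V" "finite C" "C \<noteq> {}" "k > 0" "\<delta> \<ge> 0"
    and J: "\<And>c. c \<in> C \<Longrightarrow> stopping_set V (J c)"
    and f: "\<And>c A i. c \<in> C \<Longrightarrow> A \<subseteq> V \<Longrightarrow> i \<in> V \<Longrightarrow> i \<notin> J c A \<Longrightarrow> f (flip i A) = f A"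
    and f1: "\<And>A. A \<subseteq> V \<Longrightarrow> \<bar>f A\<bar> \<le> 1"
    and \<delta>: "\<And>i. i \<in> V \<Longrightarrow> (\<Sum>c\<in>C. cube_prob V (\<lambda>A. i \<in> J c A)) \<le> \<delta> * card C"
  shows "level_weight V f k \<le> k * \<delta>"
proof -
  let ?W = "level_weight V f k" and ?L = "{S. S \<subseteq> V \<and> card S = k}"
  have f2: "cube_avg V (\<lambda>A. (f A)\<^sup>2) \<le> 1"
    using assms(1) f1 by (intro cube_avg_le_const) (auto simp: abs_square_le_1)
  have hit: "(\<Sum>c\<in>C. cube_prob V (\<lambda>A. S \<inter> J c A \<noteq> {})) \<le> k * (\<delta> * card C)" if "S \<in> ?L" for S
  proof -
    have "finite S" using that assms(1) finite_subset by auto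
    then have "(\<Sum>c\<in>C. cube_prob V (\<lambda>A. S \<inter> J c A \<noteq> {})) \<le> (\<Sum>c\<in>C. \<Sum>i\<in>S. cube_prob V (\<lambda>A. i \<in> J c A))"
      by (intro sum_mono cube_prob_UN) auto
    also have "\<dots> = (\<Sum>i\<in>S. \<Sum>c\<in>C. cube_prob V (\<lambda>A. i \<in> J c A))" by (rule sum.swap)
    also have "\<dots> \<le> (\<Sum>i\<in>S. \<delta> * card C)" using that by (intro sum_mono \<delta>) auto
    finally show ?thesis using that by simp
  qed
  have "card C * ?W\<^sup>2 = (\<Sum>c\<in>C. ?W\<^sup>2)" by simp
  also have "\<dots> \<le> (\<Sum>c\<in>C. \<Sum>S\<in>?L. (fourier V f S)\<^sup>2 * cube_prob V (\<lambda>A. S \<inter> J c A \<noteq> {}))"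
  proof (rule sum_mono)
    fix c assume "c \<in> C"
    let ?R = "\<Sum>S\<in>?L. (fourier V f S)\<^sup>2 * cube_prob V (\<lambda>A. S \<inter> J c A \<noteq> {})"
    have "?W\<^sup>2 \<le> cube_avg V (\<lambda>A. (f A)\<^sup>2) * ?R"
      using assms(1,4) J[OF \<open>c \<in> C\<close>] f[OF \<open>c \<in> C\<close>] by (intro level_weight_stopping_set)
    also have "\<dots> \<le> 1 * ?R"
      using f2 by (intro mult_right_mono sum_nonneg) (auto simp: cube_prob_nonneg)
    finally show "?W\<^sup>2 \<le> ?R" by simp
  qed
  also have "\<dots> = (\<Sum>S\<in>?L. (fourier V f S)\<^sup>2 * (\<Sum>c\<in>C. cube_prob V (\<lambda>A. S \<inter> J c A \<noteq> {})))"
    unfolding sum_distrib_left by (rule sum.swap)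
  also have "\<dots> \<le> (\<Sum>S\<in>?L. (fourier V f S)\<^sup>2 * (k * (\<delta> * card C)))"
    by (intro sum_mono mult_left_mono hit) auto
  also have "\<dots> = card C * ?W * (k * \<delta>)"
    by (simp add: level_weight_def sum_distrib_left mult_ac)
  finally have main: "?W * ?W \<le> ?W * (k * \<delta>)"
    using assms(2,3) by (simp add: power2_eq_square mult.assoc card_gt_0_iff)
  show ?thesis
  proof (cases "?W = 0")
    case True
    then show ?thesis using \<open>\<delta> \<ge> 0\<close> by simp
  next
    case False
    then have "?W > 0" using level_weight_nonneg[of V f k] by linarith
    then show ?thesis using main by simp
  qed
qed

section \<open>Smoothing by random permutations\<close>

definition perm_avg :: "'v set \<Rightarrow> (('v \<Rightarrow> 'v) \<Rightarrow> real) \<Rightarrow> ('v set \<Rightarrow> real) \<Rightarrow> 'v set \<Rightarrow> real" where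
  "perm_avg V \<mu> g A = (\<Sum>\<sigma> | \<sigma> permutes V. \<mu> \<sigma> * g (\<sigma> ` A))"

definition perm_weights :: "'v set \<Rightarrow> (('v \<Rightarrow> 'v) \<Rightarrow> real) \<Rightarrow> bool" where
  "perm_weights V \<mu> \<longleftrightarrow> (\<forall>\<sigma>. \<sigma> permutes V \<longrightarrow> 0 \<le> \<mu> \<sigma>) \<and> (\<Sum>\<sigma> | \<sigma> permutes V. \<mu> \<sigma>) = 1"

text \<open>Up to a constant, the Dirichlet form of the exclusion process. Pairs are ordered, so
  each transposition counts twice.\<close>

definition swap_energy :: "'v set \<Rightarrow> ('v set \<Rightarrow> real) \<Rightarrow> real" where
  "swap_energy V g = (\<Sum>x\<in>V. \<Sum>y\<in>V. cube_avg V (\<lambda>A. (g A - g (Transposition.transpose x y ` A))\<^sup>2))"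

text \<open>The site is drawn from all of V, open ones included, so its law does not depend on A;
  drawing an open site changes nothing.\<close>

definition up_avg :: "'v set \<Rightarrow> ('v set \<Rightarrow> real) \<Rightarrow> 'v set \<Rightarrow> real" where
  "up_avg V g A = (\<Sum>i\<in>V. g (insert i A)) / card V"

definition up_mean :: "'v set \<Rightarrow> nat \<Rightarrow> ('v set \<Rightarrow> real) \<Rightarrow> 'v set \<Rightarrow> real" where
  "up_mean V R g A = (\<Sum>r<R. (up_avg V ^^ r) g A) / R"

lemma permutes_image_subset: "\<sigma> permutes V \<Longrightarrow> A \<subseteq> V \<Longrightarrow> \<sigma> ` A \<subseteq> V"
  using permutes_image by blast

lemma cube_avg_permutes: "\<sigma> permutes V \<Longrightarrow> cube_avg V (\<lambda>A. g (\<sigma> ` A)) = cube_avg V g"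
  using cube_avg_image[of \<sigma> V g] permutes_image[of \<sigma> V] permutes_inj_on[of \<sigma> V] by simp

lemma cube_avg_perm_avg:
  assumes "perm_weights V \<mu>"
  shows "cube_avg V (perm_avg V \<mu> g) = cube_avg V g"
proof -
  have "cube_avg V (perm_avg V \<mu> g) = (\<Sum>\<sigma> | \<sigma> permutes V. \<mu> \<sigma> * cube_avg V (\<lambda>A. g (\<sigma> ` A)))"
    unfolding perm_avg_def[abs_def] cube_avg_sum by (simp add: cube_avg_cmult)
  also have "\<dots> = (\<Sum>\<sigma> | \<sigma> permutes V. \<mu> \<sigma> * cube_avg V g)"
    by (intro sum.cong refl) (simp add: cube_avg_permutes)
  also have "\<dots> = cube_avg V g"
    using assms by (simp add: perm_weights_def flip: sum_distrib_right)
  finally show ?thesis .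
qed

lemma perm_avg_mono:
  assumes "perm_weights V \<mu>" "A \<subseteq> V" "\<And>B. B \<subseteq> V \<Longrightarrow> g B \<le> h B"
  shows "perm_avg V \<mu> g A \<le> perm_avg V \<mu> h A"
  unfolding perm_avg_def using assms(1)
  by (intro sum_mono mult_left_mono assms(3) permutes_image_subset[OF _ assms(2)])
     (auto simp: perm_weights_def)

lemma perm_avg_const: "perm_weights V \<mu> \<Longrightarrow> perm_avg V \<mu> (\<lambda>_. c) A = c"
  unfolding perm_avg_def perm_weights_def by (simp flip: sum_distrib_right)

lemma perm_avg_diff: "perm_avg V \<mu> (\<lambda>A. g A - h A) A = perm_avg V \<mu> g A - perm_avg V \<mu> h A"
  unfolding perm_avg_def by (simp add: right_diff_distrib sum_subtractf)

lemma perm_avg_bounds: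
  assumes "perm_weights V \<mu>" "A \<subseteq> V" "\<And>B. B \<subseteq> V \<Longrightarrow> l \<le> g B \<and> g B \<le> u"
  shows "l \<le> perm_avg V \<mu> g A \<and> perm_avg V \<mu> g A \<le> u"
  using perm_avg_mono[OF assms(1,2), of g "\<lambda>_. u"] perm_avg_mono[OF assms(1,2), of "\<lambda>_. l" g] assms
  by (simp add: perm_avg_const)

lemma perm_weights_Jensen:
  assumes "perm_weights V \<mu>"
  shows "(\<Sum>\<sigma> | \<sigma> permutes V. \<mu> \<sigma> * a \<sigma>)\<^sup>2 \<le> (\<Sum>\<sigma> | \<sigma> permutes V. \<mu> \<sigma> * (a \<sigma>)\<^sup>2)"
proof -
  let ?P = "{\<sigma>. \<sigma> permutes V}"
  have "(\<Sum>\<sigma>\<in>?P. \<mu> \<sigma> * a \<sigma>)\<^sup>2 = (\<Sum>\<sigma>\<in>?P. sqrt (\<mu> \<sigma>) * (sqrt (\<mu> \<sigma>) * a \<sigma>))\<^sup>2"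
    using assms by (intro arg_cong[where f = "\<lambda>x. x\<^sup>2"] sum.cong) (auto simp: perm_weights_def simp flip: mult.assoc)
  also have "\<dots> \<le> (\<Sum>\<sigma>\<in>?P. (sqrt (\<mu> \<sigma>))\<^sup>2) * (\<Sum>\<sigma>\<in>?P. (sqrt (\<mu> \<sigma>) * a \<sigma>)\<^sup>2)"
    by (rule Cauchy_Schwarz_ineq_sum)
  also have "\<dots> = (\<Sum>\<sigma>\<in>?P. \<mu> \<sigma> * (a \<sigma>)\<^sup>2)"
    using assms by (simp add: perm_weights_def power_mult_distrib)
  finally show ?thesis .
qed

lemma permutes_transpose_image:
  assumes "\<sigma> permutes V"
  shows "\<sigma> ` Transposition.transpose x y ` A = Transposition.transpose (\<sigma> x) (\<sigma> y) ` \<sigma> ` A"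
proof -
  have "inj \<sigma>" using assms by (rule permutes_inj)
  then have "\<sigma> (Transposition.transpose x y z) = Transposition.transpose (\<sigma> x) (\<sigma> y) (\<sigma> z)" for z
    by (auto simp: Transposition.transpose_def inj_eq)
  then show ?thesis by (simp add: image_image)
qed

text \<open>Conjugation by \<sigma> turns the swap of x and y into that of \<sigma> x and \<sigma>
  y, and the sum over all pairs is invariant under this relabelling; by Jensen, every law \<mu>
  contracts the energy.\<close>

lemma swap_energy_perm_avg_le:
  assumes "perm_weights V \<mu>"
  shows "swap_energy V (perm_avg V \<mu> g) \<le> swap_energy V g"
proof -
  let ?P = "{\<sigma>. \<sigma> permutes V}"
  let ?d = "\<lambda>x y A. (g A - g (Transposition.transpose x y ` A))\<^sup>2"
  have "(perm_avg V \<mu> g A - perm_avg V \<mu> g (Transposition.transpose x y ` A))\<^sup>2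
      \<le> (\<Sum>\<sigma>\<in>?P. \<mu> \<sigma> * ?d (\<sigma> x) (\<sigma> y) (\<sigma> ` A))" for x y A
  proof -
    have "perm_avg V \<mu> g A - perm_avg V \<mu> g (Transposition.transpose x y ` A)
       = (\<Sum>\<sigma>\<in>?P. \<mu> \<sigma> * (g (\<sigma> ` A) - g (Transposition.transpose (\<sigma> x) (\<sigma> y) ` \<sigma> ` A)))"
      unfolding perm_avg_def sum_subtractf[symmetric]
      by (intro sum.cong refl) (simp add: right_diff_distrib permutes_transpose_image)
    then show ?thesis
      using perm_weights_Jensen[OF assms, of "\<lambda>\<sigma>. g (\<sigma> ` A) - g (Transposition.transpose (\<sigma> x) (\<sigma> y) ` \<sigma> ` A)"] by simp
  qed
  then have "swap_energy V (perm_avg V \<mu> g)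
      \<le> (\<Sum>x\<in>V. \<Sum>y\<in>V. cube_avg V (\<lambda>A. \<Sum>\<sigma>\<in>?P. \<mu> \<sigma> * ?d (\<sigma> x) (\<sigma> y) (\<sigma> ` A)))"
    unfolding swap_energy_def by (intro sum_mono cube_avg_mono)
  also have "\<dots> = (\<Sum>x\<in>V. \<Sum>y\<in>V. \<Sum>\<sigma>\<in>?P. \<mu> \<sigma> * cube_avg V (?d (\<sigma> x) (\<sigma> y)))"
    unfolding cube_avg_sum cube_avg_cmult
    by (intro sum.cong refl) (simp add: cube_avg_permutes[where g = "?d _ _"])
  also have "\<dots> = (\<Sum>x\<in>V. \<Sum>\<sigma>\<in>?P. \<Sum>y\<in>V. \<mu> \<sigma> * cube_avg V (?d (\<sigma> x) (\<sigma> y)))"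
    by (rule sum.cong[OF refl], rule sum.swap)
  also have "\<dots> = (\<Sum>\<sigma>\<in>?P. \<Sum>x\<in>V. \<Sum>y\<in>V. \<mu> \<sigma> * cube_avg V (?d (\<sigma> x) (\<sigma> y)))"
    by (rule sum.swap)
  also have "\<dots> = (\<Sum>\<sigma>\<in>?P. \<mu> \<sigma> * swap_energy V g)"
  proof (rule sum.cong[OF refl])
    fix \<sigma> assume "\<sigma> \<in> ?P"
    then have bij: "bij_betw \<sigma> V V" by (auto intro: permutes_imp_bij)
    have "(\<Sum>x\<in>V. \<Sum>y\<in>V. cube_avg V (?d (\<sigma> x) (\<sigma> y))) = (\<Sum>x\<in>V. \<Sum>y\<in>V. cube_avg V (?d (\<sigma> x) y))"
      by (rule sum.cong[OF refl], rule sum.reindex_bij_betw[OF bij, where g = "\<lambda>y. cube_avg V (?d _ y)"])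
    also have "\<dots> = swap_energy V g"
      unfolding swap_energy_def
      by (rule sum.reindex_bij_betw[OF bij, where g = "\<lambda>x. \<Sum>y\<in>V. cube_avg V (?d x y)"])
    finally show "(\<Sum>x\<in>V. \<Sum>y\<in>V. \<mu> \<sigma> * cube_avg V (?d (\<sigma> x) (\<sigma> y))) = \<mu> \<sigma> * swap_energy V g"
      by (simp flip: sum_distrib_left)
  qed
  also have "\<dots> = swap_energy V g"
    using assms by (simp add: perm_weights_def flip: sum_distrib_right)
  finally show ?thesis .
qed

lemma card_transpose_fiber:
  assumes "\<sigma> \<noteq> id"
  shows "finite {p \<in> X. Transposition.transpose (fst p) (snd p) = \<sigma>}" "card {p \<in> X. Transposition.transpose (fst p) (snd p) = \<sigma>} \<le> 2"
proof -
  have "\<exists>x y. {p \<in> X. Transposition.transpose (fst p) (snd p) = \<sigma>} \<subseteq> {(x, y), (y, x)}"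
  proof (cases "{p \<in> X. Transposition.transpose (fst p) (snd p) = \<sigma>} = {}")
    case True
    then show ?thesis by (metis empty_subsetI)
  next
    case False
    then obtain x y where xy: "Transposition.transpose x y = \<sigma>" by auto
    have "(u = x \<and> v = y) \<or> (u = y \<and> v = x)" if "Transposition.transpose u v = \<sigma>" for u v
    proof -
      have *: "Transposition.transpose u v z = Transposition.transpose x y z" for z using that xy by simp
      have "x \<noteq> y" "u \<noteq> v" using xy that assms by auto
      then show ?thesis using *[of u] *[of v] *[of x] *[of y] by (auto simp: Transposition.transpose_def split: if_splits)
    qed
    then show ?thesis by force
  qed
  then obtain x y where sub: "{p \<in> X. Transposition.transpose (fst p) (snd p) = \<sigma>} \<subseteq> {(x, y), (y, x)}" by blast
  then show "finite {p \<in> X. Transposition.transpose (fst p) (snd p) = \<sigma>}" using finite_subset by blast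
  have "card {(x, y), (y, x)} \<le> 2" using card_length[of "[(x, y), (y, x)]"] by simp
  then show "card {p \<in> X. Transposition.transpose (fst p) (snd p) = \<sigma>} \<le> 2"
    by (intro order_trans[OF card_mono[OF _ sub]]) simp_all
qed

text \<open>A transposition other than the identity comes from at most two ordered pairs, hence the
  factor 2. The many diagonal pairs all give the identity, where h vanishes.\<close>

lemma sum_transpose_le:
  fixes h :: "('v \<Rightarrow> 'v) \<Rightarrow> real"
  assumes "finite V" "h id = 0" "\<And>\<sigma>. 0 \<le> h \<sigma>"
  shows "(\<Sum>x\<in>V. \<Sum>y\<in>V. h (Transposition.transpose x y)) \<le> 2 * (\<Sum>\<sigma>\<in>{Transposition.transpose x y |x y. x \<in> V \<and> y \<in> V}. h \<sigma>)"
proof -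
  let ?t = "\<lambda>p. Transposition.transpose (fst p) (snd p)" and ?T = "{Transposition.transpose x y |x y. x \<in> V \<and> y \<in> V}"
  have T: "?T = ?t ` (V \<times> V)" by force
  have "(\<Sum>x\<in>V. \<Sum>y\<in>V. h (Transposition.transpose x y)) = (\<Sum>p\<in>V \<times> V. h (?t p))"
    by (simp add: sum.cartesian_product case_prod_unfold)
  also have "\<dots> = (\<Sum>\<sigma>\<in>?T. \<Sum>p | p \<in> V \<times> V \<and> ?t p = \<sigma>. h (?t p))"
    unfolding T using assms(1) by (intro sum.image_gen) auto
  also have "\<dots> \<le> (\<Sum>\<sigma>\<in>?T. 2 * h \<sigma>)"
  proof (rule sum_mono)
    fix \<sigma> assume "\<sigma> \<in> ?T"
    have "(\<Sum>p | p \<in> V \<times> V \<and> ?t p = \<sigma>. h (?t p)) = real (card {p \<in> V \<times> V. ?t p = \<sigma>}) * h \<sigma>"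
      by (simp add: )
    also have "\<dots> \<le> 2 * h \<sigma>"
    proof (cases "\<sigma> = id")
      case True
      then show ?thesis using assms(2) by simp
    next
      case False
      then show ?thesis
        using card_transpose_fiber(2)[OF False, of "V \<times> V"] assms(3)[of \<sigma>] by (intro mult_right_mono) auto
    qed
    finally show "(\<Sum>p | p \<in> V \<times> V \<and> ?t p = \<sigma>. h (?t p)) \<le> 2 * h \<sigma>" .
  qed
  finally show ?thesis by (simp add: sum_distrib_left)
qed

text \<open>Twice the variance is the double sum of \<open>\<mu> \<sigma> * \<mu> \<tau> * (a \<tau>
  - a \<sigma>)\<^sup>2\<close>; the bound keeps only the terms with \<tau> = \<open>id\<close>,
  whose mass is at least p0.\<close>

lemma perm_weights_variance:
  assumes "finite V" "perm_weights V \<mu>" "p0 \<le> \<mu> id"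
  shows "p0 * (\<Sum>\<sigma> | \<sigma> permutes V. \<mu> \<sigma> * (a id - a \<sigma>)\<^sup>2)
    \<le> 2 * ((\<Sum>\<sigma> | \<sigma> permutes V. \<mu> \<sigma> * (a \<sigma>)\<^sup>2) - (\<Sum>\<sigma> | \<sigma> permutes V. \<mu> \<sigma> * a \<sigma>)\<^sup>2)"
proof -
  let ?P = "{\<sigma>. \<sigma> permutes V}"
  have fin: "finite ?P" using assms(1) by (rule finite_permutations)
  have nn: "0 \<le> \<mu> \<sigma>" if "\<sigma> \<in> ?P" for \<sigma> using assms(2) that by (auto simp: perm_weights_def)
  have one: "sum \<mu> ?P = 1" using assms(2) by (auto simp: perm_weights_def)
  define r where "r \<tau> = (\<Sum>\<sigma>\<in>?P. \<mu> \<sigma> * (a \<tau> - a \<sigma>)\<^sup>2)" for \<tau>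
  have r0: "0 \<le> r \<tau>" for \<tau> unfolding r_def using nn by (intro sum_nonneg) auto
  have "p0 * r id \<le> \<mu> id * r id" using assms(3) r0 by (intro mult_right_mono)
  also have "\<dots> \<le> (\<Sum>\<tau>\<in>?P. \<mu> \<tau> * r \<tau>)"
    using fin nn r0 by (intro member_le_sum[of id]) (auto intro: permutes_id)
  also have "\<dots> = 2 * ((\<Sum>\<sigma>\<in>?P. \<mu> \<sigma> * (a \<sigma>)\<^sup>2) - (\<Sum>\<sigma>\<in>?P. \<mu> \<sigma> * a \<sigma>)\<^sup>2)"
  proof -
    let ?m1 = "\<Sum>\<sigma>\<in>?P. \<mu> \<sigma> * a \<sigma>" and ?m2 = "\<Sum>\<sigma>\<in>?P. \<mu> \<sigma> * (a \<sigma>)\<^sup>2"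
    have r_eq: "r \<tau> = (a \<tau>)\<^sup>2 - 2 * a \<tau> * ?m1 + ?m2" for \<tau>
    proof -
      have "r \<tau> = (\<Sum>\<sigma>\<in>?P. (a \<tau>)\<^sup>2 * \<mu> \<sigma> - 2 * a \<tau> * (\<mu> \<sigma> * a \<sigma>) + \<mu> \<sigma> * (a \<sigma>)\<^sup>2)"
        unfolding r_def by (intro sum.cong refl) (simp add: power2_eq_square algebra_simps)
      then show ?thesis
        by (simp add: sum.distrib sum_subtractf one flip: sum_distrib_left)
    qed
    have "(\<Sum>\<tau>\<in>?P. \<mu> \<tau> * r \<tau>) = (\<Sum>\<tau>\<in>?P. \<mu> \<tau> * (a \<tau>)\<^sup>2 - 2 * ?m1 * (\<mu> \<tau> * a \<tau>) + ?m2 * \<mu> \<tau>)"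
      unfolding r_eq by (intro sum.cong refl) (simp add: algebra_simps)
    also have "\<dots> = ?m2 - 2 * ?m1 * ?m1 + ?m2"
      by (simp add: sum.distrib sum_subtractf one flip: sum_distrib_left)
    finally show ?thesis by (simp add: power2_eq_square)
  qed
  finally show ?thesis by (simp add: r_def)
qed

lemma swap_energy_dissipation:
  assumes "finite V" and \<mu>: "perm_weights V \<mu>"
    and p: "0 \<le> p0" "p0 \<le> \<mu> id" "0 \<le> p1"
    and p1: "\<And>x y. x \<in> V \<Longrightarrow> y \<in> V \<Longrightarrow> x \<noteq> y \<Longrightarrow> p1 \<le> \<mu> (Transposition.transpose x y)"
  shows "p0 * p1 * swap_energy V g \<le> 4 * (cube_avg V (\<lambda>A. (g A)\<^sup>2) - cube_avg V (\<lambda>A. (perm_avg V \<mu> g A)\<^sup>2))"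
proof -
  let ?P = "{\<sigma>. \<sigma> permutes V}" and ?T = "{Transposition.transpose x y |x y. x \<in> V \<and> y \<in> V}"
  have fin: "finite ?P" using assms(1) by (rule finite_permutations)
  have TP: "?T \<subseteq> ?P" by (auto intro: permutes_swap_id)
  have pt: "p1 * (\<Sum>\<tau>\<in>?T. (g A - g (\<tau> ` A))\<^sup>2) \<le> (\<Sum>\<sigma>\<in>?P. \<mu> \<sigma> * (g (id ` A) - g (\<sigma> ` A))\<^sup>2)" for A
  proof -
    have "p1 * (\<Sum>\<tau>\<in>?T. (g A - g (\<tau> ` A))\<^sup>2) \<le> (\<Sum>\<tau>\<in>?T. \<mu> \<tau> * (g A - g (\<tau> ` A))\<^sup>2)"
      unfolding sum_distrib_left
    proof (rule sum_mono)
      fix \<tau> assume "\<tau> \<in> ?T"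
      then obtain x y where xy: "\<tau> = Transposition.transpose x y" "x \<in> V" "y \<in> V" by auto
      show "p1 * (g A - g (\<tau> ` A))\<^sup>2 \<le> \<mu> \<tau> * (g A - g (\<tau> ` A))\<^sup>2"
        using xy p1[of x y] by (cases "x = y") (auto intro: mult_right_mono)
    qed
    also have "\<dots> \<le> (\<Sum>\<sigma>\<in>?P. \<mu> \<sigma> * (g A - g (\<sigma> ` A))\<^sup>2)"
      using fin TP \<mu> by (intro sum_mono2) (auto simp: perm_weights_def)
    finally show ?thesis by simp
  qed
  have half: "p1 * (\<Sum>x\<in>V. \<Sum>y\<in>V. (g A - g (Transposition.transpose x y ` A))\<^sup>2)
      \<le> 2 * (\<Sum>\<sigma>\<in>?P. \<mu> \<sigma> * (g (id ` A) - g (\<sigma> ` A))\<^sup>2)" for A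
  proof -
    have "p1 * (\<Sum>x\<in>V. \<Sum>y\<in>V. (g A - g (Transposition.transpose x y ` A))\<^sup>2)
       \<le> p1 * (2 * (\<Sum>\<tau>\<in>?T. (g A - g (\<tau> ` A))\<^sup>2))"
      using p(3) assms(1)
      by (intro mult_left_mono sum_transpose_le[where h = "\<lambda>\<tau>. (g A - g (\<tau> ` A))\<^sup>2"]) auto
    then show ?thesis using pt[of A] by linarith
  qed
  have energy: "swap_energy V g = cube_avg V (\<lambda>A. \<Sum>x\<in>V. \<Sum>y\<in>V. (g A - g (Transposition.transpose x y ` A))\<^sup>2)"
    by (simp add: swap_energy_def cube_avg_sum)
  have "p0 * p1 * swap_energy V g
      = cube_avg V (\<lambda>A. p0 * (p1 * (\<Sum>x\<in>V. \<Sum>y\<in>V. (g A - g (Transposition.transpose x y ` A))\<^sup>2)))"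
    unfolding energy by (simp add: cube_avg_cmult)
  also have "\<dots> \<le> cube_avg V (\<lambda>A. 4 * ((\<Sum>\<sigma>\<in>?P. \<mu> \<sigma> * (g (\<sigma> ` A))\<^sup>2) - (perm_avg V \<mu> g A)\<^sup>2))"
  proof (rule cube_avg_mono)
    fix A assume "A \<subseteq> V"
    have "p0 * (p1 * (\<Sum>x\<in>V. \<Sum>y\<in>V. (g A - g (Transposition.transpose x y ` A))\<^sup>2))
       \<le> p0 * (2 * (\<Sum>\<sigma>\<in>?P. \<mu> \<sigma> * (g (id ` A) - g (\<sigma> ` A))\<^sup>2))"
      using half p(1) by (intro mult_left_mono)
    also have "\<dots> \<le> 2 * (2 * ((\<Sum>\<sigma>\<in>?P. \<mu> \<sigma> * (g (\<sigma> ` A))\<^sup>2) - (\<Sum>\<sigma>\<in>?P. \<mu> \<sigma> * g (\<sigma> ` A))\<^sup>2))"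
      using perm_weights_variance[OF assms(1) \<mu> p(2), of "\<lambda>\<sigma>. g (\<sigma> ` A)"] by simp
    finally show "p0 * (p1 * (\<Sum>x\<in>V. \<Sum>y\<in>V. (g A - g (Transposition.transpose x y ` A))\<^sup>2))
       \<le> 4 * ((\<Sum>\<sigma>\<in>?P. \<mu> \<sigma> * (g (\<sigma> ` A))\<^sup>2) - (perm_avg V \<mu> g A)\<^sup>2)"
      by (simp add: perm_avg_def)
  qed
  also have "\<dots> = 4 * (cube_avg V (perm_avg V \<mu> (\<lambda>A. (g A)\<^sup>2)) - cube_avg V (\<lambda>A. (perm_avg V \<mu> g A)\<^sup>2))"
    by (simp add: cube_avg_cmult cube_avg_diff perm_avg_def[abs_def])
  also have "\<dots> = 4 * (cube_avg V (\<lambda>A. (g A)\<^sup>2) - cube_avg V (\<lambda>A. (perm_avg V \<mu> g A)\<^sup>2))"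
    using \<mu> by (simp add: cube_avg_perm_avg)
  finally show ?thesis .
qed

text \<open>The energy never increases and the losses of squared norm telescope, so M times the
  final energy is controlled by the initial squared norm. This is the discrete form of the bound of
  the Dirichlet energy at time t by the squared norm over 2 t, obtained without spectral
  theory.\<close>

lemma swap_energy_iterate:
  assumes "finite V" and \<mu>: "perm_weights V \<mu>"
    and p: "0 \<le> p0" "p0 \<le> \<mu> id" "0 \<le> p1"
    and p1: "\<And>x y. x \<in> V \<Longrightarrow> y \<in> V \<Longrightarrow> x \<noteq> y \<Longrightarrow> p1 \<le> \<mu> (Transposition.transpose x y)"
  shows "M * (p0 * p1) * swap_energy V ((perm_avg V \<mu> ^^ M) g) \<le> 4 * cube_avg V (\<lambda>A. (g A)\<^sup>2)"
proof -
  let ?q = "\<lambda>j. cube_avg V (\<lambda>A. ((perm_avg V \<mu> ^^ j) g A)\<^sup>2)"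
  let ?s = "\<lambda>j. swap_energy V ((perm_avg V \<mu> ^^ j) g)"
  have step: "p0 * p1 * ?s j \<le> 4 * (?q j - ?q (Suc j))" for j
    using swap_energy_dissipation[OF assms, of "(perm_avg V \<mu> ^^ j) g"] by simp
  have "?s (Suc j) \<le> ?s j" for j
    using swap_energy_perm_avg_le[OF \<mu>, of "(perm_avg V \<mu> ^^ j) g"] by simp
  then have "decseq ?s" by (simp add: decseq_Suc_iff)
  then have dec: "?s M \<le> ?s j" if "j \<le> M" for j using that by (simp add: decseq_def)
  have "M * (p0 * p1) * ?s M = (\<Sum>j<M. p0 * p1 * ?s M)" by simp
  also have "\<dots> \<le> (\<Sum>j<M. 4 * (?q j - ?q (Suc j)))"
  proof (rule sum_mono)
    fix j assume "j \<in> {..<M}"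
    then have "p0 * p1 * ?s M \<le> p0 * p1 * ?s j" using p dec[of j] by (intro mult_left_mono) auto
    then show "p0 * p1 * ?s M \<le> 4 * (?q j - ?q (Suc j))" using step[of j] by linarith
  qed
  also have "\<dots> = 4 * (?q 0 - ?q M)"
    by (simp only: sum_distrib_left[symmetric] sum_lessThan_telescope'[of ?q])
  also have "\<dots> \<le> 4 * ?q 0" using cube_avg_nonneg[of V "\<lambda>A. ((perm_avg V \<mu> ^^ M) g A)\<^sup>2"] by simp
  finally show ?thesis by simp
qed

section \<open>Influences\<close>

lemma cube_avg_spin_sum:
  assumes "finite V"
  shows "cube_avg V (\<lambda>A. (\<Sum>i\<in>V. spin A i)\<^sup>2) = card V"
proof -
  have "cube_avg V (\<lambda>A. (\<Sum>i\<in>V. spin A i)\<^sup>2) = (\<Sum>i\<in>V. \<Sum>j\<in>V. cube_avg V (\<lambda>A. walsh {i} A * walsh {j} A))"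
    unfolding cube_avg_sum[symmetric] by (simp add: power2_eq_square sum_product walsh_def)
  also have "\<dots> = (\<Sum>i\<in>V. \<Sum>j\<in>V. if j = i then 1 else 0)"
    using assms by (intro sum.cong refl) (auto simp: walsh_orthogonal)
  finally show ?thesis using assms by simp
qed

text \<open>Chebyshev: the spin sum is \<open>card V\<close> minus twice the number of zeros, has
  variance \<open>card V\<close>, and is at least \<open>card V / 2\<close> on this event. The rate
  matters, since the event is later weighted by \<open>card V\<close>.\<close>

lemma cube_prob_few_zeros:
  assumes "finite V" "V \<noteq> {}"
  shows "cube_prob V (\<lambda>A. card (V - A) < card V / 4) \<le> 4 / card V"
proof -
  let ?N = "real (card V)"
  have N: "?N > 0" using assms by (simp add: card_gt_0_iff)
  have "cube_prob V (\<lambda>A. card (V - A) < ?N / 4) \<le> cube_avg V (\<lambda>A. 4 / ?N\<^sup>2 * (\<Sum>i\<in>V. spin A i)\<^sup>2)"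
    unfolding cube_prob_def
  proof (rule cube_avg_mono)
    fix A assume A: "A \<subseteq> V"
    have "(\<Sum>i\<in>V. spin A i) = (\<Sum>i\<in>V. 1 - 2 * of_bool (i \<in> V - A))"
      by (intro sum.cong refl) (auto simp: spin_def)
    also have "\<dots> = ?N - 2 * card (V - A)"
    proof -
      have "(\<Sum>i\<in>V. of_bool (i \<in> S) :: real) = card S" if "S \<subseteq> V" for S
        using assms(1) that by (simp add: Int_absorb1)
      then show ?thesis by (simp only: sum_subtractf sum_distrib_left[symmetric] Diff_subset) simp
    qed
    finally have s: "(\<Sum>i\<in>V. spin A i) = ?N - 2 * card (V - A)" .
    show "of_bool (card (V - A) < ?N / 4) \<le> 4 / ?N\<^sup>2 * (\<Sum>i\<in>V. spin A i)\<^sup>2"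
    proof (cases "card (V - A) < ?N / 4")
      case True
      then have "?N / 2 \<le> (\<Sum>i\<in>V. spin A i)" using s by linarith
      then have "(?N / 2)\<^sup>2 \<le> (\<Sum>i\<in>V. spin A i)\<^sup>2" using N by (intro power_mono) auto
      then show ?thesis using N True by (simp add: field_simps power2_eq_square)
    qed simp
  qed
  also have "\<dots> = 4 / ?N"
    unfolding cube_avg_cmult cube_avg_spin_sum[OF assms(1)] using N by (simp add: power2_eq_square)
  finally show ?thesis .
qed

definition total_influence :: "'v set \<Rightarrow> ('v set \<Rightarrow> real) \<Rightarrow> real" where
  "total_influence V g = (\<Sum>i\<in>V. cube_avg V (\<lambda>A. (g A - g (flip i A))\<^sup>2))"

text \<open>Flipping i negates the characters containing i and fixes the others, so the difference
  has twice the coefficient of g on the former; squaring gives the 4, and summing over i gives the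
  size of S.\<close>

lemma total_influence_fourier:
  assumes "finite V"
  shows "total_influence V g = 4 * (\<Sum>S\<in>Pow V. card S * (fourier V g S)\<^sup>2)"
proof -
  have four: "fourier V (\<lambda>A. g A - g (flip i A)) S = 2 * of_bool (i \<in> S) * fourier V g S"
    if "i \<in> V" "S \<subseteq> V" for i S
  proof -
    have finS: "finite S" using that assms finite_subset by auto
    have "cube_avg V (\<lambda>A. g (flip i A) * walsh S A) = cube_avg V (\<lambda>A. g A * walsh S (flip i A))"
      using cube_avg_flip[OF that(1), of "\<lambda>A. g A * walsh S (flip i A)"] by simp
    also have "\<dots> = (if i \<in> S then -1 else 1) * fourier V g S"
      by (simp add: walsh_flip[OF finS] fourier_def cube_avg_minus)
    finally show ?thesis by (simp add: fourier_def left_diff_distrib cube_avg_diff)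
  qed
  have "total_influence V g = (\<Sum>i\<in>V. \<Sum>S\<in>Pow V. 4 * of_bool (i \<in> S) * (fourier V g S)\<^sup>2)"
    unfolding total_influence_def power2_eq_square Parseval[OF assms]
    by (intro sum.cong refl) (simp add: four)
  also have "\<dots> = (\<Sum>S\<in>Pow V. \<Sum>i\<in>V. 4 * of_bool (i \<in> S) * (fourier V g S)\<^sup>2)" by (rule sum.swap)
  also have "\<dots> = (\<Sum>S\<in>Pow V. 4 * (card S * (fourier V g S)\<^sup>2))"
  proof (intro sum.cong refl)
    fix S assume "S \<in> Pow V"
    then have "(\<Sum>i\<in>V. of_bool (i \<in> S) :: real) = card S"
      using assms by (simp add: Int_absorb1)
    then show "(\<Sum>i\<in>V. 4 * of_bool (i \<in> S) * (fourier V g S)\<^sup>2) = 4 * (card S * (fourier V g S)\<^sup>2)"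
      by (simp flip: sum_distrib_right sum_distrib_left)
  qed
  finally show ?thesis by (simp add: sum_distrib_left)
qed

text \<open>Parseval split by level. The empty set contributes the product of the means; levels 1 to
  K are charged to g by Cauchy-Schwarz; above K the weight of F is at most its influence over 4 (K +
  1).\<close>

lemma covariance_le:
  assumes "finite V" and F: "\<And>A. A \<subseteq> V \<Longrightarrow> \<bar>F A\<bar> \<le> 1" and g: "\<And>A. A \<subseteq> V \<Longrightarrow> \<bar>g A\<bar> \<le> 1"
  shows "\<bar>cube_avg V (\<lambda>A. F A * g A) - cube_avg V F * cube_avg V g\<bar>
    \<le> sqrt (\<Sum>k=1..K. level_weight V g k) + sqrt (total_influence V F / (4 * real (Suc K)))"
proof -
  let ?L = "{S \<in> Pow V. card S \<in> {1..K}}" and ?H = "{S \<in> Pow V. K < card S}"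
  let ?f = "fourier V F" and ?g = "fourier V g"
  have Pow: "Pow V = {{}} \<union> ?L \<union> ?H"
  proof -
    have "S = {}" if "S \<subseteq> V" "\<not> K < card S" "card S \<notin> {1..K}" for S
      using that assms(1) finite_subset[of S V] by (cases "card S = 0") auto
    then show ?thesis by auto
  qed
  have sq: "cube_avg V (\<lambda>A. (h A)\<^sup>2) \<le> 1" if "\<And>A. A \<subseteq> V \<Longrightarrow> \<bar>h A\<bar> \<le> 1" for h :: "'a set \<Rightarrow> real"
    using that assms(1) by (intro cube_avg_le_const) (auto simp: abs_square_le_1)
  have le1: "(\<Sum>S\<in>X. (fourier V h S)\<^sup>2) \<le> 1" if "X \<subseteq> Pow V" "\<And>A. A \<subseteq> V \<Longrightarrow> \<bar>h A\<bar> \<le> 1" for X h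
  proof -
    have "cube_avg V (\<lambda>A. (h A)\<^sup>2) \<le> 1" by (rule sq) (rule that(2))
    then show ?thesis using Bessel_walsh[OF assms(1) that(1), of h] by linarith
  qed
  have "cube_avg V (\<lambda>A. F A * g A) = (\<Sum>S\<in>{{}} \<union> ?L \<union> ?H. ?f S * ?g S)"
    unfolding Parseval[OF assms(1)] by (rule sum.cong[OF Pow refl])
  also have "\<dots> = ?f {} * ?g {} + (\<Sum>S\<in>?L. ?f S * ?g S) + (\<Sum>S\<in>?H. ?f S * ?g S)"
    using assms(1) by (subst sum.union_disjoint; force?)+
  finally have eq: "cube_avg V (\<lambda>A. F A * g A) - cube_avg V F * cube_avg V g
      = (\<Sum>S\<in>?L. ?f S * ?g S) + (\<Sum>S\<in>?H. ?f S * ?g S)"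
    by (simp add: fourier_def walsh_def)
  have CS: "\<bar>\<Sum>S\<in>X. ?f S * ?g S\<bar> \<le> sqrt (\<Sum>S\<in>X. (?f S)\<^sup>2) * sqrt (\<Sum>S\<in>X. (?g S)\<^sup>2)" for X
    using Cauchy_Schwarz_ineq_sum[of ?f ?g X] real_sqrt_le_mono by (fastforce simp: real_sqrt_mult)
  have "(\<Sum>S\<in>?L. (?g S)\<^sup>2) = (\<Sum>k\<in>{1..K}. \<Sum>S | S \<in> ?L \<and> card S = k. (?g S)\<^sup>2)"
    using assms(1) by (intro sum.group[symmetric]) auto
  also have "\<dots> = (\<Sum>k=1..K. level_weight V g k)"
    unfolding level_weight_def by (intro sum.cong refl) (auto intro: Collect_cong)
  finally have L: "(\<Sum>S\<in>?L. (?g S)\<^sup>2) = (\<Sum>k=1..K. level_weight V g k)" .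
  have "sqrt (\<Sum>S\<in>?L. (?f S)\<^sup>2) * sqrt (\<Sum>S\<in>?L. (?g S)\<^sup>2) \<le> 1 * sqrt (\<Sum>S\<in>?L. (?g S)\<^sup>2)"
    using le1[of ?L F] F by (intro mult_right_mono) (auto simp: sum_nonneg)
  then have low: "\<bar>\<Sum>S\<in>?L. ?f S * ?g S\<bar> \<le> sqrt (\<Sum>k=1..K. level_weight V g k)"
    unfolding L[symmetric] using CS[of ?L] by linarith
  have "real (Suc K) * (\<Sum>S\<in>?H. (?f S)\<^sup>2) \<le> (\<Sum>S\<in>?H. card S * (?f S)\<^sup>2)"
    unfolding sum_distrib_left by (intro sum_mono mult_right_mono) auto
  also have "\<dots> \<le> (\<Sum>S\<in>Pow V. card S * (?f S)\<^sup>2)"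
    using assms(1) by (intro sum_mono2) auto
  also have "\<dots> = total_influence V F / 4" by (simp add: total_influence_fourier[OF assms(1)])
  finally have "(\<Sum>S\<in>?H. (?f S)\<^sup>2) \<le> total_influence V F / (4 * real (Suc K))" by (simp add: field_simps)
  then have "sqrt (\<Sum>S\<in>?H. (?f S)\<^sup>2) \<le> sqrt (total_influence V F / (4 * real (Suc K)))"
    by (rule real_sqrt_le_mono)
  moreover have "sqrt (\<Sum>S\<in>?H. (?f S)\<^sup>2) * sqrt (\<Sum>S\<in>?H. (?g S)\<^sup>2) \<le> sqrt (\<Sum>S\<in>?H. (?f S)\<^sup>2) * 1"
    using le1[of ?H g] g by (intro mult_left_mono) (auto simp: sum_nonneg)
  ultimately have "\<bar>\<Sum>S\<in>?H. ?f S * ?g S\<bar> \<le> sqrt (total_influence V F / (4 * real (Suc K)))"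
    using CS[of ?H] by linarith
  with low show ?thesis unfolding eq by linarith
qed

lemma sum_square_center:
  fixes a :: "'v \<Rightarrow> real"
  assumes "finite Z"
  shows "card Z * (\<Sum>i\<in>Z. (a i)\<^sup>2) = (\<Sum>i\<in>Z. a i)\<^sup>2 + (\<Sum>i\<in>Z. \<Sum>j\<in>Z. (a i - a j)\<^sup>2) / 2"
proof -
  have "(\<Sum>i\<in>Z. \<Sum>j\<in>Z. (a i - a j)\<^sup>2) = (\<Sum>i\<in>Z. \<Sum>j\<in>Z. (a i)\<^sup>2 + (a j)\<^sup>2 - 2 * (a i * a j))"
    by (intro sum.cong refl) (simp add: power2_eq_square algebra_simps)
  also have "\<dots> = 2 * (card Z * (\<Sum>i\<in>Z. (a i)\<^sup>2)) - 2 * (\<Sum>i\<in>Z. a i)\<^sup>2"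
    by (simp add: sum.distrib sum_subtractf power2_eq_square sum_product flip: sum_distrib_left)
  finally show ?thesis by (simp add: field_simps)
qed

text \<open>For zeros i and j of A, swapping i and j in \<open>insert i A\<close> gives
  \<open>insert j A\<close>, so comparing two openings is comparing a configuration with a swap of
  itself. Passing from A to \<open>flip i A\<close> preserves the uniform measure.\<close>

lemma swap_energy_up_le:
  assumes "finite V"
  shows "cube_avg V (\<lambda>A. \<Sum>i\<in>V - A. \<Sum>j\<in>V - A. (F (insert i A) - F (insert j A))\<^sup>2) \<le> swap_energy V F"
proof -
  have "cube_avg V (\<lambda>A. \<Sum>i\<in>V - A. \<Sum>j\<in>V - A. (F (insert i A) - F (insert j A))\<^sup>2)
     \<le> cube_avg V (\<lambda>A. \<Sum>i\<in>V. \<Sum>j\<in>V. (F (flip i A) - F (Transposition.transpose i j ` flip i A))\<^sup>2)"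
  proof (rule cube_avg_mono)
    fix A assume "A \<subseteq> V"
    let ?e = "\<lambda>i j. (F (flip i A) - F (Transposition.transpose i j ` flip i A))\<^sup>2"
    have swap: "Transposition.transpose i j ` insert i A = insert j A" if "i \<notin> A" "j \<notin> A" for i j
    proof -
      have "Transposition.transpose i j ` A = A"
        using that by (force simp: Transposition.transpose_def image_iff)
      then show ?thesis by simp
    qed
    have "(\<Sum>i\<in>V - A. \<Sum>j\<in>V - A. (F (insert i A) - F (insert j A))\<^sup>2) = (\<Sum>i\<in>V - A. \<Sum>j\<in>V - A. ?e i j)"
      by (intro sum.cong refl) (simp add: flip_def swap)
    also have "\<dots> \<le> (\<Sum>i\<in>V - A. \<Sum>j\<in>V. ?e i j)"
      using assms by (intro sum_mono sum_mono2) auto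
    also have "\<dots> \<le> (\<Sum>i\<in>V. \<Sum>j\<in>V. ?e i j)"
      using assms by (intro sum_mono2 sum_nonneg) auto
    finally show "(\<Sum>i\<in>V - A. \<Sum>j\<in>V - A. (F (insert i A) - F (insert j A))\<^sup>2) \<le> (\<Sum>i\<in>V. \<Sum>j\<in>V. ?e i j)" .
  qed
  also have "\<dots> = swap_energy V F"
    unfolding swap_energy_def cube_avg_sum
    by (intro sum.cong refl cube_avg_flip[where g = "\<lambda>A. (F A - F (Transposition.transpose _ _ ` A))\<^sup>2"])
  finally show ?thesis .
qed

text \<open>Among configurations with enough zeros, the gains \<open>F (insert i A) - F A\<close> over the zeros \<open>i\<close> have a
  small mean, by the bound on \<open>up_avg\<close>, and a small variance, by the bound on the swap energy.\<close>

lemma total_influence_le: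
  fixes \<kappa> :: real
  assumes "finite V" "V \<noteq> {}"
    and F: "\<And>A. A \<subseteq> V \<Longrightarrow> 0 \<le> F A \<and> F A \<le> 1"
    and up: "\<And>A. A \<subseteq> V \<Longrightarrow> \<bar>up_avg V F A - F A\<bar> \<le> \<kappa>"
  shows "total_influence V F \<le> 2 * (4 * real (card V) * \<kappa>\<^sup>2 + 2 / real (card V) * swap_energy V F + 4)"
proof -
  let ?N = "real (card V)"
  define a where "a A i = F (insert i A) - F A" for A i
  have N: "?N > 0" using assms by (simp add: card_gt_0_iff)
  have \<kappa>: "0 \<le> \<kappa>" using up[of "{}"] by simp
  have point: "(\<Sum>i\<in>V - A. (a A i)\<^sup>2) \<le> 4 * ?N * \<kappa>\<^sup>2
      + 2 / ?N * (\<Sum>i\<in>V - A. \<Sum>j\<in>V - A. (F (insert i A) - F (insert j A))\<^sup>2)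
      + ?N * of_bool (card (V - A) < ?N / 4)" (is "?l \<le> ?x + ?y + _") if A: "A \<subseteq> V" for A
  proof (cases "card (V - A) < ?N / 4")
    case True
    have "(a A i)\<^sup>2 \<le> 1" if "i \<in> V - A" for i
      using F[of A] F[of "insert i A"] A that by (auto simp: a_def abs_square_le_1)
    then have "?l \<le> (\<Sum>i\<in>V - A. 1)" by (rule sum_mono)
    also have "\<dots> \<le> ?N" using assms(1) by (simp add: card_mono)
    finally have "?l \<le> ?N" .
    moreover have "0 \<le> ?x" using N by simp
    moreover have "0 \<le> ?y" using N by (intro mult_nonneg_nonneg sum_nonneg) auto
    ultimately have "?l \<le> ?x + ?y + ?N" by linarith
    with True show ?thesis by simp
  next
    case False
    let ?z = "real (card (V - A))"
    \<comment> \<open>At least a quarter of the sites are closed, which costs a factor 4 when the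
      sum of squares is recovered from \<open>sum_square_center\<close>.\<close>
    have z: "?N / 4 \<le> ?z" "?z > 0" using False N by linarith+
    have "(\<Sum>i\<in>V - A. a A i) = (\<Sum>i\<in>V. a A i)"
      using assms(1) A by (intro sum.mono_neutral_left) (auto simp: a_def insert_absorb)
    also have "\<dots> = ?N * (up_avg V F A - F A)"
      using N by (simp add: up_avg_def a_def sum_subtractf field_simps)
    finally have s: "\<bar>\<Sum>i\<in>V - A. a A i\<bar> \<le> ?N * \<kappa>"
      using up[OF A] by (simp add: abs_mult mult_left_mono)
    have s2: "(\<Sum>i\<in>V - A. a A i)\<^sup>2 \<le> (?N * \<kappa>)\<^sup>2"
      using power_mono[OF s, of 2] by simp
    have diff: "(\<Sum>i\<in>V - A. \<Sum>j\<in>V - A. (a A i - a A j)\<^sup>2)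
        = (\<Sum>i\<in>V - A. \<Sum>j\<in>V - A. (F (insert i A) - F (insert j A))\<^sup>2)" (is "_ = ?D")
      by (simp add: a_def)
    have D: "0 \<le> ?D" by (intro sum_nonneg) auto
    have "?l \<ge> 0" by (intro sum_nonneg) auto
    then have "?N / 4 * ?l \<le> ?z * ?l" using z by (intro mult_right_mono)
    also have "\<dots> = (\<Sum>i\<in>V - A. a A i)\<^sup>2 + ?D / 2"
      using sum_square_center[of "V - A" "a A"] assms(1) diff by simp
    also have "\<dots> \<le> (?N * \<kappa>)\<^sup>2 + ?D / 2" using s2 by simp
    finally have "?l \<le> ((?N * \<kappa>)\<^sup>2 + ?D / 2) * 4 / ?N" using N by (simp add: field_simps)
    also have "\<dots> = ?x + ?y" using N by (simp add: field_simps power2_eq_square)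
    finally show ?thesis using False by simp
  qed
  \<comment> \<open>The pair of A and \<open>flip i A\<close> is seen from both ends; keeping the
    end where i is closed halves the sum and leaves only gains from opening a site.\<close>
  have half: "cube_avg V (\<lambda>A. (F A - F (flip i A))\<^sup>2) = 2 * cube_avg V (\<lambda>A. of_bool (i \<notin> A) * (a A i)\<^sup>2)"
    if i: "i \<in> V" for i
  proof -
    let ?h = "\<lambda>A. (F A - F (flip i A))\<^sup>2"
    have "cube_avg V ?h = cube_avg V (\<lambda>A. of_bool (i \<in> A) * ?h A + of_bool (i \<notin> A) * ?h A)"
      by (intro cube_avg_cong) auto
    also have "\<dots> = cube_avg V (\<lambda>A. of_bool (i \<in> A) * ?h A) + cube_avg V (\<lambda>A. of_bool (i \<notin> A) * ?h A)"
      by (rule cube_avg_add)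
    also have "cube_avg V (\<lambda>A. of_bool (i \<in> A) * ?h A) = cube_avg V (\<lambda>A. of_bool (i \<in> flip i A) * ?h (flip i A))"
      using cube_avg_flip[OF i, of "\<lambda>A. of_bool (i \<in> A) * ?h A"] by simp
    also have "\<dots> = cube_avg V (\<lambda>A. of_bool (i \<notin> A) * ?h A)"
      by (intro cube_avg_cong) (auto simp: power2_commute, auto simp: flip_def)
    also have "cube_avg V (\<lambda>A. of_bool (i \<notin> A) * ?h A) = cube_avg V (\<lambda>A. of_bool (i \<notin> A) * (a A i)\<^sup>2)"
      by (intro cube_avg_cong) (auto simp: flip_def a_def power2_commute)
    finally show ?thesis by simp
  qed
  have "total_influence V F = 2 * cube_avg V (\<lambda>A. \<Sum>i\<in>V. of_bool (i \<notin> A) * (a A i)\<^sup>2)"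
    by (simp add: total_influence_def half cube_avg_sum sum_distrib_left)
  also have "cube_avg V (\<lambda>A. \<Sum>i\<in>V. of_bool (i \<notin> A) * (a A i)\<^sup>2) = cube_avg V (\<lambda>A. \<Sum>i\<in>V - A. (a A i)\<^sup>2)"
    using assms(1) by (intro cube_avg_cong sum.mono_neutral_cong_right) auto
  also have "\<dots> \<le> cube_avg V (\<lambda>A. 4 * ?N * \<kappa>\<^sup>2
      + 2 / ?N * (\<Sum>i\<in>V - A. \<Sum>j\<in>V - A. (F (insert i A) - F (insert j A))\<^sup>2)
      + ?N * of_bool (card (V - A) < ?N / 4))"
    by (rule cube_avg_mono) (rule point)
  also have "\<dots> = 4 * ?N * \<kappa>\<^sup>2
      + 2 / ?N * cube_avg V (\<lambda>A. \<Sum>i\<in>V - A. \<Sum>j\<in>V - A. (F (insert i A) - F (insert j A))\<^sup>2)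
      + ?N * cube_prob V (\<lambda>A. card (V - A) < ?N / 4)"
    using assms(1) by (simp only: cube_avg_add cube_avg_cmult cube_avg_const cube_prob_def)
  also have "\<dots> \<le> 4 * ?N * \<kappa>\<^sup>2 + 2 / ?N * swap_energy V F + ?N * (4 / ?N)"
    using N by (intro add_mono mult_left_mono swap_energy_up_le cube_prob_few_zeros assms) auto
  finally show ?thesis using N by simp
qed

section \<open>Opening random sites\<close>

lemma up_avg_bounds:
  assumes "finite V" "V \<noteq> {}" "A \<subseteq> V" "\<And>B. B \<subseteq> V \<Longrightarrow> l \<le> g B \<and> g B \<le> u"
  shows "l \<le> up_avg V g A \<and> up_avg V g A \<le> u"
proof -
  have N: "real (card V) > 0" using assms by (simp add: card_gt_0_iff)
  have "l \<le> g (insert i A)" "g (insert i A) \<le> u" if "i \<in> V" for i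
    using assms(3) assms(4)[of "insert i A"] that by auto
  then have "(\<Sum>i\<in>V. l) \<le> (\<Sum>i\<in>V. g (insert i A))" "(\<Sum>i\<in>V. g (insert i A)) \<le> (\<Sum>i\<in>V. u)"
    by (auto intro!: sum_mono simp del: sum_constant)
  then show ?thesis using N by (simp add: up_avg_def field_simps)
qed

lemma up_avg_funpow_bounds:
  assumes "finite V" "V \<noteq> {}" "A \<subseteq> V" "\<And>B. B \<subseteq> V \<Longrightarrow> l \<le> g B \<and> g B \<le> u"
  shows "l \<le> (up_avg V ^^ r) g A \<and> (up_avg V ^^ r) g A \<le> u"
  using assms(3)
proof (induction r arbitrary: A)
  case (Suc r)
  then show ?case using up_avg_bounds[OF assms(1,2) Suc.prems, of l "(up_avg V ^^ r) g" u] by simp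
qed (use assms(4) in auto)

lemma le_up_avg_funpow:
  assumes "finite V" "V \<noteq> {}" "A \<subseteq> V" "\<And>A i. A \<subseteq> V \<Longrightarrow> i \<in> V \<Longrightarrow> g A \<le> g (insert i A)"
  shows "g A \<le> (up_avg V ^^ r) g A"
  using assms(3)
proof (induction r arbitrary: A)
  case (Suc r)
  have N: "real (card V) > 0" using assms by (simp add: card_gt_0_iff)
  have "g A \<le> (up_avg V ^^ r) g (insert i A)" if "i \<in> V" for i
    using Suc.IH[of "insert i A"] assms(4)[OF Suc.prems that] Suc.prems that by auto
  then have "(\<Sum>i\<in>V. g A) \<le> (\<Sum>i\<in>V. (up_avg V ^^ r) g (insert i A))" by (intro sum_mono) auto
  then have "g A \<le> up_avg V ((up_avg V ^^ r) g) A"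
    unfolding up_avg_def[of V "(up_avg V ^^ r) g"] using N by (simp add: field_simps)
  then show ?case by simp
qed simp

lemma up_mean_bounds:
  assumes "finite V" "V \<noteq> {}" "A \<subseteq> V" "R > 0" "\<And>B. B \<subseteq> V \<Longrightarrow> l \<le> g B \<and> g B \<le> u"
  shows "l \<le> up_mean V R g A \<and> up_mean V R g A \<le> u"
proof -
  have "l \<le> (up_avg V ^^ r) g A \<and> (up_avg V ^^ r) g A \<le> u" for r
    by (rule up_avg_funpow_bounds[OF assms(1-3) assms(5)])
  then have "(\<Sum>r<R. l) \<le> (\<Sum>r<R. (up_avg V ^^ r) g A)" "(\<Sum>r<R. (up_avg V ^^ r) g A) \<le> (\<Sum>r<R. u)"
    by (auto intro!: sum_mono simp del: sum_constant)
  then show ?thesis using \<open>R > 0\<close> by (simp add: up_mean_def field_simps)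
qed

lemma le_up_mean:
  assumes "finite V" "V \<noteq> {}" "A \<subseteq> V" "R > 0" "\<And>A i. A \<subseteq> V \<Longrightarrow> i \<in> V \<Longrightarrow> g A \<le> g (insert i A)"
  shows "g A \<le> up_mean V R g A"
proof -
  have "(\<Sum>r<R. g A) \<le> (\<Sum>r<R. (up_avg V ^^ r) g A)"
    by (intro sum_mono le_up_avg_funpow[OF assms(1-3) assms(5)])
  then show ?thesis using \<open>R > 0\<close> by (simp add: up_mean_def field_simps)
qed

text \<open>One more application of \<open>up_avg\<close> shifts the range of r by one, so the
  difference telescopes to the terms r = R and r = 0.\<close>

lemma up_avg_up_mean:
  assumes "finite V" "V \<noteq> {}" "A \<subseteq> V" "R > 0" "\<And>B. B \<subseteq> V \<Longrightarrow> 0 \<le> g B \<and> g B \<le> 1"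
  shows "\<bar>up_avg V (up_mean V R g) A - up_mean V R g A\<bar> \<le> 1 / R"
proof -
  let ?u = "\<lambda>r. (up_avg V ^^ r) g A"
  have "up_avg V (up_mean V R g) A = (\<Sum>r<R. up_avg V ((up_avg V ^^ r) g) A) / R"
  proof -
    have "(\<Sum>i\<in>V. \<Sum>r<R. (up_avg V ^^ r) g (insert i A)) = (\<Sum>r<R. \<Sum>i\<in>V. (up_avg V ^^ r) g (insert i A))"
      by (rule sum.swap)
    then show ?thesis
      by (simp add: up_avg_def[abs_def] up_mean_def mult.commute flip: sum_divide_distrib)
  qed
  also have "\<dots> = (\<Sum>r<R. ?u (Suc r)) / R" by simp
  finally have "up_avg V (up_mean V R g) A - up_mean V R g A = (\<Sum>r<R. ?u (Suc r) - ?u r) / R"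
    by (simp add: up_mean_def sum_subtractf diff_divide_distrib)
  also have "\<dots> = (?u R - ?u 0) / R"
    by (simp only: sum_lessThan_telescope[of ?u])
  finally have eq: "up_avg V (up_mean V R g) A - up_mean V R g A = (?u R - ?u 0) / R" .
  have "0 \<le> ?u r \<and> ?u r \<le> 1" for r
    by (rule up_avg_funpow_bounds[OF assms(1-3) assms(5)])
  from this[of R] this[of 0] have "\<bar>?u R - ?u 0\<bar> \<le> 1" by auto
  then show ?thesis unfolding eq using \<open>R > 0\<close> by (simp add: abs_divide divide_right_mono)
qed

lemma up_avg_perm_avg:
  "up_avg V (perm_avg V \<mu> g) = perm_avg V \<mu> (up_avg V g)"
proof
  fix A
  let ?P = "{\<sigma>. \<sigma> permutes V}"
  have "up_avg V (perm_avg V \<mu> g) A = (\<Sum>\<sigma>\<in>?P. \<Sum>i\<in>V. \<mu> \<sigma> * g (\<sigma> ` insert i A)) / card V"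
    unfolding up_avg_def perm_avg_def by (subst sum.swap) simp
  also have "\<dots> = (\<Sum>\<sigma>\<in>?P. \<mu> \<sigma> * (\<Sum>i\<in>V. g (insert i (\<sigma> ` A)))) / card V"
  proof (intro arg_cong[where f = "\<lambda>x. x / card V"] sum.cong refl)
    fix \<sigma> assume "\<sigma> \<in> ?P"
    then have "bij_betw \<sigma> V V" by (auto intro: permutes_imp_bij)
    from sum.reindex_bij_betw[OF this, of "\<lambda>i. g (insert i (\<sigma> ` A))"]
    show "(\<Sum>i\<in>V. \<mu> \<sigma> * g (\<sigma> ` insert i A)) = \<mu> \<sigma> * (\<Sum>i\<in>V. g (insert i (\<sigma> ` A)))"
      by (simp flip: sum_distrib_left)
  qed
  finally show "up_avg V (perm_avg V \<mu> g) A = perm_avg V \<mu> (up_avg V g) A"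
    by (simp add: perm_avg_def up_avg_def flip: sum_divide_distrib)
qed

text \<open>Opening site i amounts to the density \<open>1 + spin A i\<close>. The mean therefore
  grows by the covariance of g with the average spin, and Cauchy-Schwarz with variance
  \<open>card V\<close> for the spin sum gives the bound.\<close>

lemma cube_avg_up_avg_le:
  assumes "finite V" "V \<noteq> {}" "\<And>A. A \<subseteq> V \<Longrightarrow> 0 \<le> g A \<and> g A \<le> 1"
  shows "cube_avg V (up_avg V g) \<le> cube_avg V g + 1 / sqrt (card V)"
proof -
  let ?N = "real (card V)" and ?Y = "\<lambda>A. \<Sum>i\<in>V. spin A i"
  have N: "?N > 0" using assms by (simp add: card_gt_0_iff)
  have step: "cube_avg V (\<lambda>A. g (insert i A)) = cube_avg V g + cube_avg V (\<lambda>A. spin A i * g A)" if i: "i \<in> V" for i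
  proof -
    have "cube_avg V (\<lambda>A. g (insert i A)) = cube_avg V (\<lambda>A. of_bool (i \<in> A) * g A + of_bool (i \<in> flip i A) * g (flip i A))"
      by (intro cube_avg_cong) (auto simp: flip_def insert_absorb)
    also have "\<dots> = 2 * cube_avg V (\<lambda>A. of_bool (i \<in> A) * g A)"
      using cube_avg_flip[OF i, of "\<lambda>A. of_bool (i \<in> A) * g A"] by (simp add: cube_avg_add)
    also have "\<dots> = cube_avg V (\<lambda>A. g A + spin A i * g A)"
      unfolding cube_avg_cmult[symmetric] by (intro cube_avg_cong) (auto simp: spin_def)
    finally show ?thesis by (simp add: cube_avg_add)
  qed
  have "(cube_avg V (\<lambda>A. ?Y A * g A))\<^sup>2 \<le> cube_avg V (\<lambda>A. (?Y A)\<^sup>2) * cube_avg V (\<lambda>A. (g A)\<^sup>2)"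
    by (rule cube_avg_Cauchy_Schwarz)
  also have "\<dots> \<le> ?N * 1"
    unfolding cube_avg_spin_sum[OF assms(1)] using assms
    by (intro mult_left_mono cube_avg_le_const) (auto simp: power_le_one)
  finally have Y: "cube_avg V (\<lambda>A. ?Y A * g A) \<le> sqrt ?N" by (simp add: real_le_rsqrt)
  have "cube_avg V (up_avg V g) = (\<Sum>i\<in>V. cube_avg V (\<lambda>A. g (insert i A))) / ?N"
    unfolding up_avg_def[abs_def] cube_avg_sum[symmetric] using cube_avg_cmult_right[of V _ "1 / ?N"] by simp
  also have "\<dots> = (\<Sum>i\<in>V. cube_avg V g + cube_avg V (\<lambda>A. spin A i * g A)) / ?N"
    by (simp add: step)
  also have "\<dots> = cube_avg V g + cube_avg V (\<lambda>A. ?Y A * g A) / ?N"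
    using N by (simp add: sum.distrib sum_distrib_right cube_avg_sum add_divide_distrib)
  also have "\<dots> \<le> cube_avg V g + sqrt ?N / ?N"
    using Y N by (simp add: divide_right_mono)
  finally show ?thesis using N by (simp add: sqrt_divide_self_eq inverse_eq_divide)
qed

lemma cube_avg_up_mean_le:
  assumes "finite V" "V \<noteq> {}" "R > 0" "\<And>A. A \<subseteq> V \<Longrightarrow> 0 \<le> g A \<and> g A \<le> 1"
  shows "cube_avg V (up_mean V R g) \<le> cube_avg V g + R / sqrt (card V)"
proof -
  let ?s = "1 / sqrt (card V)"
  have pow: "cube_avg V ((up_avg V ^^ r) g) \<le> cube_avg V g + r * ?s" for r
  proof (induction r)
    case (Suc r)
    have "cube_avg V ((up_avg V ^^ Suc r) g) \<le> cube_avg V ((up_avg V ^^ r) g) + ?s"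
      using cube_avg_up_avg_le[OF assms(1,2), of "(up_avg V ^^ r) g"] up_avg_funpow_bounds[OF assms(1,2) _ assms(4)]
      by simp
    with Suc show ?case by (simp add: algebra_simps add_divide_distrib)
  qed simp
  have "cube_avg V (up_mean V R g) = (\<Sum>r<R. cube_avg V ((up_avg V ^^ r) g)) / R"
    unfolding up_mean_def[abs_def] cube_avg_sum[symmetric] using cube_avg_cmult_right[of V _ "1 / R"] by simp
  also have "\<dots> \<le> (\<Sum>r<R. cube_avg V g + R * ?s) / R"
  proof (intro divide_right_mono sum_mono)
    fix r assume "r \<in> {..<R}"
    then have "real r * ?s \<le> real R * ?s" by (intro mult_right_mono) auto
    then show "cube_avg V ((up_avg V ^^ r) g) \<le> cube_avg V g + R * ?s" using pow[of r] by linarith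
  qed simp
  also have "\<dots> = cube_avg V g + R * ?s" using \<open>R > 0\<close> by simp
  finally show ?thesis by simp
qed

text \<open>Monotonicity bounds \<open>f\<close> by its average \<open>up_mean\<close> over the number of ones, at scale \<open>R\<close>. The
  function \<open>F\<close> below is smooth in all directions, so that its covariance with anything that has
  small Fourier weights at low levels is small.\<close>

lemma monotone_covariance_le:
  fixes f :: "'v set \<Rightarrow> real" and e :: real and R K :: nat
  assumes "finite V" "V \<noteq> {}" "R > 0" and \<mu>: "perm_weights V \<mu>"
    and f01: "\<And>A. A \<subseteq> V \<Longrightarrow> 0 \<le> f A \<and> f A \<le> 1"
    and mono: "\<And>A i. A \<subseteq> V \<Longrightarrow> i \<in> V \<Longrightarrow> f A \<le> f (insert i A)"
    and energy: "\<And>g. (\<And>A. A \<subseteq> V \<Longrightarrow> 0 \<le> g A \<and> g A \<le> 1) \<Longrightarrow> swap_energy V (perm_avg V \<mu> g) \<le> e * card V"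
  shows "\<bar>cube_avg V (\<lambda>A. f A * perm_avg V \<mu> f A) - (cube_avg V f)\<^sup>2\<bar>
    \<le> R / sqrt (card V) + sqrt (\<Sum>k=1..K. level_weight V f k)
      + sqrt ((4 * real (card V) / (real R)\<^sup>2 + 2 * e + 4) / (2 * real (Suc K)))"
proof -
  let ?N = "real (card V)" and ?P = "perm_avg V \<mu>"
  define F where "F = ?P (up_mean V R f)"
  define c where "c = cube_avg V f"
  define \<eta> where "\<eta> = sqrt (\<Sum>k=1..K. level_weight V f k)
      + sqrt ((4 * ?N / (real R)\<^sup>2 + 2 * e + 4) / (2 * real (Suc K)))"
  have N: "?N > 0" using assms by (simp add: card_gt_0_iff)
  have B01: "0 \<le> up_mean V R f A \<and> up_mean V R f A \<le> 1" if "A \<subseteq> V" for A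
    using up_mean_bounds[OF assms(1,2) that assms(3) f01] .
  have F01: "0 \<le> F A \<and> F A \<le> 1" if "A \<subseteq> V" for A
    unfolding F_def by (rule perm_avg_bounds[OF \<mu> that B01])
  have Pf: "?P f A \<le> F A" if "A \<subseteq> V" for A
    unfolding F_def by (rule perm_avg_mono[OF \<mu> that]) (rule le_up_mean[OF assms(1,2) _ assms(3) mono])
  have up: "\<bar>up_avg V F A - F A\<bar> \<le> 1 / R" if "A \<subseteq> V" for A
  proof -
    have "up_avg V F A - F A = ?P (\<lambda>A. up_avg V (up_mean V R f) A - up_mean V R f A) A"
      unfolding F_def up_avg_perm_avg perm_avg_diff ..
    also have "\<bar>\<dots>\<bar> \<le> 1 / R"
    proof -
      have "- (1 / R) \<le> up_avg V (up_mean V R f) B - up_mean V R f B \<and>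
          up_avg V (up_mean V R f) B - up_mean V R f B \<le> 1 / R" (is "_ \<le> ?g B \<and> _") if "B \<subseteq> V" for B
      proof -
        have "\<bar>up_avg V (up_mean V R f) B - up_mean V R f B\<bar> \<le> 1 / R"
          by (rule up_avg_up_mean[OF assms(1,2) that assms(3)]) (rule f01)
        then show ?thesis by linarith
      qed
      then have "- (1 / R) \<le> ?P ?g A \<and> ?P ?g A \<le> 1 / R"
        by (rule perm_avg_bounds[OF \<mu> \<open>A \<subseteq> V\<close>])
      then show ?thesis by linarith
    qed
    finally show ?thesis .
  qed
  have "total_influence V F \<le> 2 * (4 * ?N * (1 / R)\<^sup>2 + 2 / ?N * swap_energy V F + 4)"
    by (rule total_influence_le[OF assms(1,2)]) (use F01 up in auto)
  also have "\<dots> \<le> 2 * (4 * ?N * (1 / R)\<^sup>2 + 2 / ?N * (e * ?N) + 4)"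
    using energy[OF B01] N unfolding F_def by (intro mult_left_mono add_mono) auto
  also have "\<dots> = 2 * (4 * ?N / (real R)\<^sup>2 + 2 * e + 4)" using N by (simp add: power_divide)
  finally have "total_influence V F \<le> 2 * (4 * ?N / (real R)\<^sup>2 + 2 * e + 4)" .
  moreover have "t / (4 * y) \<le> x / (2 * y)" if "t \<le> 2 * x" "y > 0" for t x y :: real
    using that by (simp add: field_simps)
  ultimately have infl: "total_influence V F / (4 * real (Suc K)) \<le> (4 * ?N / (real R)\<^sup>2 + 2 * e + 4) / (2 * real (Suc K))"
    using of_nat_0_less_iff zero_less_Suc by blast
  have "\<bar>F A\<bar> \<le> 1" "\<bar>f A\<bar> \<le> 1" if "A \<subseteq> V" for A
    using F01[OF that] f01[OF that] by simp_all
  then have "\<bar>cube_avg V (\<lambda>A. F A * f A) - cube_avg V F * cube_avg V f\<bar>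
      \<le> sqrt (\<Sum>k=1..K. level_weight V f k) + sqrt (total_influence V F / (4 * real (Suc K)))"
    by (rule covariance_le[OF assms(1)])
  then have cov: "\<bar>cube_avg V (\<lambda>A. F A * f A) - cube_avg V F * c\<bar> \<le> \<eta>"
    using real_sqrt_le_mono[OF infl] unfolding c_def \<eta>_def by linarith
  have EF: "cube_avg V F \<le> c + R / sqrt ?N"
    using cube_avg_up_mean_le[OF assms(1-3) f01] cube_avg_perm_avg[OF \<mu>] unfolding F_def c_def by simp
  have c01: "0 \<le> c" "c \<le> 1"
    unfolding c_def using f01 assms(1) by (auto intro: cube_avg_nonneg cube_avg_le_const)
  have s: "0 \<le> R / sqrt ?N" by simp
  \<comment> \<open>Upper half: the domination of \<open>?P f\<close> by F is tested against f; then
    F and f are nearly uncorrelated, and their means are close.\<close>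
  have "cube_avg V (\<lambda>A. f A * ?P f A) \<le> cube_avg V (\<lambda>A. F A * f A)"
  proof (rule cube_avg_mono)
    fix A assume A: "A \<subseteq> V"
    show "f A * ?P f A \<le> F A * f A"
      using mult_left_mono[OF Pf[OF A], of "f A"] f01[OF A] by (simp add: mult.commute)
  qed
  also have "\<dots> \<le> cube_avg V F * c + \<eta>" using cov by linarith
  also have "\<dots> \<le> (c + R / sqrt ?N) * c + \<eta>" using EF c01 by (intro add_mono mult_right_mono) auto
  also have "\<dots> = c\<^sup>2 + R / sqrt ?N * c + \<eta>" by (simp add: power2_eq_square algebra_simps)
  also have "\<dots> \<le> c\<^sup>2 + R / sqrt ?N + \<eta>" using mult_left_mono[OF c01(2) s] by simp
  finally have upper: "cube_avg V (\<lambda>A. f A * ?P f A) \<le> c\<^sup>2 + R / sqrt ?N + \<eta>" .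
  \<comment> \<open>Lower half: the same domination tested against 1 - f. As \<open>?P\<close>
    preserves the mean, the left side is the mean of \<open>?P f\<close> times 1 - f.\<close>
  have "c - cube_avg V (\<lambda>A. f A * ?P f A) = cube_avg V (\<lambda>A. ?P f A * (1 - f A))"
    by (simp add: right_diff_distrib cube_avg_diff cube_avg_perm_avg[OF \<mu>] c_def mult.commute[of "f _"])
  also have "\<dots> \<le> cube_avg V (\<lambda>A. F A * (1 - f A))"
    using Pf f01 by (intro cube_avg_mono mult_right_mono) auto
  also have "\<dots> = cube_avg V F - cube_avg V (\<lambda>A. F A * f A)"
    by (simp add: right_diff_distrib cube_avg_diff)
  also have "\<dots> \<le> cube_avg V F * (1 - c) + \<eta>" using cov by (simp add: right_diff_distrib)
  also have "\<dots> \<le> (c + R / sqrt ?N) * (1 - c) + \<eta>" using EF c01 by (intro add_mono mult_right_mono) auto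
  also have "\<dots> = c - c\<^sup>2 + R / sqrt ?N * (1 - c) + \<eta>" by (simp add: power2_eq_square algebra_simps)
  also have "\<dots> \<le> c - c\<^sup>2 + R / sqrt ?N + \<eta>" using mult_left_mono[of "1 - c" 1, OF _ s] c01 by simp
  finally have "c\<^sup>2 - R / sqrt ?N - \<eta> \<le> cube_avg V (\<lambda>A. f A * ?P f A)" by linarith
  with upper show ?thesis unfolding c_def \<eta>_def by linarith
qed

section \<open>Open clusters\<close>

definition conn :: "('v \<Rightarrow> 'v \<Rightarrow> bool) \<Rightarrow> 'v set \<Rightarrow> 'v \<Rightarrow> 'v \<Rightarrow> bool" where
  "conn E X u v \<longleftrightarrow> u \<in> X \<and> (\<lambda>x y. E x y \<and> y \<in> X)\<^sup>*\<^sup>* u v"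

lemma conn_refl: "u \<in> X \<Longrightarrow> conn E X u u"
  by (simp add: conn_def)

lemma conn_step: "conn E X u v \<Longrightarrow> E v w \<Longrightarrow> w \<in> X \<Longrightarrow> conn E X u w"
  unfolding conn_def by (auto intro: rtranclp.rtrancl_into_rtrancl)

lemma conn_induct [consumes 1, case_names refl step]:
  assumes "conn E X u v" and "u \<in> X \<Longrightarrow> P u"
    and "\<And>v w. conn E X u v \<Longrightarrow> P v \<Longrightarrow> E v w \<Longrightarrow> w \<in> X \<Longrightarrow> P w"
  shows "P v"
proof -
  have "u \<in> X" "(\<lambda>x y. E x y \<and> y \<in> X)\<^sup>*\<^sup>* u v" using assms(1) by (auto simp: conn_def)
  from this(2) show ?thesis
    by (induction rule: rtranclp_induct) (use assms(2,3) \<open>u \<in> X\<close> in \<open>auto simp: conn_def\<close>)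
qed

lemma conn_left: "conn E X u v \<Longrightarrow> u \<in> X"
  by (simp add: conn_def)

lemma conn_right: "conn E X u v \<Longrightarrow> v \<in> X"
  by (induction rule: conn_induct)

lemma conn_trans: "conn E X u v \<Longrightarrow> conn E X v w \<Longrightarrow> conn E X u w"
  unfolding conn_def by auto

lemma conn_sym:
  assumes "symp E" "conn E X u v"
  shows "conn E X v u"
  using assms(2)
proof (induction rule: conn_induct)
  case (step v w)
  then have "conn E X w v" using conn_step[OF conn_refl[of w X E]] assms(1) conn_right
    by (metis sympD)
  then show ?case using step conn_trans by metis
qed (rule conn_refl)

lemma conn_mono: "conn E X u v \<Longrightarrow> X \<subseteq> Z \<Longrightarrow> conn E Z u v"
  by (induction rule: conn_induct) (auto intro: conn_refl conn_step)

lemma conn_image: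
  assumes "conn E X u v" "\<And>x y. E x y \<Longrightarrow> E' (\<phi> x) (\<phi> y)"
  shows "conn E' (\<phi> ` X) (\<phi> u) (\<phi> v)"
  using assms(1) by (induction rule: conn_induct) (auto intro: conn_refl conn_step assms(2))

text \<open>Discrete intermediate values: h rises by at most 1 along an edge, so a path cut at its
  first vertex of height n has stayed in the region h <= n.\<close>

lemma conn_exit:
  fixes h :: "'v \<Rightarrow> int"
  assumes "conn E X u v" "h u \<le> n" "n \<le> h v"
    and "\<And>x y. E x y \<Longrightarrow> h y \<le> h x + 1"
  shows "\<exists>w. conn E (X \<inter> {z. h z \<le> n}) u w \<and> h w = n"
proof -
  let ?Z = "X \<inter> {z. h z \<le> n}"
  have "conn E ?Z u v \<or> (\<exists>w. conn E ?Z u w \<and> h w = n)"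
    using assms(1)
  proof (induction rule: conn_induct)
    case refl
    then show ?case using assms(2) by (auto intro: conn_refl)
  next
    case (step v w)
    show ?case
    proof (cases "\<exists>w. conn E ?Z u w \<and> h w = n")
      case False
      then have v: "conn E ?Z u v" using step by blast
      then have "h v \<le> n" "h v \<noteq> n" using False conn_right[OF v] by auto
      then have "h w \<le> n" using assms(4)[OF \<open>E v w\<close>] by linarith
      then show ?thesis using conn_step[OF v \<open>E v w\<close>] \<open>w \<in> X\<close> by auto
    qed auto
  qed
  then show ?thesis
  proof
    assume "conn E ?Z u v"
    then show ?thesis using conn_right[of E ?Z u v] assms(3) by force
  qed
qed

lemma conn_insert_first:
  assumes "conn E (insert b X) u v" "u \<in> X"
  shows "conn E X u v \<or> (\<exists>p. conn E X u p \<and> E p b)"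
  using assms(1)
proof (induction rule: conn_induct)
  case (step v w)
  then show ?case using conn_step by (cases "w = b") (auto intro: conn_step)
qed (use assms(2) in \<open>auto intro: conn_refl\<close>)

lemma conn_insert_pivot:
  assumes "symp E" "conn E (insert b X) u v" "u \<in> X" "v \<in> X" "\<not> conn E X u v"
  shows "b \<notin> X \<and> (\<exists>p q. E b p \<and> E b q \<and> conn E X u p \<and> conn E X v q)"
proof -
  have "\<exists>p. conn E X u p \<and> E p b" using conn_insert_first[OF assms(2,3)] assms(5) by auto
  moreover have "\<exists>p. conn E X v p \<and> E p b"
    using conn_insert_first[OF conn_sym[OF assms(1,2)] assms(4)] assms(5) conn_sym[OF assms(1)] by metis
  moreover have "b \<notin> X" using assms(2,5) by (auto simp: insert_absorb)
  ultimately show ?thesis using assms(1) by (meson sympD)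
qed

text \<open>When the sites of F are added one at a time, u and v become connected at a definite site
  b, which must then touch both of their clusters.\<close>

lemma conn_grow_pivot:
  assumes "finite F" "symp E" "u \<in> X" "v \<in> X" "\<not> conn E X u v" "conn E (X \<union> F) u v"
  shows "\<exists>F' b. F' \<subseteq> F \<and> b \<in> F \<and> b \<notin> X \<union> F' \<and> \<not> conn E (X \<union> F') u v \<and>
    (\<exists>p q. E b p \<and> E b q \<and> conn E (X \<union> F') u p \<and> conn E (X \<union> F') v q)"
  using assms(1,6)
proof (induction F rule: finite_induct)
  case empty
  then show ?case using assms(5) by simp
next
  case (insert b F)
  show ?case
  proof (cases "conn E (X \<union> F) u v")
    case True
    then show ?thesis using insert.IH by (meson subset_insertI2 insertI2)
  next
    case False
    have "b \<notin> X \<union> F \<and> (\<exists>p q. E b p \<and> E b q \<and> conn E (X \<union> F) u p \<and> conn E (X \<union> F) v q)"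
      by (rule conn_insert_pivot) (use insert.prems False assms in auto)
    then show ?thesis using False by blast
  qed
qed

definition cluster :: "('v \<Rightarrow> 'v \<Rightarrow> bool) \<Rightarrow> 'v set \<Rightarrow> 'v set \<Rightarrow> 'v set" where
  "cluster E Y A = {v. \<exists>y\<in>Y. conn E A y v}"

text \<open>The sites read when the clusters of Y are grown: Y itself whatever its state, the
  clusters, and the neighbours whose closedness stops the growth.\<close>

definition explored :: "('v \<Rightarrow> 'v \<Rightarrow> bool) \<Rightarrow> 'v set \<Rightarrow> 'v set \<Rightarrow> 'v set \<Rightarrow> 'v set" where
  "explored E V Y A = (Y \<union> cluster E Y A \<union> {v. \<exists>u\<in>cluster E Y A. E u v}) \<inter> V"

lemma cluster_subset: "cluster E Y A \<subseteq> A"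
  by (auto simp: cluster_def dest: conn_right)

text \<open>Every site that a path from Y could step on next is explored; hence no such path passes
  through i, before or after the flip.\<close>

lemma conn_flip_off:
  assumes "A \<subseteq> V" "i \<in> V" "i \<notin> explored E V Y A" "y \<in> Y"
  shows "conn E (flip i A) y v \<longleftrightarrow> conn E A y v"
proof
  have iy: "i \<noteq> y" using assms by (auto simp: explored_def)
  assume "conn E (flip i A) y v"
  then show "conn E A y v"
  proof (induction rule: conn_induct)
    case refl
    then show ?case using iy by (auto simp: flip_def intro: conn_refl split: if_splits)
  next
    case (step v w)
    then have "w \<noteq> i" using assms by (auto simp: explored_def cluster_def)
    then have "w \<in> A" using step by (auto simp: flip_def split: if_splits)
    then show ?case using step conn_step by metis
  qed
next
  assume "conn E A y v"
  then show "conn E (flip i A) y v"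
  proof (induction rule: conn_induct)
    case refl
    then show ?case using assms by (auto simp: flip_def explored_def intro: conn_refl)
  next
    case (step v w)
    then have "w \<noteq> i" using assms by (auto simp: explored_def cluster_def)
    then have "w \<in> flip i A" using step by (auto simp: flip_def)
    then show ?case using step conn_step by metis
  qed
qed

lemma cluster_flip_off:
  "A \<subseteq> V \<Longrightarrow> i \<in> V \<Longrightarrow> i \<notin> explored E V Y A \<Longrightarrow> cluster E Y (flip i A) = cluster E Y A"
  unfolding cluster_def using conn_flip_off[of A V i E Y] by blast

lemma stopping_set_explored: "stopping_set V (explored E V Y)"
  unfolding stopping_set_def using cluster_flip_off[of _ V _ E Y] by (auto simp: explored_def)

section \<open>Sites adjacent to two clusters\<close>

text \<open>Optional stopping. The spin of i has mean zero, and so does its restriction to the event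
  that i is unread, which is independent of that spin; subtract.\<close>

lemma stopping_set_spin_sum:
  assumes "finite V" "stopping_set V J" "\<And>A. A \<subseteq> V \<Longrightarrow> J A \<subseteq> V"
  shows "cube_avg V (\<lambda>A. \<Sum>i\<in>J A. spin A i) = 0"
proof -
  have "cube_avg V (\<lambda>A. of_bool (i \<notin> J A) * spin A i) = 0" if "i \<in> V" for i
    using that assms(2) by (intro cube_avg_odd_off[of V J i]) (auto simp: spin_flip stopping_set_flip)
  moreover have "cube_avg V (\<lambda>A. spin A i) = 0" if "i \<in> V" for i
    using that by (intro cube_avg_odd[of i]) (auto simp: spin_flip)
  ultimately have "(\<Sum>i\<in>V. cube_avg V (\<lambda>A. spin A i - of_bool (i \<notin> J A) * spin A i)) = 0"
    by (simp add: cube_avg_diff)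
  also have "(\<Sum>i\<in>V. cube_avg V (\<lambda>A. spin A i - of_bool (i \<notin> J A) * spin A i))
      = cube_avg V (\<lambda>A. \<Sum>i\<in>J A. spin A i)"
    unfolding cube_avg_sum[symmetric]
    using assms(1,3) by (intro cube_avg_cong sum.mono_neutral_cong_right) auto
  finally show ?thesis .
qed

lemma prod_one_plus:
  fixes x :: "'v \<Rightarrow> real"
  assumes "finite V"
  shows "(\<Prod>i\<in>V. 1 + x i) = (\<Sum>S\<in>Pow V. \<Prod>i\<in>S. x i)"
  using prod_add[OF assms, of x "\<lambda>_. 1"] by (simp add: add.commute)

text \<open>An exponential martingale, evaluated at a stopping set.\<close>

lemma stopping_set_prod:
  assumes "finite V" "stopping_set V J" "\<And>A. A \<subseteq> V \<Longrightarrow> J A \<subseteq> V"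
  shows "cube_avg V (\<lambda>A. \<Prod>i\<in>J A. 1 + x * spin A i) = 1"
proof -
  let ?w = "\<lambda>S A. (\<Prod>i\<in>S. x * spin A i)" and ?G = "\<lambda>A. \<Prod>i\<in>J A. 1 + x * spin A i"
  have flip_w: "?w S (flip i A) = - ?w S A" if "i \<in> S" "finite S" for i S A
  proof -
    have "?w S B = x ^ card S * walsh S B" for B by (simp add: walsh_def prod.distrib)
    then show ?thesis using that by (simp add: walsh_flip)
  qed
  have w0: "cube_avg V (?w S) = 0" if "S \<subseteq> V" "S \<noteq> {}" for S
  proof -
    obtain i where "i \<in> S" using \<open>S \<noteq> {}\<close> by auto
    then show ?thesis
      using that assms(1) finite_subset[of S V] by (intro cube_avg_odd[of i]) (auto simp: flip_w)
  qed
  have Gw0: "cube_avg V (\<lambda>A. of_bool (S \<inter> J A = {}) * (?G A * ?w S A)) = 0" if "S \<subseteq> V" "S \<noteq> {}" for S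
  proof -
    obtain i where i: "i \<in> S" using \<open>S \<noteq> {}\<close> by auto
    have iV: "i \<in> V" and finS: "finite S" using i that assms(1) finite_subset by auto
    have J: "J (flip i A) = J A" if "A \<subseteq> V" "i \<notin> J A" for A
      using that iV by (intro stopping_set_flip[OF assms(2)])
    have G: "?G (flip i A) = ?G A" if "A \<subseteq> V" "i \<notin> J A" for A
      unfolding J[OF that] using that(2) by (intro prod.cong refl) (auto simp: spin_flip)
    show ?thesis
    proof (rule cube_avg_odd_off[OF assms(2) iV])
      fix A assume A: "A \<subseteq> V" "i \<notin> J A"
      show "of_bool (S \<inter> J (flip i A) = {}) * (?G (flip i A) * ?w S (flip i A))
          = - (of_bool (S \<inter> J A = {}) * (?G A * ?w S A))"
        unfolding G[OF A] unfolding J[OF A] flip_w[OF i finS] by simp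
    qed (use i in auto)
  qed
  \<comment> \<open>Only the product over unread sites is expanded. A nonempty S in the expansion
    consists of unread sites, so its term is odd in any element of S and averages to zero, leaving
    \<open>?G\<close>.\<close>
  have split: "(\<Prod>i\<in>V. 1 + x * spin A i) = (\<Sum>S\<in>Pow V. of_bool (S \<inter> J A = {}) * (?G A * ?w S A))"
    if A: "A \<subseteq> V" for A
  proof -
    have "(\<Prod>i\<in>V. 1 + x * spin A i) = ?G A * (\<Prod>i\<in>V - J A. 1 + x * spin A i)"
      using prod.subset_diff[OF assms(3)[OF A] assms(1)] by (simp add: mult.commute)
    also have "\<dots> = (\<Sum>S\<in>Pow (V - J A). ?G A * ?w S A)"
      using assms(1) by (simp add: prod_one_plus sum_distrib_left)
    also have "\<dots> = (\<Sum>S\<in>Pow V. of_bool (S \<inter> J A = {}) * (?G A * ?w S A))"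
      using assms(1) by (intro sum.mono_neutral_cong_left) auto
    finally show ?thesis .
  qed
  have single: "(\<Sum>S\<in>Pow V. f S) = f {}" if "\<And>S. S \<subseteq> V \<Longrightarrow> S \<noteq> {} \<Longrightarrow> f S = 0" for f :: "'a set \<Rightarrow> real"
    using that assms(1) by (subst sum.remove[of _ "{}"]) (auto intro!: sum.neutral)
  have "cube_avg V (\<lambda>A. \<Prod>i\<in>V. 1 + x * spin A i) = (\<Sum>S\<in>Pow V. cube_avg V (?w S))"
    using assms(1) by (simp add: prod_one_plus cube_avg_sum)
  also have "\<dots> = 1" using single[OF w0] assms(1) by simp
  finally have "1 = cube_avg V (\<lambda>A. \<Sum>S\<in>Pow V. of_bool (S \<inter> J A = {}) * (?G A * ?w S A))"
    using split cube_avg_cong[of V "\<lambda>A. \<Prod>i\<in>V. 1 + x * spin A i"] by simp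
  also have "\<dots> = cube_avg V ?G"
    using single[OF Gw0] unfolding cube_avg_sum by simp
  finally show ?thesis by simp
qed

text \<open>The bounds ln (1 - t) >= - t - 2 t^2 and ln (1 + t) >= t - t^2 turn the product
  martingale into an exponential of the spin sum and of the size of the stopping set.\<close>

lemma one_minus_spin_ge:
  assumes "0 < (t::real)" "t \<le> 1 / 2"
  shows "exp (- t * spin A i - 2 * t\<^sup>2) \<le> 1 + (- t) * spin A i"
proof (cases "i \<in> A")
  case True
  have "- t - 2 * t\<^sup>2 \<le> ln (1 - t)" using ln_one_minus_pos_lower_bound[of t] assms by simp
  then have "exp (- t - 2 * t\<^sup>2) \<le> exp (ln (1 - t))" by simp
  then show ?thesis using True assms by (simp add: spin_def)
next
  case False
  have "t - t\<^sup>2 \<le> ln (1 + t)" using ln_one_plus_pos_lower_bound[of t] assms by simp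
  then have "t - 2 * t\<^sup>2 \<le> ln (1 + t)" using zero_le_power2[of t] by linarith
  then have "exp (t - 2 * t\<^sup>2) \<le> exp (ln (1 + t))" by simp
  then show ?thesis using False assms by (simp add: spin_def)
qed

text \<open>The weight L may depend on all of A, so optional stopping cannot be applied to the
  weighted sum. Instead L u <= L exp u <= exp u, where exp u lies below the martingale, whose mean
  is 1; dividing by t gives the bound, and the penalty on the size of J retains the weight
  L.\<close>

lemma stopping_set_deviation:
  assumes "finite V" "stopping_set V J" "\<And>A. A \<subseteq> V \<Longrightarrow> J A \<subseteq> V"
    and t: "0 < (t::real)" "t \<le> 1 / 2" and L: "\<And>A. A \<subseteq> V \<Longrightarrow> 0 \<le> L A \<and> L A \<le> 1"
  shows "cube_avg V (\<lambda>A. - (L A * (\<Sum>i\<in>J A. spin A i))) \<le> 2 * t * cube_avg V (\<lambda>A. L A * card (J A)) + 1 / t"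
proof -
  have "cube_avg V (\<lambda>A. t * - (L A * (\<Sum>i\<in>J A. spin A i)) - t * (2 * t * (L A * card (J A))))
     \<le> cube_avg V (\<lambda>A. \<Prod>i\<in>J A. 1 + (- t) * spin A i)"
  proof (rule cube_avg_mono)
    fix A assume A: "A \<subseteq> V"
    let ?u = "\<Sum>i\<in>J A. - t * spin A i - 2 * t\<^sup>2"
    have fin: "finite (J A)" using assms(1,3) A finite_subset by metis
    have "t * - (L A * (\<Sum>i\<in>J A. spin A i)) - t * (2 * t * (L A * card (J A))) = L A * ?u"
      by (simp add: sum_subtractf sum_negf power2_eq_square algebra_simps flip: sum_distrib_left)
    also have "\<dots> \<le> L A * exp ?u"
      using L[OF A] exp_ge_add_one_self[of ?u] by (intro mult_left_mono) linarith+
    also have "\<dots> \<le> exp ?u" using L[OF A] by (simp add: mult_left_le_one_le)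
    also have "\<dots> = (\<Prod>i\<in>J A. exp (- t * spin A i - 2 * t\<^sup>2))" using fin by (rule exp_sum)
    also have "\<dots> \<le> (\<Prod>i\<in>J A. 1 + (- t) * spin A i)"
      by (intro prod_mono conjI one_minus_spin_ge t) auto
    finally show "t * - (L A * (\<Sum>i\<in>J A. spin A i)) - t * (2 * t * (L A * card (J A)))
      \<le> (\<Prod>i\<in>J A. 1 + (- t) * spin A i)" .
  qed
  also have "\<dots> = 1" by (rule stopping_set_prod[OF assms(1-3)])
  finally have "t * (cube_avg V (\<lambda>A. - (L A * (\<Sum>i\<in>J A. spin A i))) - 2 * t * cube_avg V (\<lambda>A. L A * card (J A))) \<le> 1"
    by (simp only: cube_avg_diff cube_avg_cmult right_diff_distrib)
  then show ?thesis using t by (simp add: field_simps)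
qed

definition bridge_site :: "('v \<Rightarrow> 'v \<Rightarrow> bool) \<Rightarrow> 'v set \<Rightarrow> 'v set \<Rightarrow> 'v \<Rightarrow> bool" where
  "bridge_site E Y A x \<longleftrightarrow> x \<notin> A \<and>
     (\<exists>u v. E u x \<and> E v x \<and> u \<in> cluster E Y A \<and> v \<in> cluster E Y A \<and> \<not> conn E A u v)"

text \<open>The argument of Aizenman, Kesten and Newman. Exploring the clusters of \<open>Y\<close> one by one, rather than
  all at once, counts a site adjacent to several of them several times, while in both cases the
  numbers of open and closed explored sites nearly balance.\<close>

lemma bridge_sites_le:
  assumes "finite V" "symp E" "Y \<subseteq> V" and deg: "\<And>u. u \<in> V \<Longrightarrow> card {v \<in> V. E u v} \<le> d"
    and t: "0 < (t::real)" "t \<le> 1 / 2"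
  shows "(\<Sum>x\<in>V. cube_prob V (\<lambda>A. bridge_site E Y A x))
    \<le> card Y + 2 * t * (real (Suc d) * card V) + card Y / t"
proof -
  define C where "C y A = {v. conn E A y v}" for y A
  define N where "N y A = {i \<in> V - A. \<exists>u\<in>C y A. E u i}" for y A
  \<comment> \<open>The cluster of an open y spreads total weight 1 over its sites in Y, so a sum
    over y weighted by L counts each cluster once.\<close>
  define L where "L y A = (if y \<in> A then 1 / card (C y A \<inter> Y) else 0 :: real)" for y A
  define KY where "KY A = cluster E Y A" for A
  define NY where "NY A = {i \<in> V - A. \<exists>u\<in>KY A. E u i}" for A
  have sym: "conn E A u v \<Longrightarrow> conn E A v u" for A u v by (rule conn_sym[OF assms(2)])
  have finY: "finite Y" using assms(1,3) finite_subset by auto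
  have C_eq: "C u A = C v A" if "u \<in> C v A" for u v A
  proof -
    have vu: "conn E A v u" using that by (simp add: C_def)
    have "conn E A u w \<longleftrightarrow> conn E A v w" for w
      using conn_trans[OF vu] conn_trans[OF sym[OF vu]] by blast
    then show ?thesis by (simp add: C_def)
  qed
  have C_mem: "u \<in> C v A \<longleftrightarrow> v \<in> C u A" for u v A
    unfolding C_def mem_Collect_eq by (rule iffI; rule sym)
  have C_sub: "C y A \<subseteq> A" for y A unfolding C_def using conn_right by fastforce
  have C_self: "y \<in> C y A" if "y \<in> A" for y A using that by (simp add: C_def conn_refl)
  have C_empty: "C y A = {}" if "y \<notin> A" for y A using that conn_left by (fastforce simp: C_def)
  have L01: "0 \<le> L y A \<and> L y A \<le> 1" for y A
  proof (cases "card (C y A \<inter> Y) = 0")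
    case False
    then have "1 \<le> real (card (C y A \<inter> Y))" by linarith
    then show ?thesis by (simp add: L_def)
  qed (simp add: L_def)
  have L_sum: "(\<Sum>y\<in>C u A \<inter> Y. L y A) = 1" if "u \<in> KY A" for u A
  proof -
    obtain y where y: "y \<in> Y" "conn E A y u" using \<open>u \<in> KY A\<close> by (auto simp: KY_def cluster_def)
    then have "y \<in> C u A \<inter> Y" using sym[OF y(2)] by (simp add: C_def)
    then have ne: "card (C u A \<inter> Y) \<noteq> 0" using finY by auto
    have "L z A = 1 / card (C u A \<inter> Y)" if "z \<in> C u A \<inter> Y" for z
      using that C_eq[of z u A] C_sub[of u A] by (auto simp: L_def)
    then have "(\<Sum>y\<in>C u A \<inter> Y. L y A) = (\<Sum>y\<in>C u A \<inter> Y. 1 / card (C u A \<inter> Y))" by (intro sum.cong) auto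
    then show ?thesis using ne by simp
  qed
  have KY_C: "KY A = {u \<in> A. C u A \<inter> Y \<noteq> {}}" for A
  proof (rule set_eqI)
    fix u
    show "u \<in> KY A \<longleftrightarrow> u \<in> {u \<in> A. C u A \<inter> Y \<noteq> {}}"
      unfolding KY_def cluster_def C_def using sym[of A] conn_right[of E A] by blast
  qed
  have finC: "finite (C y A)" if "A \<subseteq> V" for y A
    using C_sub[of y A] that assms(1) finite_subset by (metis order_trans)
  have sumC: "(\<Sum>y\<in>Y. L y A * card (C y A)) = card (KY A)" if A: "A \<subseteq> V" for A
  proof -
    have finA: "finite A" using A assms(1) finite_subset by auto
    have "(\<Sum>y\<in>Y. L y A * card (C y A)) = (\<Sum>y\<in>Y. \<Sum>u\<in>A. of_bool (u \<in> C y A) * L y A)"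
    proof (intro sum.cong refl)
      fix y
      have "(\<Sum>u\<in>A. of_bool (u \<in> C y A)) = real (card (C y A))"
        using finA C_sub[of y A] by (simp add: Int_absorb1)
      then show "L y A * card (C y A) = (\<Sum>u\<in>A. of_bool (u \<in> C y A) * L y A)"
        by (simp flip: sum_distrib_right)
    qed
    also have "\<dots> = (\<Sum>u\<in>A. \<Sum>y\<in>Y. of_bool (u \<in> C y A) * L y A)" by (rule sum.swap)
    also have "\<dots> = (\<Sum>u\<in>A. \<Sum>y\<in>C u A \<inter> Y. L y A)"
    proof (rule sum.cong[OF refl])
      fix u
      show "(\<Sum>y\<in>Y. of_bool (u \<in> C y A) * L y A) = (\<Sum>y\<in>C u A \<inter> Y. L y A)"
        using finY by (intro sum.mono_neutral_cong_right) (auto simp: C_mem[of u])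
    qed
    also have "\<dots> = (\<Sum>u\<in>A. of_bool (u \<in> KY A))"
      using L_sum KY_C by (intro sum.cong refl) (auto simp: of_bool_def)
    also have "\<dots> = card (KY A)"
      using finA cluster_subset[of E Y A] by (simp add: KY_def Int_absorb1)
    finally show ?thesis .
  qed
  \<comment> \<open>Weighted by L, a closed site is counted once for each cluster of Y adjacent to
    it: at least once in \<open>NY\<close>, at least twice at a bridge site.\<close>
  have mult: "of_bool (i \<in> NY A) + of_bool (bridge_site E Y A i) \<le> (\<Sum>y\<in>Y. of_bool (i \<in> N y A) * L y A)"
    if A: "A \<subseteq> V" "i \<in> V" for A i
  proof -
    have nn: "0 \<le> of_bool (i \<in> N y A) * L y A" for y using L01 by simp
    have one: "(\<Sum>y\<in>C u A \<inter> Y. of_bool (i \<in> N y A) * L y A) = 1"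
      if "u \<in> KY A" "E u i" "i \<notin> A" for u
    proof -
      have "i \<in> N y A" if "y \<in> C u A \<inter> Y" for y
        using that \<open>E u i\<close> \<open>i \<notin> A\<close> \<open>i \<in> V\<close> C_mem[of y u A] by (auto simp: N_def)
      then show ?thesis using L_sum[OF that(1)] by simp
    qed
    show ?thesis
    proof (cases "bridge_site E Y A i")
      case True
      then obtain u v where uv: "i \<notin> A" "E u i" "E v i" "u \<in> KY A" "v \<in> KY A" "\<not> conn E A u v"
        by (auto simp: bridge_site_def KY_def)
      have disj: "(C u A \<inter> Y) \<inter> (C v A \<inter> Y) = {}"
      proof (rule ccontr)
        assume "(C u A \<inter> Y) \<inter> (C v A \<inter> Y) \<noteq> {}"
        then obtain w where "conn E A u w" "conn E A v w" by (auto simp: C_def)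
        then show False using uv(6) conn_trans[OF _ sym] by blast
      qed
      have "2 = (\<Sum>y\<in>(C u A \<inter> Y) \<union> (C v A \<inter> Y). of_bool (i \<in> N y A) * L y A)"
        using one uv finY disj by (subst sum.union_disjoint) auto
      also have "\<dots> \<le> (\<Sum>y\<in>Y. of_bool (i \<in> N y A) * L y A)"
        using finY nn by (intro sum_mono2) auto
      finally show ?thesis by (auto simp: of_bool_def)
    next
      case False
      show ?thesis
      proof (cases "i \<in> NY A")
        case True
        then obtain u where u: "u \<in> KY A" "E u i" "i \<notin> A" by (auto simp: NY_def)
        have "1 = (\<Sum>y\<in>C u A \<inter> Y. of_bool (i \<in> N y A) * L y A)" using one[OF u] by simp
        also have "\<dots> \<le> (\<Sum>y\<in>Y. of_bool (i \<in> N y A) * L y A)"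
          using finY nn by (intro sum_mono2) auto
        finally show ?thesis using False True by simp
      next
        case False
        then show ?thesis using \<open>\<not> bridge_site E Y A i\<close> nn by (simp add: sum_nonneg)
      qed
    qed
  qed
  have sumN: "real (card (NY A)) + (\<Sum>x\<in>V. of_bool (bridge_site E Y A x)) \<le> (\<Sum>y\<in>Y. L y A * card (N y A))"
    if A: "A \<subseteq> V" for A
  proof -
    have "real (card (NY A)) + (\<Sum>x\<in>V. of_bool (bridge_site E Y A x))
        = (\<Sum>i\<in>V. of_bool (i \<in> NY A) + of_bool (bridge_site E Y A i) :: real)"
    proof -
      have "NY A \<subseteq> V" by (auto simp: NY_def)
      then show ?thesis using assms(1) by (simp add: sum.distrib Int_absorb1)
    qed
    also have "\<dots> \<le> (\<Sum>i\<in>V. \<Sum>y\<in>Y. of_bool (i \<in> N y A) * L y A)"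
      by (intro sum_mono mult A)
    also have "\<dots> = (\<Sum>y\<in>Y. \<Sum>i\<in>V. of_bool (i \<in> N y A) * L y A)" by (rule sum.swap)
    also have "\<dots> = (\<Sum>y\<in>Y. L y A * card (N y A))"
    proof (intro sum.cong refl)
      fix y
      have "N y A \<subseteq> V" by (auto simp: N_def)
      then have "(\<Sum>i\<in>V. of_bool (i \<in> N y A)) = real (card (N y A))"
        using assms(1) by (simp add: Int_absorb1)
      then show "(\<Sum>i\<in>V. of_bool (i \<in> N y A) * L y A) = L y A * card (N y A)"
        by (simp flip: sum_distrib_right)
    qed
    finally show ?thesis by simp
  qed
  have J_sub: "explored E V Z A \<subseteq> V" for Z A by (auto simp: explored_def)
  have J_y: "explored E V {y} A = C y A \<union> N y A" if "A \<subseteq> V" "y \<in> A" for y A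
    using that C_self[of y A] C_sub[of y A] conn_step[of E A y]
    by (auto simp: explored_def cluster_def C_def N_def)
  have spin_sum: "(\<Sum>i\<in>B \<union> D. spin A i) = real (card B) - card D" if "B \<subseteq> A" "D \<subseteq> V - A" "A \<subseteq> V" for A B D
  proof -
    have "finite B" "finite D" "B \<inter> D = {}"
      using that assms(1) finite_subset[of B V] finite_subset[of D V] by auto
    then have "(\<Sum>i\<in>B \<union> D. spin A i) = (\<Sum>i\<in>B. spin A i) + (\<Sum>i\<in>D. spin A i)"
      by (rule sum.union_disjoint)
    also have "(\<Sum>i\<in>B. spin A i) = (\<Sum>i\<in>B. 1)" using that by (intro sum.cong) (auto simp: spin_def)
    also have "(\<Sum>i\<in>D. spin A i) = (\<Sum>i\<in>D. -1)" using that by (intro sum.cong) (auto simp: spin_def)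
    finally show ?thesis by simp
  qed
  have M_y: "L y A * (\<Sum>i\<in>explored E V {y} A. spin A i) = L y A * card (C y A) - L y A * card (N y A)"
    if A: "A \<subseteq> V" for y A
  proof (cases "y \<in> A")
    case True
    have "N y A \<subseteq> V - A" by (auto simp: N_def)
    then show ?thesis
      using spin_sum[OF C_sub _ A, of "N y A" y] J_y[OF A True] by (simp add: right_diff_distrib)
  qed (simp add: L_def)
  \<comment> \<open>At most d closed neighbours per cluster site are read, so the penalty on
    explored sites becomes one on cluster sites, whose weighted total is at most
    \<open>card V\<close>.\<close>
  have card_J: "L y A * card (explored E V {y} A) \<le> real (Suc d) * (L y A * card (C y A))"
    if A: "A \<subseteq> V" for y A
  proof (cases "y \<in> A")
    case True
    have "N y A \<subseteq> (\<Union>u\<in>C y A. {v \<in> V. E u v})" by (auto simp: N_def)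
    then have "card (N y A) \<le> card (\<Union>u\<in>C y A. {v \<in> V. E u v})"
      using assms(1) finC[OF A, of y] by (intro card_mono) auto
    also have "\<dots> \<le> (\<Sum>u\<in>C y A. card {v \<in> V. E u v})" by (rule card_UN_le[OF finC[OF A]])
    also have "\<dots> \<le> (\<Sum>u\<in>C y A. d)" using C_sub[of y A] A by (intro sum_mono deg) auto
    finally have "card (N y A) \<le> card (C y A) * d" by simp
    then have "card (explored E V {y} A) \<le> Suc d * card (C y A)"
      unfolding J_y[OF A True] using card_Un_le[of "C y A" "N y A"] by (simp add: mult.commute)
    then have "real (card (explored E V {y} A)) \<le> real (Suc d) * card (C y A)"
      by (metis of_nat_le_iff of_nat_mult)
    then have "L y A * card (explored E V {y} A) \<le> L y A * (real (Suc d) * card (C y A))"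
      using L01[of y A] by (intro mult_left_mono) auto
    then show ?thesis by (simp only: mult.left_commute)
  qed (simp add: L_def)
  \<comment> \<open>Exploration of all clusters at once: the numbers of open and closed sites read
    have equal means. Closed sites of Y are read without being next to a cluster, which costs
    \<open>card Y\<close>.\<close>
  have balance: "cube_avg V (\<lambda>A. real (card (KY A))) \<le> cube_avg V (\<lambda>A. real (card (NY A))) + card Y"
  proof -
    have "cube_avg V (\<lambda>A. real (card (KY A)) - card (NY A) - card Y) \<le> cube_avg V (\<lambda>A. \<Sum>i\<in>explored E V Y A. spin A i)"
    proof (rule cube_avg_mono)
      fix A assume A: "A \<subseteq> V"
      have sub: "KY A \<subseteq> A" unfolding KY_def by (rule cluster_subset)
      have ex: "explored E V Y A = KY A \<union> (NY A \<union> (Y - A))"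
      proof
        show "explored E V Y A \<subseteq> KY A \<union> (NY A \<union> (Y - A))"
        proof
          fix x assume "x \<in> explored E V Y A"
          then consider "x \<in> Y" | "x \<in> KY A" | u where "x \<in> V" "u \<in> KY A" "E u x"
            by (auto simp: explored_def KY_def)
          then show "x \<in> KY A \<union> (NY A \<union> (Y - A))"
          proof cases
            case 1
            then show ?thesis using conn_refl[of x A E] by (auto simp: KY_def cluster_def)
          next
            case 3
            then obtain y where "y \<in> Y" "conn E A y u" by (auto simp: KY_def cluster_def)
            then have "x \<in> A \<Longrightarrow> x \<in> KY A"
              using conn_step[of E A y u x] 3 by (auto simp: KY_def cluster_def)
            then show ?thesis using 3 by (auto simp: NY_def)
          qed simp
        qed
        show "KY A \<union> (NY A \<union> (Y - A)) \<subseteq> explored E V Y A"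
          using sub A assms(3) by (auto simp: explored_def KY_def NY_def)
      qed
      have "(\<Sum>i\<in>explored E V Y A. spin A i) = real (card (KY A)) - card (NY A \<union> (Y - A))"
        unfolding ex using assms(3) by (intro spin_sum[OF sub _ A]) (auto simp: NY_def)
      moreover have "card (NY A \<union> (Y - A)) \<le> card (NY A) + card Y"
        using card_Un_le[of "NY A" "Y - A"] card_mono[OF finY, of "Y - A"] by auto
      ultimately show "real (card (KY A)) - card (NY A) - card Y \<le> (\<Sum>i\<in>explored E V Y A. spin A i)"
        by linarith
    qed
    also have "\<dots> = 0"
      using assms(1) by (intro stopping_set_spin_sum stopping_set_explored J_sub)
    finally show ?thesis using assms(1) by (simp add: cube_avg_diff)
  qed
  have "(\<Sum>x\<in>V. cube_prob V (\<lambda>A. bridge_site E Y A x)) = cube_avg V (\<lambda>A. \<Sum>x\<in>V. of_bool (bridge_site E Y A x))"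
    by (simp add: cube_prob_def cube_avg_sum)
  \<comment> \<open>Bridge sites number at most the closed sites counted per cluster minus those
    counted once. Both counts are compared with the number \<open>card (KY A)\<close> of cluster
    sites, which cancels.\<close>
  also have "\<dots> \<le> cube_avg V (\<lambda>A. (real (card (KY A)) - real (card (NY A)))
      + (\<Sum>y\<in>Y. - (L y A * (\<Sum>i\<in>explored E V {y} A. spin A i))))"
  proof (rule cube_avg_mono)
    fix A assume A: "A \<subseteq> V"
    have "(\<Sum>y\<in>Y. - (L y A * (\<Sum>i\<in>explored E V {y} A. spin A i)))
        = (\<Sum>y\<in>Y. L y A * card (N y A)) - (\<Sum>y\<in>Y. L y A * card (C y A))"
      by (simp add: M_y[OF A] sum_subtractf)
    then show "(\<Sum>x\<in>V. of_bool (bridge_site E Y A x)) \<le> (real (card (KY A)) - real (card (NY A)))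
      + (\<Sum>y\<in>Y. - (L y A * (\<Sum>i\<in>explored E V {y} A. spin A i)))"
      using sumN[OF A] sumC[OF A] by linarith
  qed
  also have "\<dots> = (cube_avg V (\<lambda>A. real (card (KY A))) - cube_avg V (\<lambda>A. real (card (NY A))))
      + (\<Sum>y\<in>Y. cube_avg V (\<lambda>A. - (L y A * (\<Sum>i\<in>explored E V {y} A. spin A i))))"
    by (simp only: cube_avg_add cube_avg_diff cube_avg_sum)
  also have "\<dots> \<le> card Y + (\<Sum>y\<in>Y. 2 * t * cube_avg V (\<lambda>A. L y A * card (explored E V {y} A)) + 1 / t)"
    using balance
    by (intro add_mono sum_mono stopping_set_deviation stopping_set_explored J_sub assms(1) t L01) auto
  also have "\<dots> = card Y + 2 * t * cube_avg V (\<lambda>A. \<Sum>y\<in>Y. L y A * card (explored E V {y} A)) + card Y / t"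
    by (simp add: sum.distrib cube_avg_sum sum_distrib_left)
  also have "cube_avg V (\<lambda>A. \<Sum>y\<in>Y. L y A * card (explored E V {y} A)) \<le> real (Suc d) * card V"
  proof (rule cube_avg_le_const[OF assms(1)])
    fix A assume A: "A \<subseteq> V"
    have "(\<Sum>y\<in>Y. L y A * card (explored E V {y} A)) \<le> (\<Sum>y\<in>Y. real (Suc d) * (L y A * card (C y A)))"
      by (intro sum_mono card_J A)
    also have "\<dots> = real (Suc d) * card (KY A)"
      by (simp only: sum_distrib_left[symmetric] sumC[OF A])
    also have "\<dots> \<le> real (Suc d) * card V"
      using card_mono[OF assms(1), of "KY A"] cluster_subset[of E Y A] A
      by (intro mult_left_mono) (auto simp: KY_def)
    finally show "(\<Sum>y\<in>Y. L y A * card (explored E V {y} A)) \<le> real (Suc d) * card V" .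
  qed
  finally show ?thesis using t by (simp add: mult_left_mono)
qed

section \<open>Blocks that meet two clusters\<close>

definition split_block :: "('v \<Rightarrow> 'v \<Rightarrow> bool) \<Rightarrow> 'v set \<Rightarrow> 'v set \<Rightarrow> 'v set \<Rightarrow> bool" where
  "split_block E Y B A \<longleftrightarrow> (\<exists>u\<in>B. \<exists>v\<in>B. u \<in> cluster E Y A \<and> v \<in> cluster E Y A \<and> \<not> conn E A u v)"

text \<open>The path from y first enters B at p, and q is the site just before.\<close>

lemma conn_leave_block:
  assumes "conn E A y u" "y \<notin> B" "u \<in> B" "symp E"
  shows "\<exists>p q. conn E A u p \<and> p \<in> B \<and> E p q \<and> conn E (A - B) y q"
proof -
  have "conn E (A - B) y u \<or> (\<exists>p q. p \<in> A \<and> conn E A y p \<and> p \<in> B \<and> E q p \<and> conn E (A - B) y q)"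
    using assms(1)
  proof (induction rule: conn_induct)
    case refl
    then show ?case using assms(2) by (auto intro: conn_refl)
  next
    case (step v w)
    then show ?case
    proof (cases "w \<in> B")
      case True
      then show ?thesis using step conn_step[of E A y v w] by blast
    next
      case False
      then show ?thesis using step conn_step[of E "A - B" y v w] by blast
    qed
  qed
  then obtain p q where pq: "conn E A y p" "p \<in> B" "E q p" "conn E (A - B) y q"
    using conn_right[of E "A - B" y u] assms(3) by auto
  then show ?thesis
    using conn_trans[OF conn_sym[OF assms(4,1)] pq(1)] assms(4) by (meson sympD)
qed

text \<open>Closing a block that meets two clusters and then opening its sites one by one, the clusters
  merge at some site.\<close>

lemma split_block_bridge:
  assumes "finite B" "symp E" "Y \<inter> B = {}" "split_block E Y B A"
    and connB: "\<And>u v. u \<in> B \<Longrightarrow> v \<in> B \<Longrightarrow> conn E B u v"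
  shows "\<exists>B'\<subseteq>B. \<exists>x\<in>B. bridge_site E Y ((A - B) \<union> B') x"
proof -
  have sym: "conn E X u v \<Longrightarrow> conn E X v u" for X u v by (rule conn_sym[OF assms(2)])
  obtain u v y z where uv: "u \<in> B" "v \<in> B" "y \<in> Y" "z \<in> Y" "conn E A y u" "conn E A z v" "\<not> conn E A u v"
    using assms(4) by (auto simp: split_block_def cluster_def)
  have yz: "y \<notin> B" "z \<notin> B" using uv assms(3) by auto
  obtain p q where pq: "conn E A u p" "p \<in> B" "E p q" "conn E (A - B) y q"
    using conn_leave_block[OF uv(5) yz(1) uv(1) assms(2)] by auto
  obtain p' q' where pq': "conn E A v p'" "p' \<in> B" "E p' q'" "conn E (A - B) z q'"
    using conn_leave_block[OF uv(6) yz(2) uv(2) assms(2)] by auto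
  have q: "q \<in> A - B" "q' \<in> A - B" using pq(4) pq'(4) conn_right by metis+
  \<comment> \<open>In \<open>A - B\<close> the last sites q and q' of the two approaches to B are
    separated, or else u and v would be joined through y and z. Filling B joins them, so some site
    of B is pivotal.\<close>
  have not: "\<not> conn E (A - B) q q'"
  proof
    assume "conn E (A - B) q q'"
    with pq(4) have "conn E (A - B) y q'" by (rule conn_trans)
    then have "conn E (A - B) y z" using sym[OF pq'(4)] by (rule conn_trans)
    then have yz: "conn E A y z" by (rule conn_mono) auto
    have "conn E A u z" using sym[OF uv(5)] yz by (rule conn_trans)
    then have "conn E A u v" using uv(6) by (rule conn_trans)
    then show False using uv(7) by simp
  qed
  have E: "E q p" using pq(3) assms(2) by (meson sympD)
  have "conn E ((A - B) \<union> B) q p" using q pq(2) conn_step[OF conn_refl[of q "(A - B) \<union> B" E], of p] E by auto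
  moreover have "conn E ((A - B) \<union> B) p p'" using connB[OF pq(2) pq'(2)] by (rule conn_mono) auto
  ultimately have "conn E ((A - B) \<union> B) q p'" by (rule conn_trans)
  then have "conn E ((A - B) \<union> B) q q'" using q conn_step[of E "(A - B) \<union> B" q p' q'] pq'(3) by auto
  from conn_grow_pivot[OF assms(1,2) q not this]
  obtain F b r s where F: "F \<subseteq> B" "b \<in> B" "b \<notin> (A - B) \<union> F" "\<not> conn E ((A - B) \<union> F) q q'"
      "E b r" "E b s" "conn E ((A - B) \<union> F) q r" "conn E ((A - B) \<union> F) q' s"
    by blast
  have "conn E ((A - B) \<union> F) y q" "conn E ((A - B) \<union> F) z q'"
    by (rule conn_mono[OF pq(4)], simp) (rule conn_mono[OF pq'(4)], simp)
  then have "conn E ((A - B) \<union> F) y r" "conn E ((A - B) \<union> F) z s"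
    using conn_trans[OF _ F(7)] conn_trans[OF _ F(8)] by auto
  moreover have "\<not> conn E ((A - B) \<union> F) r s"
  proof
    assume "conn E ((A - B) \<union> F) r s"
    with F(7) have "conn E ((A - B) \<union> F) q s" by (rule conn_trans)
    then have "conn E ((A - B) \<union> F) q q'" using sym[OF F(8)] by (rule conn_trans)
    then show False using F(4) by simp
  qed
  ultimately have "bridge_site E Y ((A - B) \<union> F) b"
    unfolding bridge_site_def cluster_def using F(3) sympD[OF assms(2) F(5)] sympD[OF assms(2) F(6)] uv(3,4)
    by blast
  then show ?thesis using F by blast
qed

text \<open>Resampling the coordinates in B uniformly preserves the uniform measure; the factor is
  the number of subsets of B.\<close>

lemma cube_avg_resample:
  assumes "finite V" "B \<subseteq> V"
  shows "cube_avg V (\<lambda>A. \<Sum>B'\<in>Pow B. g ((A - B) \<union> B')) = 2 ^ card B * cube_avg V g"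
proof -
  have fin: "finite B" "finite (V - B)" using assms finite_subset by auto
  have V: "(V - B) \<union> B = V" using assms by auto
  have split: "cube_avg V h = cube_avg (V - B) (\<lambda>C. cube_avg B (\<lambda>D. h (C \<union> D)))" for h
    using cube_avg_Un[OF fin(2,1), of h] V by auto
  have "cube_avg V (\<lambda>A. \<Sum>B'\<in>Pow B. g ((A - B) \<union> B'))
      = cube_avg (V - B) (\<lambda>C. cube_avg B (\<lambda>D. 2 ^ card B * cube_avg B (\<lambda>B'. g (C \<union> B'))))"
    unfolding split
  proof (intro cube_avg_cong)
    fix C D assume "C \<subseteq> V - B" "D \<subseteq> B"
    then have "(C \<union> D) - B = C" by auto
    then show "(\<Sum>B'\<in>Pow B. g ((C \<union> D - B) \<union> B')) = 2 ^ card B * cube_avg B (\<lambda>B'. g (C \<union> B'))"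
      by (simp add: cube_avg_def)
  qed
  also have "\<dots> = 2 ^ card B * cube_avg V g"
    unfolding split[of g] using fin by (simp add: cube_avg_cmult)
  finally show ?thesis .
qed

text \<open>A finite-energy estimate: reaching a bridge site alters A inside B only, so the cost is
  \<open>2 ^ card B\<close>, a constant for blocks of fixed size.\<close>

lemma split_block_prob_le:
  assumes "finite V" "B \<subseteq> V" "symp E" "Y \<inter> B = {}"
    and connB: "\<And>u v. u \<in> B \<Longrightarrow> v \<in> B \<Longrightarrow> conn E B u v"
  shows "cube_prob V (split_block E Y B) \<le> 2 ^ card B * (\<Sum>x\<in>B. cube_prob V (\<lambda>A. bridge_site E Y A x))"
proof -
  have finB: "finite B" using assms(1,2) finite_subset by auto
  have "cube_prob V (split_block E Y B)
     \<le> cube_avg V (\<lambda>A. \<Sum>B'\<in>Pow B. \<Sum>x\<in>B. of_bool (bridge_site E Y ((A - B) \<union> B') x))"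
    unfolding cube_prob_def
  proof (rule cube_avg_mono)
    fix A
    show "of_bool (split_block E Y B A) \<le> (\<Sum>B'\<in>Pow B. \<Sum>x\<in>B. of_bool (bridge_site E Y ((A - B) \<union> B') x) :: real)"
    proof (cases "split_block E Y B A")
      case True
      then obtain B' x where Bx: "B' \<subseteq> B" "x \<in> B" "bridge_site E Y ((A - B) \<union> B') x"
        using split_block_bridge[OF finB assms(3,4) _ connB] by blast
      have "1 \<le> (\<Sum>x\<in>B. of_bool (bridge_site E Y ((A - B) \<union> B') x) :: real)"
        using member_le_sum[of x B "\<lambda>x. of_bool (bridge_site E Y ((A - B) \<union> B') x) :: real"] Bx finB by auto
      also have "\<dots> \<le> (\<Sum>B'\<in>Pow B. \<Sum>x\<in>B. of_bool (bridge_site E Y ((A - B) \<union> B') x))"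
        using Bx finB by (intro member_le_sum[of B']) (auto simp: sum_nonneg)
      finally show ?thesis using True by simp
    qed (simp add: sum_nonneg)
  qed
  also have "\<dots> = 2 ^ card B * cube_avg V (\<lambda>A. \<Sum>x\<in>B. of_bool (bridge_site E Y A x))"
    by (rule cube_avg_resample[OF assms(1,2)])
  finally show ?thesis by (simp add: cube_avg_sum cube_prob_def)
qed

section \<open>Critical percolation on the triangular lattice\<close>

text \<open>The triangular lattice in the coordinates \<open>(m, k)\<close> of the basis \<open>(1, 0)\<close>, \<open>(1/2, sqrt 3 / 2)\<close>.\<close>

definition hex_adj :: "int \<times> int \<Rightarrow> int \<times> int \<Rightarrow> bool" where
  "hex_adj u v \<longleftrightarrow> (fst v - fst u, snd v - snd u) \<in> {(1, 0), (-1, 0), (0, 1), (0, -1), (1, -1), (-1, 1)}"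

text \<open>The sup norm of the lattice coordinates, whose balls are rhombi in the plane. Negation
  and exchange of coordinates preserve both these rhombi around 0 and
  \<open>hex_adj\<close>.\<close>

definition hdist :: "int \<times> int \<Rightarrow> int \<times> int \<Rightarrow> int" where
  "hdist x v = max \<bar>fst v - fst x\<bar> \<bar>snd v - snd x\<bar>"

definition rbox :: "int \<times> int \<Rightarrow> nat \<Rightarrow> (int \<times> int) set" where
  "rbox x n = {v. hdist x v \<le> int n}"

definition rim :: "int \<times> int \<Rightarrow> nat \<Rightarrow> (int \<times> int) set" where
  "rim x n = {v. hdist x v = int n}"

lemma symp_hex_adj: "symp hex_adj"
  by (auto simp: symp_def hex_adj_def)

lemma hdist_self [simp]: "hdist x x = 0"
  by (simp add: hdist_def)

lemma hdist_step: "hex_adj u v \<Longrightarrow> hdist x v \<le> hdist x u + 1"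
  by (auto simp: hex_adj_def hdist_def)

lemma hdist_triangle: "hdist x v \<le> hdist x y + hdist y v"
  by (auto simp: hdist_def)

lemma hdist_commute: "hdist x y = hdist y x"
  by (auto simp: hdist_def)

lemma rbox_eq: "rbox x n = {fst x - int n..fst x + int n} \<times> {snd x - int n..snd x + int n}"
  by (auto simp: rbox_def hdist_def)

lemma finite_rbox [simp]: "finite (rbox x n)"
  by (simp add: rbox_eq)

lemma card_rbox: "card (rbox x n) = (2 * n + 1)\<^sup>2"
  by (simp add: rbox_eq card_cartesian_product power2_eq_square) (simp add: nat_add_distrib nat_mult_distrib)

lemma rim_subset_rbox: "rim x n \<subseteq> rbox x n"
  by (auto simp: rim_def rbox_def)

lemma card_rim_le: "card (rim x n) \<le> 4 * (2 * n + 1)"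
proof -
  let ?I = "{fst x - int n..fst x + int n}" and ?J = "{snd x - int n..snd x + int n}"
  have "rim x n \<subseteq> (?I \<times> {snd x - int n} \<union> ?I \<times> {snd x + int n}) \<union> ({fst x - int n} \<times> ?J \<union> {fst x + int n} \<times> ?J)"
    by (force simp: rim_def hdist_def max_def abs_if split: if_splits)
  then have "card (rim x n) \<le> card ((?I \<times> {snd x - int n} \<union> ?I \<times> {snd x + int n}) \<union> ({fst x - int n} \<times> ?J \<union> {fst x + int n} \<times> ?J))"
    by (rule card_mono[rotated]) simp
  also have "\<dots> \<le> (card (?I \<times> {snd x - int n}) + card (?I \<times> {snd x + int n})) + (card ({fst x - int n} \<times> ?J) + card ({fst x + int n} \<times> ?J))"
    by (intro order_trans[OF card_Un_le] add_mono card_Un_le)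
  also have "\<dots> = 4 * (2 * n + 1)" by (simp add: card_cartesian_product)
  finally show ?thesis .
qed

lemma hex_degree: "card {v \<in> V. hex_adj u v} \<le> 6"
proof -
  let ?D = "{(1, 0), (-1, 0), (0, 1), (0, -1), (1, -1), (-1, 1)} :: (int \<times> int) set"
  have "{v \<in> V. hex_adj u v} \<subseteq> (\<lambda>d. (fst u + fst d, snd u + snd d)) ` ?D"
  proof
    fix v assume "v \<in> {v \<in> V. hex_adj u v}"
    then have "(fst v - fst u, snd v - snd u) \<in> ?D" by (simp add: hex_adj_def)
    moreover have "v = (fst u + fst (fst v - fst u, snd v - snd u), snd u + snd (fst v - fst u, snd v - snd u))"
      by simp
    ultimately show "v \<in> (\<lambda>d. (fst u + fst d, snd u + snd d)) ` ?D" by blast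
  qed
  then have "card {v \<in> V. hex_adj u v} \<le> card ((\<lambda>d. (fst u + fst d, snd u + snd d)) ` ?D)"
    by (intro card_mono) auto
  also have "\<dots> \<le> card ?D" by (rule card_image_le) simp
  finally show ?thesis by simp
qed

lemma conn_line:
  assumes "a \<le> a'" "{a..a'} \<times> {b} \<subseteq> X"
  shows "conn hex_adj X (a, b) (a', b)"
  using assms
proof (induction a' rule: int_ge_induct)
  case base
  then show ?case by (auto intro: conn_refl)
next
  case (step i)
  then have "conn hex_adj X (a, b) (i, b)" by (auto simp: subset_iff)
  then show ?case by (rule conn_step) (use step in \<open>auto simp: hex_adj_def\<close>)
qed

lemma conn_column:
  assumes "b \<le> b'" "{a} \<times> {b..b'} \<subseteq> X"
  shows "conn hex_adj X (a, b) (a, b')"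
  using assms
proof (induction b' rule: int_ge_induct)
  case base
  then show ?case by (auto intro: conn_refl)
next
  case (step i)
  then have "conn hex_adj X (a, b) (a, i)" by (auto simp: subset_iff)
  then show ?case by (rule conn_step) (use step in \<open>auto simp: hex_adj_def\<close>)
qed

lemma conn_rbox:
  assumes "u \<in> rbox x n" "v \<in> rbox x n"
  shows "conn hex_adj (rbox x n) u v"
proof -
  obtain a b a' b' where uv: "u = (a, b)" "v = (a', b')" by (metis surj_pair)
  have "conn hex_adj (rbox x n) (min a a', b) (max a a', b)"
    by (rule conn_line) (use assms uv in \<open>auto simp: rbox_eq\<close>)
  then have "conn hex_adj (rbox x n) (a, b) (a', b)"
    using conn_sym[OF symp_hex_adj] by (cases "a \<le> a'") (auto simp: min_def max_def)
  moreover have "conn hex_adj (rbox x n) (a', min b b') (a', max b b')"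
    by (rule conn_column) (use assms uv in \<open>auto simp: rbox_eq\<close>)
  then have "conn hex_adj (rbox x n) (a', b) (a', b')"
    using conn_sym[OF symp_hex_adj] by (cases "b \<le> b'") (auto simp: min_def max_def)
  ultimately show ?thesis unfolding uv by (rule conn_trans)
qed

subsection \<open>Paths of opposite colours cannot cross\<close>

text \<open>The lattice is drawn sheared, as the square grid with one diagonal per cell, so that the
  rhombi become squares with sides parallel to the axes, the setting of
  \<open>fashoda\<close>.\<close>

definition emb :: "int \<times> int \<Rightarrow> real ^ 2" where
  "emb v = vector [of_int (fst v), of_int (snd v)]"

lemma emb_nth [simp]: "emb v $ 1 = of_int (fst v)" "emb v $ 2 = of_int (snd v)"
  by (simp_all add: emb_def)

lemma emb_eq_iff [simp]: "emb u = emb v \<longleftrightarrow> u = v"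
  by (auto simp: vec_eq_iff forall_2 prod_eq_iff)

text \<open>The segments with p = q keep a path of length zero inside the drawing.\<close>

definition drawing :: "('v \<Rightarrow> real ^ 2) \<Rightarrow> ('v \<Rightarrow> 'v \<Rightarrow> bool) \<Rightarrow> 'v set \<Rightarrow> (real ^ 2) set" where
  "drawing \<phi> E X = (\<Union>p\<in>X. \<Union>q\<in>{q \<in> X. E p q \<or> p = q}. closed_segment (\<phi> p) (\<phi> q))"

lemma segment_subset_drawing:
  assumes "p \<in> X" "q \<in> X" "E p q \<or> p = q"
  shows "closed_segment (\<phi> p) (\<phi> q) \<subseteq> drawing \<phi> E X"
  unfolding drawing_def by (intro subsetI UN_I[of p] UN_I[of q]) (use assms in auto)

lemma conn_path:
  assumes "conn E X u v"
  shows "\<exists>g. path g \<and> pathstart g = \<phi> u \<and> pathfinish g = \<phi> v \<and> path_image g \<subseteq> drawing \<phi> E X"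
  using assms
proof (induction rule: conn_induct)
  case refl
  then have "path_image (linepath (\<phi> u) (\<phi> u)) \<subseteq> drawing \<phi> E X"
    using segment_subset_drawing[of u X u E \<phi>] by simp
  then show ?case
    by (intro exI[of _ "linepath (\<phi> u) (\<phi> u)"] conjI path_linepath pathstart_linepath pathfinish_linepath)
next
  case (step v w)
  then obtain g where g: "path g" "pathstart g = \<phi> u" "pathfinish g = \<phi> v" "path_image g \<subseteq> drawing \<phi> E X" by blast
  have "v \<in> X" using step conn_right by metis
  then have "closed_segment (\<phi> v) (\<phi> w) \<subseteq> drawing \<phi> E X" using step by (intro segment_subset_drawing) auto
  then have "path_image (g +++ linepath (\<phi> v) (\<phi> w)) \<subseteq> drawing \<phi> E X"
    using g by (subst path_image_join) auto
  then show ?case using g by (intro exI[of _ "g +++ linepath (\<phi> v) (\<phi> w)"]) simp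
qed

lemma of_int_add_frac:
  fixes s t :: real
  assumes "of_int a + s = of_int b + t" "0 \<le> s" "s < 1" "0 \<le> t" "t < 1"
  shows "a = b"
proof -
  have "\<lfloor>of_int a + s\<rfloor> = a" using assms by (intro floor_unique) auto
  moreover have "\<lfloor>of_int a + s\<rfloor> = b" unfolding assms(1) using assms by (intro floor_unique) auto
  ultimately show ?thesis by simp
qed

text \<open>A point of an edge is a vertex, or its coordinates have fractional parts (s, 0), (0, s)
  or (s, 1 - s) with 0 < s < 1. The pattern shows the direction of the edge, and the integer parts
  show which edge it is.\<close>

inductive point_on_edge :: "real ^ 2 \<Rightarrow> (int \<times> int) set \<Rightarrow> bool" for z where
  vertex: "w \<in> e \<Longrightarrow> z = emb w \<Longrightarrow> point_on_edge z e"
| horizontal: "0 < s \<Longrightarrow> s < 1 \<Longrightarrow> z $ 1 = of_int a + s \<Longrightarrow> z $ 2 = of_int b \<Longrightarrow> point_on_edge z {(a, b), (a + 1, b)}"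
| vertical: "0 < s \<Longrightarrow> s < 1 \<Longrightarrow> z $ 1 = of_int a \<Longrightarrow> z $ 2 = of_int b + s \<Longrightarrow> point_on_edge z {(a, b), (a, b + 1)}"
| diagonal: "0 < s \<Longrightarrow> s < 1 \<Longrightarrow> z $ 1 = of_int a + s \<Longrightarrow> z $ 2 = of_int b + (1 - s) \<Longrightarrow>
    point_on_edge z {(a, b + 1), (a + 1, b)}"

lemma point_on_edge_segment:
  assumes "z \<in> closed_segment (emb p) (emb q)" "hex_adj p q \<or> p = q"
  shows "point_on_edge z {p, q}"
proof -
  obtain c where c: "0 \<le> c" "c \<le> 1" "z = (1 - c) *\<^sub>R emb p + c *\<^sub>R emb q"
    using assms(1) by (auto simp: closed_segment_def)
  obtain m k m' k' where pq: "p = (m, k)" "q = (m', k')" by (metis surj_pair)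
  have z: "z $ 1 = of_int m + c * (of_int m' - of_int m)" "z $ 2 = of_int k + c * (of_int k' - of_int k)"
    unfolding c(3) pq by (simp_all add: algebra_simps)
  show ?thesis
  proof (cases "c = 0 \<or> c = 1 \<or> p = q")
    case True
    then have "z = emb p \<or> z = emb q" using c(3) by (auto simp flip: scaleR_left.add)
    then show ?thesis by (auto intro: vertex)
  next
    case False
    then have c01: "0 < c" "c < 1" "0 < 1 - c" "1 - c < 1" using c by auto
    have "(m' - m, k' - k) \<in> {(1, 0), (-1, 0), (0, 1), (0, -1), (1, -1), (-1, 1)}"
      using assms(2) False pq by (auto simp: hex_adj_def)
    then consider "m' = m + 1 \<and> k' = k" | "m = m' + 1 \<and> k' = k" | "m' = m \<and> k' = k + 1"
      | "m' = m \<and> k = k' + 1" | "m' = m + 1 \<and> k = k' + 1" | "m = m' + 1 \<and> k' = k + 1" by force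
    then show ?thesis
    proof cases
      case 1 then show ?thesis using horizontal[of c z m k] c01 z pq by auto
    next
      case 2 then show ?thesis
        using horizontal[of "1 - c" z m' k] c01 z pq by (auto simp: algebra_simps insert_commute)
    next
      case 3 then show ?thesis using vertical[of c z m k] c01 z pq by auto
    next
      case 4 then show ?thesis
        using vertical[of "1 - c" z m k'] c01 z pq by (auto simp: algebra_simps insert_commute)
    next
      case 5 then show ?thesis using diagonal[of c z m k'] c01 z pq by (auto simp: algebra_simps)
    next
      case 6 then show ?thesis
        using diagonal[of "1 - c" z m' k] c01 z pq by (auto simp: algebra_simps insert_commute)
    qed
  qed
qed

text \<open>Planarity of the drawing: by uniqueness of integer and fractional parts, an interior
  point of an edge lies on no other edge.\<close>

lemma point_on_edges_meet:
  assumes "point_on_edge z e" "point_on_edge z e'"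
  shows "e \<inter> e' \<noteq> {}"
proof -
  have 1: False if "real_of_int a + s = of_int b" "0 < s" "s < 1" for a b s
  proof -
    have "a = b" by (rule of_int_add_frac[of a s b 0]) (use that in simp_all)
    then have "real_of_int a = real_of_int b" by (rule arg_cong)
    then show False using that by linarith
  qed
  have 2: False if "real_of_int b = of_int a + s" "0 < s" "s < 1" for a b s
    using 1[of a s b] that by metis
  have 3: "a = b" if "real_of_int a + s = of_int b + t" "0 < s" "s < 1" "0 < t" "t < 1" for a b s t
    by (rule of_int_add_frac[of a s b t]) (use that in simp_all)
  have 4: False if "real_of_int a + (1 - s) = of_int b" "0 < s" "s < 1" for a b s
    by (rule 1[of a "1 - s" b]) (use that in simp_all)
  have 5: False if "real_of_int b = of_int a + (1 - s)" "0 < s" "s < 1" for a b s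
    by (rule 1[of a "1 - s" b]) (use that in simp_all)
  have 6: "a = b" if "real_of_int a + (1 - s) = of_int b + (1 - t)" "0 < s" "s < 1" "0 < t" "t < 1" for a b s t
    by (rule of_int_add_frac[of a "1 - s" b "1 - t"]) (use that in simp_all)
  show ?thesis
    using assms(1)
  proof cases
    case (vertex w)
    from assms(2) show ?thesis
    proof cases
      case v': (vertex w')
      then show ?thesis using vertex by auto
    qed (use vertex 2 5 in force)+
  next
    case h: (horizontal s a b)
    from assms(2) show ?thesis
    proof cases
      case (horizontal s' a' b')
      then show ?thesis using h 3[of a s a' s'] by auto
    next
      case (diagonal s' a' b')
      then show ?thesis using h 5[of b b' s'] by auto
    qed (use h 1 2 in force)+
  next
    case v: (vertical s a b)
    from assms(2) show ?thesis
    proof cases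
      case (vertical s' a' b')
      then show ?thesis using v 3[of b s b' s'] by auto
    qed (use v 1 2 5 in force)+
  next
    case d: (diagonal s a b)
    from assms(2) show ?thesis
    proof cases
      case (horizontal s' a' b')
      then show ?thesis using d 4[of b s b'] by auto
    next
      case (diagonal s' a' b')
      then show ?thesis using d 3[of a s a' s'] 6[of b s b' s'] by auto
    qed (use d 1 2 4 5 in force)+
  qed
qed

text \<open>The two paths meet in the square by the Fashoda theorem, and by planarity the two edges
  at the meeting point share a vertex, which would lie both in X and outside. Both colours use the
  same adjacency because all faces are triangles.\<close>

lemma blocking:
  assumes l: "conn hex_adj (X \<inter> rbox 0 n) l r" "fst l = - int n" "fst r = int n"
    and b: "conn hex_adj (rbox 0 n - X) b t" "snd b = - int n" "snd t = int n"
  shows False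
proof -
  let ?S = "drawing emb hex_adj"
  define lo hi :: "real ^ 2" where "lo = vector [- real n, - real n]" and "hi = vector [real n, real n]"
  have lohi [simp]: "lo $ 1 = - real n" "lo $ 2 = - real n" "hi $ 1 = real n" "hi $ 2 = real n"
    by (simp_all add: lo_def hi_def)
  have emb_box: "emb v \<in> cbox lo hi" if "v \<in> rbox 0 n" for v
    using that by (auto simp: mem_box_cart forall_2 rbox_eq)
  have S_box: "?S Y \<subseteq> cbox lo hi" if "Y \<subseteq> rbox 0 n" for Y
  proof -
    have "closed_segment (emb p) (emb q) \<subseteq> cbox lo hi" if "p \<in> Y" "q \<in> Y" for p q
      using that \<open>Y \<subseteq> _\<close> by (intro closed_segment_subset emb_box convex_box) auto
    then show ?thesis unfolding drawing_def by (intro UN_least) auto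
  qed
  obtain f where f: "path f" "pathstart f = emb l" "pathfinish f = emb r" "path_image f \<subseteq> ?S (X \<inter> rbox 0 n)"
    using conn_path[OF l(1)] by blast
  obtain g where g: "path g" "pathstart g = emb b" "pathfinish g = emb t" "path_image g \<subseteq> ?S (rbox 0 n - X)"
    using conn_path[OF b(1)] by blast
  obtain z where z: "z \<in> path_image f" "z \<in> path_image g"
  proof (rule fashoda[OF f(1) g(1)])
    show "path_image f \<subseteq> cbox lo hi" using f(4) S_box[of "X \<inter> rbox 0 n"] by auto
    show "path_image g \<subseteq> cbox lo hi" using g(4) S_box[of "rbox 0 n - X"] by auto
  qed (use l b f g in auto)
  obtain p q where pq: "p \<in> X" "q \<in> X" "hex_adj p q \<or> p = q" "z \<in> closed_segment (emb p) (emb q)"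
    using z(1) f(4) unfolding drawing_def by blast
  obtain p' q' where pq': "p' \<notin> X" "q' \<notin> X" "hex_adj p' q' \<or> p' = q'" "z \<in> closed_segment (emb p') (emb q')"
    using z(2) g(4) unfolding drawing_def by blast
  have "{p, q} \<inter> {p', q'} \<noteq> {}" using pq pq' by (intro point_on_edges_meet[of z] point_on_edge_segment)
  then show False using pq pq' by auto
qed

subsection \<open>One-arm events\<close>

definition arm :: "int \<times> int \<Rightarrow> nat \<Rightarrow> (int \<times> int) set \<Rightarrow> bool" where
  "arm x n A \<longleftrightarrow> (\<exists>v\<in>rim x n. conn hex_adj (A \<inter> rbox x n) x v)"

definition arm_prob :: "nat \<Rightarrow> real" where
  "arm_prob n = cube_prob (rbox 0 n) (arm 0 n)"

lemma conn_exit_rim: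
  assumes "conn hex_adj A u v" "hdist x u \<le> int n" "int n \<le> hdist x v"
  shows "\<exists>w\<in>rim x n. conn hex_adj (A \<inter> rbox x n) u w"
  using conn_exit[OF assms hdist_step] by (auto simp: rim_def rbox_def)

lemma armI: "conn hex_adj A x v \<Longrightarrow> int n \<le> hdist x v \<Longrightarrow> arm x n A"
  using conn_exit_rim[of A x v x n] by (simp add: arm_def)

lemma arm_mono: "arm x n A \<Longrightarrow> A \<subseteq> B \<Longrightarrow> arm x n B"
  unfolding arm_def by (meson conn_mono Int_mono order_refl)

lemma arm_antimono: "arm x n A \<Longrightarrow> m \<le> n \<Longrightarrow> arm x m A"
  unfolding arm_def[of x n] by (auto simp: rim_def intro!: armI elim!: conn_mono)

lemma arm_restrict: "rbox x n \<subseteq> V \<Longrightarrow> arm x n (A \<inter> V) = arm x n A"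
  unfolding arm_def by (simp add: Int_assoc Int_absorb1 inf.absorb2)

lemma cube_prob_marginal:
  assumes "finite V" "W \<subseteq> V"
  shows "cube_prob V (\<lambda>A. Q (A \<inter> W)) = cube_prob W Q"
  unfolding cube_prob_def by (rule cube_avg_marginal[OF assms, of "\<lambda>A. of_bool (Q A)"])

lemma cube_prob_translate:
  assumes "\<And>A. Q (plus x ` A) = R A"
  shows "cube_prob (rbox x n) Q = cube_prob (rbox 0 n) R"
proof -
  have "plus x ` rbox 0 n = rbox x n"
  proof
    show "rbox x n \<subseteq> plus x ` rbox 0 n"
    proof
      fix v assume "v \<in> rbox x n"
      then have "v - x \<in> rbox 0 n" "v = x + (v - x)" by (auto simp: rbox_def hdist_def)
      then show "v \<in> plus x ` rbox 0 n" by blast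
    qed
  qed (auto simp: rbox_def hdist_def)
  then show ?thesis
    using cube_avg_image[of "plus x" "rbox 0 n" "\<lambda>A. of_bool (Q A)"] assms by (simp add: cube_prob_def)
qed

lemma hex_adj_translate [simp]: "hex_adj (x + u) (x + v) = hex_adj u v"
  by (simp add: hex_adj_def)

lemma conn_translate: "conn hex_adj (plus x ` X) (x + u) (x + v) \<longleftrightarrow> conn hex_adj X u v"
proof
  assume "conn hex_adj (plus x ` X) (x + u) (x + v)"
  then have "conn hex_adj (plus (- x) ` plus x ` X) (- x + (x + u)) (- x + (x + v))"
    by (rule conn_image) (simp only: hex_adj_translate)
  moreover have "plus (- x) ` plus x ` X = X" by (simp add: image_image)
  ultimately show "conn hex_adj X u v" by simp
qed (rule conn_image, simp_all)

lemma arm_translate: "arm x n (plus x ` A) = arm 0 n A"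
proof -
  have rb: "plus x ` A \<inter> rbox x n = plus x ` (A \<inter> rbox 0 n)"
    by (auto simp: rbox_def hdist_def)
  have "(\<exists>v\<in>rim x n. P v) \<longleftrightarrow> (\<exists>v\<in>rim 0 n. P (x + v))" for P
  proof
    assume "\<exists>v\<in>rim x n. P v"
    then obtain v where "v \<in> rim x n" "P (x + (v - x))" by auto
    moreover from this have "v - x \<in> rim 0 n" by (simp add: rim_def hdist_def)
    ultimately show "\<exists>v\<in>rim 0 n. P (x + v)" by blast
  next
    assume "\<exists>v\<in>rim 0 n. P (x + v)"
    then obtain v where "v \<in> rim 0 n" "P (x + v)" by auto
    moreover from this have "x + v \<in> rim x n" by (simp add: rim_def hdist_def)
    ultimately show "\<exists>v\<in>rim x n. P v" by blast
  qed
  then show ?thesis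
    unfolding arm_def rb using conn_translate[of x "A \<inter> rbox 0 n" 0] by simp
qed

lemma arm_prob_eq:
  assumes "finite V" "rbox x n \<subseteq> V"
  shows "cube_prob V (arm x n) = arm_prob n"
proof -
  have "cube_prob V (arm x n) = cube_prob V (\<lambda>A. arm x n (A \<inter> rbox x n))"
    by (simp add: arm_restrict)
  also have "\<dots> = cube_prob (rbox x n) (arm x n)" by (rule cube_prob_marginal[OF assms])
  also have "\<dots> = arm_prob n" unfolding arm_prob_def by (rule cube_prob_translate) (rule arm_translate)
  finally show ?thesis .
qed

text \<open>Sites of the box missing from V only make the arm rarer, so V is enlarged to contain the
  box.\<close>

lemma arm_prob_ge:
  assumes "finite V"
  shows "cube_prob V (arm x n) \<le> arm_prob n"
proof -
  have "cube_prob V (arm x n) = cube_prob (V \<union> rbox x n) (\<lambda>A. arm x n (A \<inter> V))"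
    using assms by (simp add: cube_prob_marginal)
  also have "\<dots> \<le> cube_prob (V \<union> rbox x n) (arm x n)"
    by (rule cube_prob_mono) (auto elim: arm_mono)
  also have "\<dots> = arm_prob n" using assms by (intro arm_prob_eq) auto
  finally show ?thesis .
qed

lemma arm_prob_decseq: "decseq arm_prob"
proof (rule decseq_SucI)
  fix n
  have "arm_prob (Suc n) = cube_prob (rbox 0 (Suc n)) (arm 0 (Suc n))" by (simp add: arm_prob_def)
  also have "\<dots> \<le> cube_prob (rbox 0 (Suc n)) (arm 0 n)" by (rule cube_prob_mono) (auto elim: arm_antimono)
  also have "\<dots> = arm_prob n" by (rule arm_prob_eq[OF finite_rbox]) (auto simp: rbox_def)
  finally show "arm_prob (Suc n) \<le> arm_prob n" .
qed

subsection \<open>Large boxes are connected to infinity\<close>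

lemma cube_avg_indep_prod:
  fixes g :: "nat \<Rightarrow> 'v set \<Rightarrow> real"
  assumes "finite V" "\<And>i. i < K \<Longrightarrow> S i \<subseteq> V" "\<And>i j. i < j \<Longrightarrow> j < K \<Longrightarrow> S i \<inter> S j = {}"
    and "\<And>i A. i < K \<Longrightarrow> g i A = g i (A \<inter> S i)"
  shows "cube_avg V (\<lambda>A. \<Prod>i<K. g i A) = (\<Prod>i<K. cube_avg V (g i))"
  using assms(2-)
proof (induction K)
  case 0
  then show ?case using assms(1) by simp
next
  case (Suc K)
  let ?U = "\<Union>i<K. S i"
  have "cube_avg V (\<lambda>A. (\<Prod>i<K. g i A) * g K A) = cube_avg V (\<lambda>A. \<Prod>i<K. g i A) * cube_avg V (g K)"
  proof (rule cube_avg_indep[OF assms(1), of ?U])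
    fix A
    have "g i A = g i (A \<inter> ?U)" if "i < K" for i
    proof -
      have "A \<inter> ?U \<inter> S i = A \<inter> S i" using that by auto
      then show ?thesis using Suc.prems(3)[of i A] Suc.prems(3)[of i "A \<inter> ?U"] that by simp
    qed
    then show "(\<Prod>i<K. g i A) = (\<Prod>i<K. g i (A \<inter> ?U))" by simp
    have "(A - ?U) \<inter> S K = A \<inter> S K" using Suc.prems(2)[of _ K] by auto
    then show "g K A = g K (A - ?U)" using Suc.prems(3)[of K A] Suc.prems(3)[of K "A - ?U"] by simp
    show "?U \<subseteq> V" by (intro UN_least Suc.prems(1)) auto
  qed
  moreover have "cube_avg V (\<lambda>A. \<Prod>i<K. g i A) = (\<Prod>i<K. cube_avg V (g i))"
  proof (rule Suc.IH)
    show "S i \<subseteq> V" if "i < K" for i using that by (intro Suc.prems(1)) simp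
    show "S i \<inter> S j = {}" if "i < j" "j < K" for i j using that by (intro Suc.prems(2)) simp_all
    show "g i A = g i (A \<inter> S i)" if "i < K" for i A by (rule Suc.prems(3)) (use that in simp)
  qed
  ultimately show ?case by simp
qed

definition box_arm :: "nat \<Rightarrow> nat \<Rightarrow> (int \<times> int) set \<Rightarrow> bool" where
  "box_arm m n A \<longleftrightarrow> (\<exists>u\<in>rbox 0 m. \<exists>v\<in>rim 0 n. conn hex_adj A u v)"

text \<open>If the one-arm probability at scale \<open>r\<close> nearly equals its limit, then a site with an arm to
  distance \<open>r\<close> has one to distance \<open>n\<close> with probability close to 1; and among many independent sites
  one has an arm to distance \<open>r\<close>.\<close>

lemma box_arm_prob:
  assumes \<theta>: "0 < \<theta>" "\<And>n. \<theta> \<le> arm_prob n" and "0 < \<epsilon>"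
  shows "\<exists>m. \<forall>n\<ge>m. 1 - \<epsilon> \<le> cube_prob (rbox 0 n) (box_arm m n)"
proof -
  have "\<theta> \<le> 1" using \<theta>(2)[of 0] cube_prob_le_1[of "rbox 0 0" "arm 0 0"] by (simp add: arm_prob_def)
  \<comment> \<open>K independent sites all lack an arm with probability at most
    \<open>(1 - \<theta>) ^ K\<close>. Half of the error is spent on this, and \<delta> divides the
    other half among the K sites.\<close>
  then obtain K where K: "(1 - \<theta>) ^ K < \<epsilon> / 2" using real_arch_pow_inv[of "\<epsilon> / 2" "1 - \<theta>"] \<theta>(1) \<open>0 < \<epsilon>\<close> by auto
  define \<delta> where "\<delta> = \<epsilon> / (2 * real (Suc K))"
  have \<delta>: "0 < \<delta>" using \<open>0 < \<epsilon>\<close> by (simp add: \<delta>_def)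
  obtain L where L: "arm_prob \<longlonglongrightarrow> L" "\<And>n. L \<le> arm_prob n"
    using decseq_convergent[OF arm_prob_decseq, of \<theta>] \<theta>(2) by auto
  have "eventually (\<lambda>r. arm_prob r < L + \<delta>) sequentially"
    using L(1) \<delta> by (intro order_tendstoD(2)) auto
  then obtain r where r: "arm_prob r < L + \<delta>" by (auto simp: eventually_sequentially)
  \<comment> \<open>Spacing 2 r + 1 makes the boxes of radius r disjoint, so the arm events of the
    sites \<open>x i\<close> are independent.\<close>
  define x where "x i = (int (i * (2 * r + 1)), 0 :: int)" for i :: nat
  define m where "m = K * (2 * r + 1) + r"
  have "1 - \<epsilon> \<le> cube_prob (rbox 0 n) (box_arm m n)" if "n \<ge> m" for n
  proof -
    let ?V = "rbox 0 n" and ?far = "\<lambda>i A. \<exists>v\<in>rim 0 n. conn hex_adj A (x i) v"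
    have x_m: "hdist 0 (x i) + int r \<le> int m" if "i < K" for i
    proof -
      have "i * (2 * r + 1) \<le> K * (2 * r + 1)" using that by (intro mult_right_mono) auto
      then have "int (i * (2 * r + 1)) \<le> int (K * (2 * r + 1))" by (simp only: of_nat_le_iff)
      moreover have "hdist 0 (x i) = int (i * (2 * r + 1))" by (simp add: x_def hdist_def)
      ultimately show ?thesis by (simp add: m_def)
    qed
    have sub: "rbox (x i) r \<subseteq> ?V" if "i < K" for i
    proof
      fix v assume "v \<in> rbox (x i) r"
      then show "v \<in> ?V"
        using x_m[OF that] hdist_triangle[of 0 v "x i"] \<open>n \<ge> m\<close> by (simp add: rbox_def)
    qed
    have disj: "rbox (x i) r \<inter> rbox (x j) r = {}" if "i < j" for i j
    proof -
      have "(i + 1) * (2 * r + 1) \<le> j * (2 * r + 1)" using that by (intro mult_right_mono) auto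
      then have "int ((i + 1) * (2 * r + 1)) \<le> int (j * (2 * r + 1))" by (simp only: of_nat_le_iff)
      then have *: "int (i * (2 * r + 1)) + (2 * int r + 1) \<le> int (j * (2 * r + 1))" by (simp add: algebra_simps)
      show ?thesis
      proof (rule ccontr)
        assume "rbox (x i) r \<inter> rbox (x j) r \<noteq> {}"
        then obtain v where "v \<in> rbox (x i) r" "v \<in> rbox (x j) r" by blast
        then have "fst v \<le> int (i * (2 * r + 1)) + int r" "int (j * (2 * r + 1)) - int r \<le> fst v"
          unfolding rbox_eq x_def by (auto simp del: of_nat_mult)
        then show False using * by linarith
      qed
    qed
    have none: "cube_prob ?V (\<lambda>A. \<forall>i<K. \<not> arm (x i) r A) \<le> \<epsilon> / 2"
    proof -
      have "cube_prob ?V (\<lambda>A. \<forall>i<K. \<not> arm (x i) r A) = cube_avg ?V (\<lambda>A. \<Prod>i<K. of_bool (\<not> arm (x i) r A))"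
        unfolding cube_prob_def by (intro cube_avg_cong) (auto simp: of_bool_def)
      also have "\<dots> = (\<Prod>i<K. cube_avg ?V (\<lambda>A. of_bool (\<not> arm (x i) r A)))"
        by (rule cube_avg_indep_prod[where S = "\<lambda>i. rbox (x i) r"]) (auto simp: arm_restrict sub[THEN subsetD] disj)
      also have "\<dots> = (\<Prod>i<K. 1 - arm_prob r)"
        by (intro prod.cong refl) (simp add: cube_prob_not arm_prob_eq sub flip: cube_prob_def)
      also have "\<dots> \<le> (1 - \<theta>) ^ K"
        using \<theta>(2)[of r] cube_prob_le_1[of "rbox 0 r" "arm 0 r"] by (auto simp: arm_prob_def intro!: power_mono)
      finally show ?thesis using K by linarith
    qed
    have stop: "cube_prob ?V (\<lambda>A. arm (x i) r A \<and> \<not> ?far i A) \<le> \<delta>" if i: "i < K" for i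
    proof -
      have far_arm: "arm (x i) r A" if "?far i A" for A
      proof -
        obtain v where v: "v \<in> rim 0 n" "conn hex_adj A (x i) v" using \<open>?far i A\<close> by blast
        have "int r \<le> hdist (x i) v"
          using v(1) x_m[OF i] \<open>n \<ge> m\<close> hdist_triangle[of 0 v "x i"] by (simp add: rim_def)
        then show ?thesis using v(2) by (intro armI)
      qed
      have "L \<le> cube_prob ?V (?far i)"
      proof -
        \<comment> \<open>An arm of length n + m from \<open>x i\<close> leaves the box of radius n
          around 0, so the limit L bounds from below the probability of reaching the rim of that
          box.\<close>
        let ?W = "rbox (x i) (n + m)"
        have VW: "?V \<subseteq> ?W"
        proof
          fix v assume "v \<in> ?V"
          then show "v \<in> ?W"
            using x_m[OF i] hdist_triangle[of "x i" v 0] hdist_commute[of "x i" 0] by (simp add: rbox_def)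
        qed
        have "L \<le> arm_prob (n + m)" by (rule L(2))
        also have "\<dots> = cube_prob ?W (arm (x i) (n + m))" by (simp add: arm_prob_eq)
        also have "\<dots> \<le> cube_prob ?W (\<lambda>A. ?far i (A \<inter> ?V))"
        proof (rule cube_prob_mono)
          fix A assume "arm (x i) (n + m) A"
          then obtain v where v: "v \<in> rim (x i) (n + m)" "conn hex_adj (A \<inter> ?W) (x i) v" by (auto simp: arm_def)
          have "int n \<le> hdist 0 v" "hdist 0 (x i) \<le> int n"
            using v(1) x_m[OF i] \<open>n \<ge> m\<close> hdist_triangle[of "x i" v 0] hdist_commute[of "x i" 0]
            by (simp_all add: rim_def)
          from conn_exit_rim[OF v(2) this(2,1)] show "?far i (A \<inter> ?V)"
            by (auto elim!: conn_mono)
        qed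
        also have "\<dots> = cube_prob ?V (?far i)" using VW by (intro cube_prob_marginal) auto
        finally show ?thesis .
      qed
      moreover have "cube_prob ?V (\<lambda>A. arm (x i) r A \<and> \<not> ?far i A) = cube_prob ?V (arm (x i) r) - cube_prob ?V (?far i)"
        unfolding cube_prob_def cube_avg_diff[symmetric] using far_arm by (intro cube_avg_cong) auto
      ultimately show ?thesis using r arm_prob_eq[OF _ sub[OF i]] by simp
    qed
    have "cube_prob ?V (\<lambda>A. \<not> box_arm m n A)
      \<le> (\<Sum>i\<in>{..K}. cube_prob ?V (if i < K then (\<lambda>A. arm (x i) r A \<and> \<not> ?far i A) else (\<lambda>A. \<forall>i<K. \<not> arm (x i) r A)))"
    proof (rule cube_prob_UN)
      fix A assume not: "\<not> box_arm m n A"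
      have "x i \<in> rbox 0 m" if "i < K" for i using x_m[OF that] by (simp add: rbox_def)
      then have nf: "\<not> ?far i A" if "i < K" for i using not that by (auto simp: box_arm_def)
      show "\<exists>i\<in>{..K}. (if i < K then (\<lambda>A. arm (x i) r A \<and> \<not> ?far i A) else (\<lambda>A. \<forall>i<K. \<not> arm (x i) r A)) A"
      proof (cases "\<forall>i<K. \<not> arm (x i) r A")
        case True
        then show ?thesis by (intro bexI[of _ K]) auto
      next
        case False
        then obtain i where "i < K" "arm (x i) r A" by auto
        then show ?thesis using nf by (intro bexI[of _ i]) auto
      qed
    qed simp
    also have "\<dots> = (\<Sum>i<K. cube_prob ?V (\<lambda>A. arm (x i) r A \<and> \<not> ?far i A)) + cube_prob ?V (\<lambda>A. \<forall>i<K. \<not> arm (x i) r A)"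
      unfolding lessThan_Suc_atMost[symmetric] by simp
    also have "\<dots> \<le> (\<Sum>i<K. \<delta>) + \<epsilon> / 2" by (intro add_mono sum_mono stop none) auto
    also have "\<dots> \<le> \<epsilon>"
    proof -
      have "real K * \<delta> \<le> real (Suc K) * \<delta>" using \<delta> by (intro mult_right_mono) auto
      also have "\<dots> = \<epsilon> / 2" by (simp add: \<delta>_def field_simps)
      finally show ?thesis by simp
    qed
    finally show ?thesis by (simp add: cube_prob_not)
  qed
  then show ?thesis by blast
qed

subsection \<open>Uniqueness of the crossing cluster\<close>

text \<open>A connection from the block to the distant rim around x crosses \<open>rim 0 n\<close>,
  and separation persists when sites are removed. So the split events at different x are all seen
  within one box.\<close>

lemma split_block_restrict:
  assumes "split_block hex_adj (rim x N) (rbox x m) A"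
    and V: "\<And>y. y \<in> rim x N \<Longrightarrow> int n \<le> hdist 0 y" and B: "rbox x m \<subseteq> rbox 0 n"
  shows "split_block hex_adj (rim 0 n) (rbox x m) (A \<inter> rbox 0 n)"
proof -
  let ?V = "rbox 0 n"
  obtain u v y z where uv: "u \<in> rbox x m" "v \<in> rbox x m" "y \<in> rim x N" "z \<in> rim x N"
    "conn hex_adj A y u" "conn hex_adj A z v" "\<not> conn hex_adj A u v"
    using assms(1) by (auto simp: split_block_def cluster_def)
  have "w \<in> cluster hex_adj (rim 0 n) (A \<inter> ?V)" if "w \<in> rbox x m" "y \<in> rim x N" "conn hex_adj A y w" for w y
  proof -
    have "hdist 0 w \<le> int n" using that(1) B by (auto simp: rbox_def)
    from conn_exit_rim[OF conn_sym[OF symp_hex_adj that(3)] this V[OF that(2)]]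
    obtain y' where "y' \<in> rim 0 n" "conn hex_adj (A \<inter> ?V) w y'" by blast
    from conn_sym[OF symp_hex_adj this(2)] have "conn hex_adj (A \<inter> ?V) y' w" .
    with \<open>y' \<in> rim 0 n\<close> show ?thesis unfolding cluster_def by blast
  qed
  moreover have "\<not> conn hex_adj (A \<inter> ?V) u v" using uv(7) conn_mono[of hex_adj "A \<inter> ?V" u v A] by auto
  ultimately show ?thesis using uv unfolding split_block_def by blast
qed

lemma mem_translate:
  fixes x :: "'a :: ab_group_add"
  shows "v \<in> plus x ` S \<longleftrightarrow> v - x \<in> S"
proof
  assume "v - x \<in> S"
  then have "x + (v - x) \<in> plus x ` S" by (rule imageI)
  then show "v \<in> plus x ` S" by simp
qed auto

lemma split_block_translate:
  "split_block hex_adj (rim x N) (rbox x m) (plus x ` A) = split_block hex_adj (rim 0 N) (rbox 0 m) A"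
proof -
  have trans: "plus x ` rbox 0 k = rbox x k" "plus x ` rim 0 k = rim x k" for k
    by (rule set_eqI, simp add: mem_translate rbox_def rim_def hdist_def)+
  have "split_block hex_adj (plus x ` Y) (plus x ` B) (plus x ` A) = split_block hex_adj Y B A" for Y B
    unfolding split_block_def cluster_def by (simp add: conn_translate)
  from this[of "rim 0 N" "rbox 0 m"] show ?thesis by (simp only: trans)
qed

text \<open>The bound on bridge sites concerns their total number, so it is shared among all
  positions x of the block, which are equally likely to be split by translation. Each bridge site
  serves at most \<open>card (rbox 0 m)\<close> positions. The rim of radius 2 n around x encloses
  the box of radius n, and the margin \<open>Suc m\<close> keeps the block off
  \<open>rim 0 n\<close>. The 7 is one plus the degree.\<close>

lemma split_block_prob_sum:
  assumes "Suc m \<le> n" "0 < t" "t \<le> 1 / 2"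
  shows "card (rbox 0 (n - Suc m)) * cube_prob (rbox 0 (2 * n)) (split_block hex_adj (rim 0 (2 * n)) (rbox 0 m))
    \<le> 2 ^ card (rbox 0 m) * card (rbox 0 m) *
      (card (rim 0 n) + 2 * t * (7 * real (card (rbox 0 n))) + card (rim 0 n) / t)"
proof -
  let ?V = "rbox 0 n" and ?X = "rbox 0 (n - Suc m)" and ?B = "rbox 0 m"
  let ?P = "cube_prob (rbox 0 (2 * n)) (split_block hex_adj (rim 0 (2 * n)) ?B)"
  let ?b = "\<lambda>y. cube_prob ?V (\<lambda>A. bridge_site hex_adj (rim 0 n) A y)"
  have each: "?P \<le> 2 ^ card ?B * (\<Sum>w\<in>?B. ?b (x + w))" if x: "x \<in> ?X" for x
  proof -
    have x0: "hdist 0 x \<le> int n - int (Suc m)" using x assms(1) by (simp add: rbox_def of_nat_diff)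
    have B: "rbox x m \<subseteq> ?V"
    proof
      fix v assume "v \<in> rbox x m"
      then show "v \<in> ?V" using x0 hdist_triangle[of 0 v x] by (simp add: rbox_def)
    qed
    have V2: "?V \<subseteq> rbox x (2 * n)"
    proof
      fix v assume "v \<in> ?V"
      then show "v \<in> rbox x (2 * n)"
        using x0 hdist_triangle[of x v 0] hdist_commute[of x 0] by (simp add: rbox_def)
    qed
    have far: "int n \<le> hdist 0 y" if "y \<in> rim x (2 * n)" for y
      using that x0 hdist_triangle[of x y 0] hdist_commute[of x 0] by (simp add: rim_def)
    have disj: "rim 0 n \<inter> rbox x m = {}"
    proof (rule ccontr)
      assume "rim 0 n \<inter> rbox x m \<noteq> {}"
      then obtain v where "v \<in> rim 0 n" "v \<in> rbox x m" by blast
      then show False using x0 hdist_triangle[of 0 v x] by (simp add: rim_def rbox_def)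
    qed
    have "?P = cube_prob (rbox x (2 * n)) (split_block hex_adj (rim x (2 * n)) (rbox x m))"
      by (rule cube_prob_translate[symmetric]) (rule split_block_translate)
    also have "\<dots> \<le> cube_prob (rbox x (2 * n)) (\<lambda>A. split_block hex_adj (rim 0 n) (rbox x m) (A \<inter> ?V))"
      by (rule cube_prob_mono) (rule split_block_restrict[OF _ far B])
    also have "\<dots> = cube_prob ?V (split_block hex_adj (rim 0 n) (rbox x m))"
      by (rule cube_prob_marginal[OF finite_rbox V2])
    also have "\<dots> \<le> 2 ^ card (rbox x m) * (\<Sum>y\<in>rbox x m. ?b y)"
      by (rule split_block_prob_le[OF finite_rbox B symp_hex_adj disj conn_rbox])
    also have "card (rbox x m) = card ?B" by (simp add: card_rbox)
    also have "(\<Sum>y\<in>rbox x m. ?b y) = (\<Sum>w\<in>?B. ?b (x + w))"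
      by (rule sum.reindex_bij_witness[where i = "plus x" and j = "\<lambda>y. y - x"]) (auto simp: rbox_def hdist_def)
    finally show ?thesis .
  qed
  have shift: "(\<Sum>x\<in>?X. ?b (x + w)) \<le> (\<Sum>y\<in>?V. ?b y)" if w: "w \<in> ?B" for w
  proof -
    have "(\<Sum>x\<in>?X. ?b (x + w)) = (\<Sum>y\<in>(\<lambda>x. x + w) ` ?X. ?b y)"
      by (subst sum.reindex) (auto simp: inj_on_def)
    also have "\<dots> \<le> (\<Sum>y\<in>?V. ?b y)"
    proof (rule sum_mono2[OF finite_rbox])
      show "(\<lambda>x. x + w) ` ?X \<subseteq> ?V"
      proof
        fix v assume "v \<in> (\<lambda>x. x + w) ` ?X"
        then obtain x where x: "v = x + w" "x \<in> ?X" by blast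
        have "hdist x v = hdist 0 w" by (simp add: x(1) hdist_def)
        then show "v \<in> ?V"
          using x(2) w hdist_triangle[of 0 v x] assms(1) by (simp add: rbox_def of_nat_diff)
      qed
    qed (simp add: cube_prob_nonneg)
    finally show ?thesis .
  qed
  have "card ?X * ?P = (\<Sum>x\<in>?X. ?P)" by simp
  also have "\<dots> \<le> (\<Sum>x\<in>?X. 2 ^ card ?B * (\<Sum>w\<in>?B. ?b (x + w)))" by (intro sum_mono each)
  also have "\<dots> = 2 ^ card ?B * (\<Sum>w\<in>?B. \<Sum>x\<in>?X. ?b (x + w))"
    unfolding sum_distrib_left[symmetric] by (subst sum.swap) (rule refl)
  also have "\<dots> \<le> 2 ^ card ?B * (\<Sum>w\<in>?B. \<Sum>y\<in>?V. ?b y)" by (intro mult_left_mono sum_mono shift) auto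
  also have "\<dots> = 2 ^ card ?B * card ?B * (\<Sum>y\<in>?V. ?b y)" by simp
  also have "\<dots> \<le> 2 ^ card ?B * card ?B * (card (rim 0 n) + 2 * t * (real (Suc 6) * card ?V) + card (rim 0 n) / t)"
    by (intro mult_left_mono bridge_sites_le finite_rbox symp_hex_adj rim_subset_rbox hex_degree assms) auto
  finally show ?thesis by simp
qed

lemma split_block_prob_tendsto:
  "(\<lambda>n. cube_prob (rbox 0 (2 * n)) (split_block hex_adj (rim 0 (2 * n)) (rbox 0 m))) \<longlonglongrightarrow> 0"
proof -
  define c where "c = 2 ^ card (rbox 0 m) * real (card (rbox 0 m))"
  let ?P = "\<lambda>n. cube_prob (rbox 0 (2 * n)) (split_block hex_adj (rim 0 (2 * n)) (rbox 0 m))"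
  have bound: "?P n \<le> 88 * c / sqrt (2 * real n + 1)" if n: "n \<ge> 2 * Suc m" for n
  proof -
    define N where "N = 2 * real n + 1"
    \<comment> \<open>This t balances the volume term t N^2 against the boundary term N / t, both of
      order N^(3/2). There are at least N^2 / 4 positions, whence 88 = 4 (4 + 14 + 4).\<close>
    define t where "t = 1 / sqrt N"
    have N: "4 \<le> N" using n by (simp add: N_def)
    then have "sqrt 4 \<le> sqrt N" by (rule real_sqrt_le_mono)
    then have s: "2 \<le> sqrt N" by simp
    have t: "0 < t" "t \<le> 1 / 2" using s N by (simp_all add: t_def field_simps)
    have c0: "0 \<le> c" by (simp add: c_def)
    have rim: "card (rim 0 n) \<le> 4 * N" 
    proof -
      have "real (card (rim 0 n)) \<le> real (4 * (2 * n + 1))" using card_rim_le[of 0 n] by (simp only: of_nat_le_iff)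
      then show ?thesis by (simp add: N_def)
    qed
    have box: "real (card (rbox 0 n)) = N\<^sup>2" by (simp add: card_rbox N_def)
    have "real n + 1 \<le> 2 * real (n - Suc m) + 1" using n by (simp add: of_nat_diff)
    moreover have "N / 2 \<le> real n + 1" by (simp add: N_def)
    ultimately have half: "N / 2 \<le> 2 * real (n - Suc m) + 1" by linarith
    then have "(N / 2)\<^sup>2 \<le> (2 * real (n - Suc m) + 1)\<^sup>2" using N by (intro power_mono) auto
    then have X: "N\<^sup>2 / 4 \<le> card (rbox 0 (n - Suc m))" by (simp add: card_rbox power_divide add.commute)
    have NN: "sqrt N * sqrt N = N" using N by simp
    have "N\<^sup>2 / 4 * ?P n \<le> card (rbox 0 (n - Suc m)) * ?P n"
      by (intro mult_right_mono X cube_prob_nonneg)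
    also have "\<dots> \<le> c * (card (rim 0 n) + 2 * t * (7 * real (card (rbox 0 n))) + card (rim 0 n) / t)"
      using split_block_prob_sum[of m n t] n t by (simp add: c_def)
    also have "\<dots> \<le> c * (4 * N + 2 * t * (7 * N\<^sup>2) + 4 * N / t)"
      unfolding box using rim t c0 by (intro mult_left_mono add_mono divide_right_mono) auto
    also have "\<dots> \<le> c * (4 * (N * sqrt N) + 14 * (N * sqrt N) + 4 * (N * sqrt N))"
    proof (rule mult_left_mono[OF add_mono[OF add_mono] c0])
      show "4 * N \<le> 4 * (N * sqrt N)" using s N by simp
      have "t * N = N / sqrt N" by (simp add: t_def)
      also have "\<dots> = sqrt N" using N by (intro real_div_sqrt) simp
      finally have "t * N = sqrt N" .
      moreover have "2 * t * (7 * N\<^sup>2) = 14 * (N * (t * N))" by (simp add: power2_eq_square mult_ac)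
      ultimately show "2 * t * (7 * N\<^sup>2) \<le> 14 * (N * sqrt N)" by simp
      show "4 * N / t \<le> 4 * (N * sqrt N)" by (simp add: t_def)
    qed
    also have "\<dots> = 22 * c * (N * sqrt N)" by (simp add: algebra_simps)
    finally have "N * N * ?P n \<le> N * (88 * c * sqrt N)" by (simp add: power2_eq_square algebra_simps)
    then have "N * ?P n \<le> 88 * c * sqrt N" using N by (simp add: mult.assoc)
    then have "sqrt N * (sqrt N * ?P n) \<le> sqrt N * (88 * c)"
      unfolding mult.assoc[symmetric] NN by (simp add: mult_ac)
    then have "sqrt N * ?P n \<le> 88 * c" by (rule mult_left_le_imp_le) (use s in linarith)
    moreover have "0 < sqrt N" using s by linarith
    ultimately show ?thesis unfolding N_def[symmetric] by (simp only: pos_le_divide_eq mult.commute)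
  qed
  have lim: "(\<lambda>n. 88 * c / sqrt (2 * real n + 1)) \<longlonglongrightarrow> 0" by real_asymp
  show ?thesis
  proof (rule tendsto_sandwich[OF _ _ tendsto_const lim])
    show "\<forall>\<^sub>F n in sequentially. ?P n \<le> 88 * c / sqrt (2 * real n + 1)"
      using bound by (auto simp: eventually_sequentially)
  qed (simp add: cube_prob_nonneg)
qed

subsection \<open>The one-arm probability tends to zero\<close>

definition side_arm :: "(int \<times> int) set \<Rightarrow> nat \<Rightarrow> (int \<times> int) set \<Rightarrow> bool" where
  "side_arm Z m A \<longleftrightarrow> (\<exists>u\<in>rbox 0 m. \<exists>v\<in>Z. conn hex_adj A u v)"

lemma side_arm_mono: "side_arm Z m A \<Longrightarrow> A \<subseteq> B \<Longrightarrow> side_arm Z m B"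
  unfolding side_arm_def using conn_mono[of hex_adj A _ _ B] by blast

lemma cube_prob_side_arm_image:
  assumes "inj \<phi>" "\<phi> ` rbox 0 n = rbox 0 n" "\<phi> ` rbox 0 m = rbox 0 m"
    and adj: "\<And>u v. hex_adj (\<phi> u) (\<phi> v) = hex_adj u v"
  shows "cube_prob (rbox 0 n) (side_arm (\<phi> ` Z) m) = cube_prob (rbox 0 n) (side_arm Z m)"
proof -
  have "conn hex_adj (\<phi> ` A) (\<phi> u) (\<phi> v) = conn hex_adj A u v" for A u v
  proof
    have inv: "inv \<phi> (\<phi> w) = w" for w using assms(1) by simp
    assume "conn hex_adj (\<phi> ` A) (\<phi> u) (\<phi> v)"
    \<comment> \<open>\<open>inv \<phi>\<close> respects adjacency on the range of \<phi>, so the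
      edges are confined to that range before being mapped back.\<close>
    then have "conn (\<lambda>x y. x \<in> range \<phi> \<and> y \<in> range \<phi> \<and> hex_adj x y) (\<phi> ` A) (\<phi> u) (\<phi> v)"
      (is "conn ?E _ _ _")
    proof (induction rule: conn_induct)
      case (step v w)
      then show ?case using conn_right[OF step.IH] by (auto intro!: conn_step[OF step.IH])
    qed (auto intro: conn_refl)
    moreover have "hex_adj (inv \<phi> x) (inv \<phi> y)" if "x \<in> range \<phi> \<and> y \<in> range \<phi> \<and> hex_adj x y" for x y
      using that by (auto simp: inv adj)
    ultimately have "conn hex_adj (inv \<phi> ` \<phi> ` A) (inv \<phi> (\<phi> u)) (inv \<phi> (\<phi> v))"
      by (rule conn_image)
    then show "conn hex_adj A u v" by (simp add: inv image_image)
  qed (rule conn_image, simp_all add: adj)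
  then have "(\<exists>u\<in>\<phi> ` rbox 0 m. \<exists>v\<in>\<phi> ` Z. conn hex_adj (\<phi> ` A) u v) = side_arm Z m A" for A
    by (simp add: side_arm_def)
  then have "side_arm (\<phi> ` Z) m (\<phi> ` A) = side_arm Z m A" for A
    by (simp add: side_arm_def[of "\<phi> ` Z"] assms(3))
  then show ?thesis
    using cube_avg_image[of \<phi> "rbox 0 n" "\<lambda>A. of_bool (side_arm (\<phi> ` Z) m A)"] assms(1,2)
    by (simp add: cube_prob_def inj_on_subset)
qed

text \<open>The absences of an arm to each side are decreasing events of equal probability, so by
  Harris they occur jointly with probability at least \<open>(1 - p) ^ 4\<close>; jointly they say
  that no arm reaches the rim.\<close>

lemma fourth_root_trick:
  assumes sides: "rim 0 n = Z 0 \<union> Z 1 \<union> Z 2 \<union> Z (3::nat)"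
    and eq: "\<And>i. i < 4 \<Longrightarrow> cube_prob (rbox 0 n) (side_arm (Z i) m) = p"
  shows "(1 - p) ^ 4 \<le> 1 - cube_prob (rbox 0 n) (box_arm m n)"
proof -
  let ?V = "rbox 0 n" and ?f = "\<lambda>i A. of_bool (\<not> side_arm (Z i) m A) :: real"
  have f: "cube_avg ?V (?f i) = 1 - p" if "i < 4" for i
    using cube_prob_not[of ?V "side_arm (Z i) m"] eq[OF that] by (simp add: cube_prob_def)
  have anti: "?f i B \<le> ?f i A" if "A \<subseteq> B" for i A B using side_arm_mono[of "Z i" m A B] that by auto
  have anti2: "?f i B * ?f j B \<le> ?f i A * ?f j A" if "A \<subseteq> B" for i j A B
    using anti[OF that] by (intro mult_mono) auto
  have "(1 - p) ^ 4 = (cube_avg ?V (?f 0) * cube_avg ?V (?f 1)) * (cube_avg ?V (?f 2) * cube_avg ?V (?f 3))"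
    by (simp add: f power4_eq_xxxx)
  also have "\<dots> \<le> cube_avg ?V (\<lambda>A. ?f 0 A * ?f 1 A) * cube_avg ?V (\<lambda>A. ?f 2 A * ?f 3 A)"
    by (intro mult_mono Harris finite_rbox anti mult_nonneg_nonneg cube_avg_nonneg) auto
  also have "\<dots> \<le> cube_avg ?V (\<lambda>A. (?f 0 A * ?f 1 A) * (?f 2 A * ?f 3 A))"
    by (intro Harris finite_rbox anti2)
  also have "\<dots> = cube_prob ?V (\<lambda>A. \<not> box_arm m n A)"
    unfolding cube_prob_def box_arm_def sides by (intro cube_avg_cong) (auto simp: side_arm_def)
  finally show ?thesis by (simp add: cube_prob_not)
qed

definition side :: "nat \<Rightarrow> nat \<Rightarrow> (int \<times> int) set" where
  "side n i = {v \<in> rim 0 n. (if i = 0 then fst v = - int n else if i = 1 then fst v = int n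
     else if i = 2 then snd v = - int n else snd v = int n)}"

lemma rim_eq_sides: "rim 0 n = side n 0 \<union> side n 1 \<union> side n 2 \<union> side n 3"
  by (auto simp: side_def rim_def hdist_def)

text \<open>Negation and exchange of coordinates are symmetries of \<open>hex_adj\<close>, and
  together they carry any side to any other.\<close>

lemma side_arm_prob_eq:
  assumes "i < 4"
  shows "cube_prob (rbox 0 n) (side_arm (side n i) m) = cube_prob (rbox 0 n) (side_arm (side n 0) m)"
proof -
  let ?p = "\<lambda>i. cube_prob (rbox 0 n) (side_arm (side n i) m)"
  let ?r = "uminus :: int \<times> int \<Rightarrow> int \<times> int" and ?s = "prod.swap :: int \<times> int \<Rightarrow> int \<times> int"
  have mr: "v \<in> ?r ` S \<longleftrightarrow> - v \<in> S" and ms: "v \<in> ?s ` S \<longleftrightarrow> prod.swap v \<in> S" for v S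
    by (metis image_iff minus_minus) (metis image_iff swap_swap)
  have r: "?r ` rbox 0 k = rbox 0 k" and s: "?s ` rbox 0 k = rbox 0 k" for k
    by (rule set_eqI, simp add: mr rbox_def hdist_def) (rule set_eqI, auto simp: ms rbox_def hdist_def)
  have adj: "hex_adj (- u) (- v) = hex_adj u v" "hex_adj (prod.swap u) (prod.swap v) = hex_adj u v" for u v
  proof -
    let ?D = "{(1, 0), (-1, 0), (0, 1), (0, -1), (1, -1), (-1, 1)} :: (int \<times> int) set"
    have neg: "(- d, - e) \<in> ?D \<longleftrightarrow> (d, e) \<in> ?D" for d e by (simp add: minus_equation_iff[of d] minus_equation_iff[of e]) linarith
    have swap: "(e, d) \<in> ?D \<longleftrightarrow> (d, e) \<in> ?D" for d e by simp linarith
    show "hex_adj (- u) (- v) = hex_adj u v"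
      unfolding hex_adj_def fst_uminus snd_uminus minus_diff_minus by (rule neg)
    show "hex_adj (prod.swap u) (prod.swap v) = hex_adj u v"
      unfolding hex_adj_def fst_swap snd_swap by (rule swap)
  qed
  have rot: "cube_prob (rbox 0 n) (side_arm (?r ` Z) m) = cube_prob (rbox 0 n) (side_arm Z m)" for Z
    by (rule cube_prob_side_arm_image) (simp_all add: r adj inj_on_def)
  have swp: "cube_prob (rbox 0 n) (side_arm (?s ` Z) m) = cube_prob (rbox 0 n) (side_arm Z m)" for Z
    by (rule cube_prob_side_arm_image) (simp_all add: s adj)
  have "side n 1 = ?r ` side n 0"
    by (rule set_eqI) (auto simp: mr side_def rim_def hdist_def)
  then have 1: "?p 1 = ?p 0" using rot by simp
  have "side n 2 = ?s ` side n 0"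
    by (rule set_eqI) (auto simp: ms side_def rim_def hdist_def max.commute)
  then have 2: "?p 2 = ?p 0" using swp by simp
  have "side n 3 = ?s ` side n 1"
    by (rule set_eqI) (auto simp: ms side_def rim_def hdist_def max.commute)
  then have 3: "?p 3 = ?p 1" using swp by simp
  have "i = 0 \<or> i = 1 \<or> i = 2 \<or> i = 3" using assms by linarith
  then show ?thesis using 1 2 3 by auto
qed

text \<open>Zhang's argument. A large box has open arms to the left and right sides and closed arms to the
  bottom and top sides; by uniqueness, the arms of each colour are connected to each other.\<close>

lemma arms_conflict:
  assumes "side_arm (side n 0) m A" "side_arm (side n 1) m A" "\<not> split_block hex_adj (rim 0 n) (rbox 0 m) A"
    and "side_arm (side n 2) m (rbox 0 n - A)" "side_arm (side n 3) m (rbox 0 n - A)"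
      "\<not> split_block hex_adj (rim 0 n) (rbox 0 m) (rbox 0 n - A)" and A: "A \<subseteq> rbox 0 n"
  shows False
proof -
  have sym: "conn hex_adj X u v \<Longrightarrow> conn hex_adj X v u" for X u v by (rule conn_sym[OF symp_hex_adj])
  have link: "\<exists>v\<in>side n i. \<exists>w\<in>side n j. conn hex_adj X v w"
    if X: "side_arm (side n i) m X" "side_arm (side n j) m X" "\<not> split_block hex_adj (rim 0 n) (rbox 0 m) X" for i j X
  proof -
    obtain u v where uv: "u \<in> rbox 0 m" "v \<in> side n i" "conn hex_adj X u v"
      using X(1) by (auto simp: side_arm_def)
    obtain u' v' where uv': "u' \<in> rbox 0 m" "v' \<in> side n j" "conn hex_adj X u' v'"
      using X(2) by (auto simp: side_arm_def)
    have "u \<in> cluster hex_adj (rim 0 n) X" "u' \<in> cluster hex_adj (rim 0 n) X"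
      using sym[OF uv(3)] sym[OF uv'(3)] uv(2) uv'(2) unfolding cluster_def side_def by blast+
    then have "conn hex_adj X u u'" using X(3) uv(1) uv'(1) by (auto simp: split_block_def)
    then have "conn hex_adj X v v'" using conn_trans[OF conn_trans[OF sym[OF uv(3)]] uv'(3)] by simp
    then show ?thesis using uv(2) uv'(2) by blast
  qed
  obtain l r where l: "l \<in> side n 0" "r \<in> side n 1" "conn hex_adj A l r" using link[OF assms(1-3)] by blast
  obtain b t where b: "b \<in> side n 2" "t \<in> side n 3" "conn hex_adj (rbox 0 n - A) b t"
    using link[OF assms(4-6)] by blast
  have "A \<inter> rbox 0 n = A" using A by auto
  then show False using blocking[of A n l r b t] l b by (simp add: side_def)
qed

lemma arm_prob_tendsto: "arm_prob \<longlonglongrightarrow> 0"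
proof -
  have nonneg: "0 \<le> arm_prob n" for n by (simp add: arm_prob_def cube_prob_nonneg)
  obtain \<theta> where \<theta>: "arm_prob \<longlonglongrightarrow> \<theta>" "\<And>n. \<theta> \<le> arm_prob n"
    using decseq_convergent[OF arm_prob_decseq, of 0] nonneg by auto
  have "\<theta> = 0"
  proof (rule ccontr)
    assume "\<theta> \<noteq> 0"
    moreover have "0 \<le> \<theta>" using \<theta>(1) nonneg by (intro LIMSEQ_le_const) auto
    ultimately have "0 < \<theta>" by simp
    \<comment> \<open>The fourth power is undone by \<open>fourth_root_trick\<close>, leaving 1/10
      for each side.\<close>
    from box_arm_prob[OF this \<theta>(2), of "(1 / 10) ^ 4"]
    obtain m where m: "\<And>n. n \<ge> m \<Longrightarrow> 1 - (1 / 10) ^ 4 \<le> cube_prob (rbox 0 n) (box_arm m n)" by auto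
    have "eventually (\<lambda>n. cube_prob (rbox 0 (2 * n)) (split_block hex_adj (rim 0 (2 * n)) (rbox 0 m)) < 1 / 10) sequentially"
      by (rule order_tendstoD(2)[OF split_block_prob_tendsto]) simp
    then obtain k where k: "cube_prob (rbox 0 (2 * k)) (split_block hex_adj (rim 0 (2 * k)) (rbox 0 m)) < 1 / 10"
      "m \<le> k" by (auto simp: eventually_sequentially) (metis linear)
    define n where "n = 2 * k"
    let ?V = "rbox 0 n" and ?sp = "split_block hex_adj (rim 0 n) (rbox 0 m)"
    define p where "p = cube_prob ?V (side_arm (side n 0) m)"
    have "(1 - p) ^ 4 \<le> 1 - cube_prob ?V (box_arm m n)"
      by (rule fourth_root_trick[OF rim_eq_sides]) (unfold p_def, rule side_arm_prob_eq)
    also have "\<dots> \<le> (1 / 10) ^ 4" using m[of n] k(2) by (simp add: n_def)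
    finally have "1 - p \<le> 1 / 10" using power_le_imp_le_base[of "1 - p" 3 "1 / 10"] by simp
    then have fail: "cube_prob ?V (\<lambda>A. \<not> side_arm (side n i) m A) \<le> 1 / 10" if "i < 4" for i
      using side_arm_prob_eq[OF that, of n m] by (simp add: cube_prob_not p_def)
    \<comment> \<open>Closed sites have the same law as open ones: at density 1/2 the two colours
      are symmetric.\<close>
    have compl: "cube_prob ?V (\<lambda>A. Q (?V - A)) = cube_prob ?V Q" for Q
      unfolding cube_prob_def by (rule cube_avg_compl[OF finite_rbox])
    define Q where "Q i = [\<lambda>A. \<not> side_arm (side n 0) m A, \<lambda>A. \<not> side_arm (side n 1) m A, ?sp,
      \<lambda>A. \<not> side_arm (side n 2) m (?V - A), \<lambda>A. \<not> side_arm (side n 3) m (?V - A), \<lambda>A. ?sp (?V - A)] ! i" for i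
    have six: "{..<6} = {0, 1, 2, 3, 4, 5 :: nat}" by auto
    \<comment> \<open>Six failures of probability at most 1/10 each cannot cover the cube, while
      \<open>arms_conflict\<close> forces them to.\<close>
    have "cube_prob ?V (\<lambda>A. True) \<le> (\<Sum>i\<in>{..<6}. cube_prob ?V (Q i))"
    proof (rule cube_prob_UN)
      fix A assume A: "A \<subseteq> ?V"
      have "Q 0 A \<or> Q 1 A \<or> Q 2 A \<or> Q 3 A \<or> Q 4 A \<or> Q 5 A"
        using arms_conflict[of n m A] A by (auto simp: Q_def)
      then show "\<exists>i\<in>{..<6}. Q i A" unfolding six by auto
    qed simp
    also have "\<dots> \<le> (\<Sum>i\<in>{..<6::nat}. 1 / 10)"
    proof (rule sum_mono)
      fix i :: nat assume "i \<in> {..<6}"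
      then show "cube_prob ?V (Q i) \<le> 1 / 10"
        using k(1) fail compl[of "\<lambda>A. \<not> side_arm (side n 2) m A"] compl[of "\<lambda>A. \<not> side_arm (side n 3) m A"] compl[of ?sp]
        unfolding six by (auto simp: Q_def n_def)
    qed
    finally show False by (simp add: cube_prob_def)
  qed
  then show ?thesis using \<theta>(1) by simp
qed

section \<open>Concatenation of exponential clocks\<close>

abbreviation expo :: "real \<Rightarrow> real measure" where
  "expo l \<equiv> density lborel (exponential_density l)"

abbreviation expo_seq :: "real \<Rightarrow> (nat \<Rightarrow> real) measure" where
  "expo_seq l \<equiv> PiM UNIV (\<lambda>_. expo l)"

lemma measurable_expo [simp]: "measurable M (expo l) = measurable M borel"
  by (rule measurable_cong_sets) simp_all

lemma emeasure_expo:
  assumes "A \<in> sets borel"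
  shows "emeasure (expo l) A = (\<integral>\<^sup>+x. ennreal (exponential_density l x) * indicator A x \<partial>lborel)"
  using assms by (subst emeasure_density) auto

lemma emeasure_expo_tail_shift:
  assumes "0 < l" "0 \<le> s" "A \<in> sets borel"
  shows "emeasure (expo l) (A \<inter> {s<..}) = ennreal (exp (- l * s)) * emeasure (expo l) ((+) s -` A)"
proof -
  have A': "(+) s -` A \<in> sets borel" using measurable_sets[of "(+) s" borel borel A] assms(3) by simp
  have "emeasure (expo l) (A \<inter> {s<..})
      = (\<integral>\<^sup>+x. ennreal (exponential_density l x) * indicator (A \<inter> {s<..}) x \<partial>lborel)"
    using assms(3) by (intro emeasure_expo) auto
  also have "\<dots> = (\<integral>\<^sup>+y. ennreal (exponential_density l (s + 1 * y)) * indicator (A \<inter> {s<..}) (s + 1 * y) \<partial>lborel)"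
    using assms(3) by (subst nn_integral_real_affine[of _ 1 s]) auto
  also have "\<dots> = (\<integral>\<^sup>+y. ennreal (exp (- l * s)) * (ennreal (exponential_density l y) * indicator ((+) s -` A) y) \<partial>lborel)"
  proof (rule nn_integral_cong_AE)
    \<comment> \<open>The density is positive at 0 while the event is cut off strictly above s, so
      the single point y = 0 has to be discarded.\<close>
    have "AE y in lborel. y \<noteq> (0::real)" by (rule AE_lborel_singleton)
    then show "AE y in lborel. ennreal (exponential_density l (s + 1 * y)) * indicator (A \<inter> {s<..}) (s + 1 * y)
        = ennreal (exp (- l * s)) * (ennreal (exponential_density l y) * indicator ((+) s -` A) y)"
    proof eventually_elim
      case (elim y)
      show ?case
      proof (cases "y > 0")
        case True
        then have "exponential_density l (s + 1 * y) = exp (- l * s) * exponential_density l y"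
          using assms by (simp add: exponential_density_def exp_add[symmetric] algebra_simps)
        then show ?thesis using True assms
          by (simp add: ennreal_mult exponential_density_nonneg mult.assoc indicator_def)
      next
        case False
        then show ?thesis using elim by (simp add: exponential_density_def)
      qed
    qed
  qed
  also have "\<dots> = ennreal (exp (- l * s)) * (\<integral>\<^sup>+y. ennreal (exponential_density l y) * indicator ((+) s -` A) y \<partial>lborel)"
    using A' by (intro nn_integral_cmult) auto
  also have "\<dots> = ennreal (exp (- l * s)) * emeasure (expo l) ((+) s -` A)"
    using emeasure_expo[OF A'] by simp
  finally show ?thesis .
qed

lemma emeasure_expo_space: "0 < l \<Longrightarrow> emeasure (expo l) UNIV = 1"
  using prob_space.emeasure_space_1[OF prob_space_exponential_density, of l] by simp

lemma emeasure_expo_greaterThan: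
  assumes "0 < l" "0 \<le> s"
  shows "emeasure (expo l) {s<..} = ennreal (exp (- l * s))"
  using emeasure_expo_tail_shift[OF assms, of UNIV] emeasure_expo_space[OF assms(1)] by simp

text \<open>Replacing an overshoot beyond s by s plus a fresh exponential time leaves the law
  unchanged: the Markov property for one waiting time.\<close>

lemma expo_memoryless:
  assumes "0 < l" "0 \<le> s" "A \<in> sets borel"
  shows "emeasure (expo l) (A \<inter> {..s}) + emeasure (expo l) {s<..} * emeasure (expo l) ((+) s -` A) = emeasure (expo l) A"
proof -
  have "emeasure (expo l) (A \<inter> {..s}) + emeasure (expo l) (A \<inter> {s<..}) = emeasure (expo l) ((A \<inter> {..s}) \<union> (A \<inter> {s<..}))"
    using assms(3) by (intro plus_emeasure) auto
  also have "(A \<inter> {..s}) \<union> (A \<inter> {s<..}) = A" by auto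
  finally show ?thesis
    using emeasure_expo_tail_shift[OF assms] emeasure_expo_greaterThan[OF assms(1,2)] by simp
qed

text \<open>Waiting times of the clock that follows the clock with waiting times \<open>w\<close> up to time \<open>s\<close> and from
  then on the clock with waiting times \<open>w'\<close>, started at time \<open>s\<close>.\<close>

primrec wait_splice :: "nat \<Rightarrow> real \<Rightarrow> (nat \<Rightarrow> real) \<Rightarrow> (nat \<Rightarrow> real) \<Rightarrow> real" where
  "wait_splice 0 s w w' = (if w 0 \<le> s then w 0 else s + w' 0)"
| "wait_splice (Suc i) s w w' = (if w 0 \<le> s then wait_splice i (s - w 0) (\<lambda>j. w (Suc j)) w' else w' (Suc i))"

text \<open>The recursion of \<open>wait_splice\<close> changes source at the first ring after s,
  which has index n; from there on the ring times are those of w' delayed by s.\<close>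

lemma splice_sums:
  assumes "\<And>k. k < n \<Longrightarrow> (\<Sum>j\<le>k. w j) \<le> s" "s < (\<Sum>j\<le>n. w j)"
  shows "(\<forall>k<n. (\<Sum>j\<le>k. wait_splice j s w w') = (\<Sum>j\<le>k. w j))
    \<and> (\<forall>k. (\<Sum>j\<le>n + k. wait_splice j s w w') = s + (\<Sum>j\<le>k. w' j))"
  using assms
proof (induction n arbitrary: s w)
  case 0
  have "(\<Sum>j\<le>k. wait_splice j s w w') = s + (\<Sum>j\<le>k. w' j)" for k
    using 0 by (induction k) auto
  then show ?case by simp
next
  case (Suc n)
  let ?w = "\<lambda>j. w (Suc j)"
  have w0: "w 0 \<le> s" using Suc.prems(1)[of 0] by simp
  have shift: "(\<Sum>j\<le>Suc k. v j) = v 0 + (\<Sum>j\<le>k. v (Suc j))" for v :: "nat \<Rightarrow> real" and k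
    by (rule sum.atMost_Suc_shift)
  have IH: "(\<forall>k<n. (\<Sum>j\<le>k. wait_splice j (s - w 0) ?w w') = (\<Sum>j\<le>k. ?w j))
    \<and> (\<forall>k. (\<Sum>j\<le>n + k. wait_splice j (s - w 0) ?w w') = (s - w 0) + (\<Sum>j\<le>k. w' j))"
  proof (rule Suc.IH)
    fix k assume "k < n"
    then show "(\<Sum>j\<le>k. ?w j) \<le> s - w 0" using Suc.prems(1)[of "Suc k"] unfolding shift by simp
  next
    show "s - w 0 < (\<Sum>j\<le>n. ?w j)" using Suc.prems(2) unfolding shift by simp
  qed
  have step: "(\<Sum>j\<le>Suc k. wait_splice j s w w') = w 0 + (\<Sum>j\<le>k. wait_splice j (s - w 0) ?w w')" for k
    unfolding shift using w0 by simp
  show ?case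
  proof (intro conjI allI impI)
    fix k assume "k < Suc n"
    then show "(\<Sum>j\<le>k. wait_splice j s w w') = (\<Sum>j\<le>k. w j)"
      using IH w0 by (cases k) (simp_all only: step shift, auto)
  next
    fix k
    show "(\<Sum>j\<le>Suc n + k. wait_splice j s w w') = s + (\<Sum>j\<le>k. w' j)"
      using IH step[of "n + k"] by simp
  qed
qed

lemma measurable_splice [measurable (raw)]:
  assumes "f \<in> borel_measurable M" "\<And>j. (\<lambda>x. g x j) \<in> borel_measurable M" "\<And>j. (\<lambda>x. h x j) \<in> borel_measurable M"
  shows "(\<lambda>x. wait_splice i (f x) (g x) (h x)) \<in> borel_measurable M"
  using assms(1,2)
proof (induction i arbitrary: f g)
  case 0
  note [measurable] = 0 assms(3)
  show ?case by simp
next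
  case (Suc i)
  note [measurable] = Suc.prems assms(3)
  have [measurable]: "(\<lambda>x. wait_splice i (f x - g x 0) (\<lambda>j. g x (Suc j)) (h x)) \<in> borel_measurable M"
    by (rule Suc.IH) measurable
  show ?case by simp
qed

lemma prod_indicator_eq: "(\<Prod>i\<in>K. indicator (A i) (x i)) = (indicator {x. \<forall>i\<in>K. x i \<in> A i} x :: ennreal)"
  if "finite K"
  using that by (induction K rule: finite_induct) (auto simp: indicator_def)

lemma product_prob_space_expo: "0 < l \<Longrightarrow> product_prob_space (\<lambda>_. expo l)"
  by (simp add: product_prob_space_def product_prob_space_axioms_def product_sigma_finite_def
      prob_space_exponential_density prob_space_imp_sigma_finite)

lemma nn_integral_expo_seq_prod:
  assumes "0 < l" "finite K" "\<And>i. A i \<in> sets borel"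
  shows "(\<integral>\<^sup>+w. (\<Prod>i\<in>K. indicator (A i) (w i)) \<partial>expo_seq l) = (\<Prod>i\<in>K. emeasure (expo l) (A i))"
proof -
  interpret product_prob_space "\<lambda>_. expo l" "UNIV :: nat set" using assms(1) by (rule product_prob_space_expo)
  have meas: "{w \<in> space (expo_seq l). \<forall>i\<in>K. w i \<in> A i} \<in> sets (expo_seq l)"
    using assms by measurable
  have "(\<integral>\<^sup>+w. (\<Prod>i\<in>K. indicator (A i) (w i)) \<partial>expo_seq l)
      = (\<integral>\<^sup>+w. indicator {w \<in> space (expo_seq l). \<forall>i\<in>K. w i \<in> A i} w \<partial>expo_seq l)"
    by (intro nn_integral_cong) (simp add: prod_indicator_eq assms(2) indicator_def)
  also have "\<dots> = emeasure (expo_seq l) {w \<in> space (expo_seq l). \<forall>i\<in>K. w i \<in> A i}"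
    by (rule nn_integral_indicator[OF meas])
  also have "\<dots> = (\<Prod>i\<in>K. emeasure (expo l) (A i))"
    using assms by (intro emeasure_PiM_Collect) auto
  finally show ?thesis .
qed

lemma nn_integral_expo_seq_iter:
  assumes "0 < l" "f \<in> borel_measurable (expo_seq l)"
  shows "(\<integral>\<^sup>+w. f w \<partial>expo_seq l) = (\<integral>\<^sup>+x. \<integral>\<^sup>+v. f (case_nat x v) \<partial>expo_seq l \<partial>expo l)"
proof -
  interpret S': prob_space "expo_seq l" using assms(1) by (intro prob_space_PiM prob_space_exponential_density)
  interpret S: sequence_space "expo l"
    unfolding sequence_space_def using assms(1) by (rule product_prob_space_expo)
  note [measurable] = assms(2)
  have "(\<integral>\<^sup>+w. f w \<partial>expo_seq l) = (\<integral>\<^sup>+w. f w \<partial>distr (expo l \<Otimes>\<^sub>M expo_seq l) (expo_seq l) (\<lambda>(s, \<omega>). case_nat s \<omega>))"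
    by (simp only: S.PiM_iter)
  also have "\<dots> = (\<integral>\<^sup>+p. f (case_nat (fst p) (snd p)) \<partial>(expo l \<Otimes>\<^sub>M expo_seq l))"
    by (subst nn_integral_distr) (auto simp: case_prod_unfold)
  also have "\<dots> = (\<integral>\<^sup>+x. \<integral>\<^sup>+v. f (case_nat x v) \<partial>expo_seq l \<partial>expo l)"
    by (subst S'.nn_integral_fst[symmetric]) auto
  finally show ?thesis .
qed

lemma measurable_expo_seq_component [measurable]: "(\<lambda>w. w i) \<in> borel_measurable (expo_seq l)"
  using measurable_component_singleton[of i UNIV "\<lambda>_. expo l"] by simp

text \<open>Induction on n, conditioning on the first waiting time x. If x <= s, the rest is a
  splice at s - x; otherwise everything comes from w', the first entry delayed by s.
  \<open>expo_memoryless\<close> adds up the two cases.\<close>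

lemma nn_integral_splice:
  assumes "0 < l" "0 \<le> s" "\<And>i. A i \<in> sets borel"
  shows "(\<integral>\<^sup>+w. \<integral>\<^sup>+w'. (\<Prod>i<n. indicator (A i) (wait_splice i s w w')) \<partial>expo_seq l \<partial>expo_seq l)
    = (\<Prod>i<n. emeasure (expo l) (A i))"
  using assms(2,3)
proof (induction n arbitrary: s A)
  case 0
  interpret S': prob_space "expo_seq l" using assms(1) by (intro prob_space_PiM prob_space_exponential_density)
  show ?case by (simp add: S'.emeasure_space_1)
next
  case (Suc n)
  interpret S': prob_space "expo_seq l" using assms(1) by (intro prob_space_PiM prob_space_exponential_density)
  note [measurable] = Suc.prems(2)
  let ?S = "expo_seq l" and ?c = "\<Prod>i<n. emeasure (expo l) (A (Suc i))"
  let ?B = "\<lambda>i. if i = 0 then (+) s -` A 0 else A i"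
  have B: "?B i \<in> sets borel" for i
    using measurable_sets[of "(+) s" borel borel "A 0"] Suc.prems(2) by auto
  have inner: "(\<integral>\<^sup>+v. \<integral>\<^sup>+w'. (\<Prod>i<Suc n. indicator (A i) (wait_splice i s (case_nat x v) w')) \<partial>?S \<partial>?S)
      = ?c * indicator (A 0 \<inter> {..s}) x + ?c * emeasure (expo l) ((+) s -` A 0) * indicator {s<..} x" for x
  proof (cases "x \<le> s")
    case True
    have "(\<integral>\<^sup>+v. \<integral>\<^sup>+w'. (\<Prod>i<Suc n. indicator (A i) (wait_splice i s (case_nat x v) w')) \<partial>?S \<partial>?S)
       = (\<integral>\<^sup>+v. \<integral>\<^sup>+w'. indicator (A 0) x * (\<Prod>i<n. indicator (A (Suc i)) (wait_splice i (s - x) v w')) \<partial>?S \<partial>?S)"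
      using True by (simp add: prod.lessThan_Suc_shift del: prod.lessThan_Suc)
    also have "\<dots> = indicator (A 0) x * (\<integral>\<^sup>+v. \<integral>\<^sup>+w'. (\<Prod>i<n. indicator (A (Suc i)) (wait_splice i (s - x) v w')) \<partial>?S \<partial>?S)"
      by (simp add: nn_integral_cmult)
    also have "\<dots> = indicator (A 0) x * ?c"
      using Suc.IH[of "s - x" "\<lambda>i. A (Suc i)"] True Suc.prems(2) by simp
    finally show ?thesis using True by (simp add: indicator_def)
  next
    case False
    have "(\<integral>\<^sup>+v. \<integral>\<^sup>+w'. (\<Prod>i<Suc n. indicator (A i) (wait_splice i s (case_nat x v) w')) \<partial>?S \<partial>?S)
       = (\<integral>\<^sup>+v. \<integral>\<^sup>+w'. (\<Prod>i<Suc n. indicator (?B i) (w' i)) \<partial>?S \<partial>?S)"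
      using False by (simp add: prod.lessThan_Suc_shift indicator_def del: prod.lessThan_Suc)
    also have "\<dots> = (\<integral>\<^sup>+v. (\<Prod>i<Suc n. emeasure (expo l) (?B i)) \<partial>?S)"
      by (subst nn_integral_expo_seq_prod[OF assms(1) _ B]) auto
    also have "\<dots> = emeasure (expo l) ((+) s -` A 0) * ?c"
      by (simp add: S'.emeasure_space_1 prod.lessThan_Suc_shift del: prod.lessThan_Suc)
    finally show ?thesis using False by (simp add: indicator_def mult.commute)
  qed
  have "(\<integral>\<^sup>+w. \<integral>\<^sup>+w'. (\<Prod>i<Suc n. indicator (A i) (wait_splice i s w w')) \<partial>?S \<partial>?S)
     = (\<integral>\<^sup>+x. \<integral>\<^sup>+v. \<integral>\<^sup>+w'. (\<Prod>i<Suc n. indicator (A i) (wait_splice i s (case_nat x v) w')) \<partial>?S \<partial>?S \<partial>expo l)"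
    by (rule nn_integral_expo_seq_iter[OF assms(1)]) measurable
  also have "\<dots> = (\<integral>\<^sup>+x. ?c * indicator (A 0 \<inter> {..s}) x + ?c * emeasure (expo l) ((+) s -` A 0) * indicator {s<..} x \<partial>expo l)"
    unfolding inner ..
  also have "\<dots> = ?c * emeasure (expo l) (A 0 \<inter> {..s}) + ?c * emeasure (expo l) ((+) s -` A 0) * emeasure (expo l) {s<..}"
    by (subst nn_integral_add) (auto simp: nn_integral_cmult)
  also have "\<dots> = ?c * (emeasure (expo l) (A 0 \<inter> {..s}) + emeasure (expo l) {s<..} * emeasure (expo l) ((+) s -` A 0))"
    by (simp add: distrib_left mult_ac)
  also have "\<dots> = ?c * emeasure (expo l) (A 0)"
    by (subst expo_memoryless) (use assms(1) Suc.prems in auto)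
  finally show ?case by (simp add: prod.lessThan_Suc_shift mult.commute del: prod.lessThan_Suc)
qed

section \<open>Families of independent clocks\<close>

abbreviation clocks :: "'e set \<Rightarrow> real \<Rightarrow> ('e \<times> nat \<Rightarrow> real) measure" where
  "clocks E l \<equiv> PiM (E \<times> UNIV) (\<lambda>_. expo l)"

lemma measurable_clocks_component [measurable (raw)]:
  "e \<in> E \<Longrightarrow> (\<lambda>w. w (e, i)) \<in> borel_measurable (clocks E l)"
  using measurable_component_singleton[of "(e, i)" "E \<times> UNIV" "\<lambda>_. expo l"] by simp

lemma emeasure_clocks_rect:
  assumes "finite E" "0 < l" "\<And>r. A r \<in> sets borel"
  shows "emeasure (clocks E l) {x \<in> space (clocks E l). \<forall>e\<in>E. \<forall>i<n. x (e, i) \<in> A (e, i)}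
    = (\<Prod>e\<in>E. \<Prod>i<n. emeasure (expo l) (A (e, i)))"
proof -
  interpret product_prob_space "\<lambda>_. expo l" "E \<times> (UNIV :: nat set)" using assms(2) by (rule product_prob_space_expo)
  have "emeasure (clocks E l) {x \<in> space (clocks E l). \<forall>r\<in>E \<times> {..<n}. x r \<in> A r}
     = (\<Prod>r\<in>E \<times> {..<n}. emeasure (expo l) (A r))"
    using assms by (intro emeasure_PiM_Collect) auto
  moreover have "{x \<in> space (clocks E l). \<forall>r\<in>E \<times> {..<n}. x r \<in> A r}
      = {x \<in> space (clocks E l). \<forall>e\<in>E. \<forall>i<n. x (e, i) \<in> A (e, i)}" by auto
  ultimately show ?thesis by (simp add: prod.cartesian_product case_prod_unfold)
qed

text \<open>Any finite set of coordinates has indices below some n; the missing coordinates are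
  given the set \<open>UNIV\<close>, so rectangles of this regular shape determine the law.\<close>

lemma clocks_eqI:
  assumes "finite E" "0 < l" and sets: "sets P = sets (clocks E l)" and fin: "finite_measure P"
    and rect: "\<And>n A. (\<And>r. A r \<in> sets borel) \<Longrightarrow>
      emeasure P {x \<in> space (clocks E l). \<forall>e\<in>E. \<forall>i<n. x (e, i) \<in> A (e, i)}
      = (\<Prod>e\<in>E. \<Prod>i<n. emeasure (expo l) (A (e, i)))"
  shows "P = clocks E l"
proof (rule measure_eqI_PiM_infinite[OF sets refl _ fin])
  fix A :: "'a \<times> nat \<Rightarrow> real set" and J
  assume J: "finite J" "J \<subseteq> E \<times> UNIV" and A: "\<And>i. i \<in> J \<Longrightarrow> A i \<in> sets (expo l)"
  define A' where "A' r = (if r \<in> J then A r else UNIV)" for r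
  have A': "A' r \<in> sets borel" for r using A by (auto simp: A'_def)
  obtain n where n: "snd ` J \<subseteq> {..<n}" using J(1) finite_nat_bounded by blast
  have "prod_emb (E \<times> UNIV) (\<lambda>_. expo l) J (Pi\<^sub>E J A)
      = {x \<in> space (clocks E l). \<forall>e\<in>E. \<forall>i<n. x (e, i) \<in> A' (e, i)}"
  proof -
    have "(\<forall>r\<in>J. x r \<in> A r) \<longleftrightarrow> (\<forall>e\<in>E. \<forall>i<n. x (e, i) \<in> A' (e, i))" for x
      using n J(2) by (force simp: A'_def)
    then show ?thesis
      by (intro set_eqI) (simp add: prod_emb_iff restrict_PiE_iff space_PiM PiE_iff conj_commute)
  qed
  then show "emeasure P (prod_emb (E \<times> UNIV) (\<lambda>_. expo l) J (Pi\<^sub>E J A))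
      = emeasure (clocks E l) (prod_emb (E \<times> UNIV) (\<lambda>_. expo l) J (Pi\<^sub>E J A))"
    using rect[of A' n] emeasure_clocks_rect[OF assms(1,2), of A' n] A' by simp
qed

lemma measurable_uncurry_clocks:
  "(\<lambda>x. \<lambda>(e, i)\<in>E \<times> UNIV. x e i) \<in> measurable (PiM E (\<lambda>_. expo_seq l)) (clocks E l)"
proof (rule measurable_PiM_single')
  fix r assume r: "r \<in> E \<times> (UNIV :: nat set)"
  then have "(\<lambda>x. x (fst r)) \<in> measurable (PiM E (\<lambda>_. expo_seq l)) (expo_seq l)"
    using measurable_component_singleton[of "fst r" E "\<lambda>_. expo_seq l"] by auto
  from measurable_compose[OF this measurable_expo_seq_component[of "snd r"]]
  show "(\<lambda>x. (\<lambda>(e, i)\<in>E \<times> UNIV. x e i) r) \<in> measurable (PiM E (\<lambda>_. expo_seq l)) (expo l)"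
    using r by (simp add: case_prod_unfold)
qed (auto simp: PiE_iff split: if_splits)

text \<open>Regards the clocks as one independent sequence per pair, the form in which the
  computation for a single clock can be applied to each pair.\<close>

lemma distr_uncurry_clocks:
  assumes "finite E" "0 < l"
  shows "distr (PiM E (\<lambda>_. expo_seq l)) (clocks E l) (\<lambda>x. \<lambda>(e, i)\<in>E \<times> UNIV. x e i) = clocks E l"
    (is "distr ?P ?C ?u = _")
proof (rule clocks_eqI[OF assms])
  interpret S: prob_space "expo_seq l" using assms(2) by (intro prob_space_PiM prob_space_exponential_density)
  interpret P: prob_space ?P by (rule prob_space_PiM) unfold_locales
  interpret F: product_sigma_finite "\<lambda>_. expo_seq l" by unfold_locales
  interpret Q: product_prob_space "\<lambda>_. expo l" "UNIV :: nat set" using assms(2) by (rule product_prob_space_expo)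
  note u = measurable_uncurry_clocks[of E l]
  show "finite_measure (distr ?P ?C ?u)"
    using P.prob_space_distr[OF u] by (rule prob_space.finite_measure)
  fix n :: nat and A :: "'a \<times> nat \<Rightarrow> real set" assume A: "\<And>r. A r \<in> sets borel"
  have R: "{x \<in> space ?C. \<forall>e\<in>E. \<forall>i<n. x (e, i) \<in> A (e, i)} \<in> sets ?C"
    using A assms(1) by measurable
  let ?G = "\<lambda>e. {y \<in> space (expo_seq l). \<forall>i\<in>{..<n}. y i \<in> A (e, i)}"
  have G: "?G e \<in> sets (expo_seq l)" for e using A by measurable
  have "emeasure (distr ?P ?C ?u) {x \<in> space ?C. \<forall>e\<in>E. \<forall>i<n. x (e, i) \<in> A (e, i)}
      = emeasure ?P (?u -` {x \<in> space ?C. \<forall>e\<in>E. \<forall>i<n. x (e, i) \<in> A (e, i)} \<inter> space ?P)"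
    by (rule emeasure_distr[OF u R])
  also have "?u -` {x \<in> space ?C. \<forall>e\<in>E. \<forall>i<n. x (e, i) \<in> A (e, i)} \<inter> space ?P = PiE E ?G"
    using measurable_space[OF u] by (auto simp: space_PiM PiE_iff)
  also have "emeasure ?P (PiE E ?G) = (\<Prod>e\<in>E. emeasure (expo_seq l) (?G e))"
    by (rule F.emeasure_PiM[OF assms(1) G])
  also have "\<dots> = (\<Prod>e\<in>E. \<Prod>i<n. emeasure (expo l) (A (e, i)))"
    using A by (intro prod.cong refl Q.emeasure_PiM_Collect) auto
  finally show "emeasure (distr ?P ?C ?u) {x \<in> space ?C. \<forall>e\<in>E. \<forall>i<n. x (e, i) \<in> A (e, i)}
      = (\<Prod>e\<in>E. \<Prod>i<n. emeasure (expo l) (A (e, i)))" .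
qed simp

lemma measurable_clocks_pair:
  assumes "e \<in> E"
  shows "(\<lambda>x. fst x (e, j)) \<in> borel_measurable (clocks E l \<Otimes>\<^sub>M N)"
    and "(\<lambda>x. snd x (e, j)) \<in> borel_measurable (N \<Otimes>\<^sub>M clocks E l)"
  by (rule measurable_compose[OF measurable_fst measurable_clocks_component[OF assms]])
     (rule measurable_compose[OF measurable_snd measurable_clocks_component[OF assms]])

definition splice_clocks ::
    "'e set \<Rightarrow> real \<Rightarrow> ('e \<times> nat \<Rightarrow> real) \<Rightarrow> ('e \<times> nat \<Rightarrow> real) \<Rightarrow> 'e \<times> nat \<Rightarrow> real" where
  "splice_clocks E s w w' = (\<lambda>(e, i)\<in>E \<times> UNIV. wait_splice i s (\<lambda>j. w (e, j)) (\<lambda>j. w' (e, j)))"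

lemma measurable_splice_clocks:
  "(\<lambda>(w, w'). splice_clocks E s w w') \<in> measurable (clocks E l \<Otimes>\<^sub>M clocks E l) (clocks E l)"
proof (rule measurable_PiM_single')
  fix r assume "r \<in> E \<times> (UNIV :: nat set)"
  then obtain e i where r: "r = (e, i)" "e \<in> E" by auto
  have "(\<lambda>x. wait_splice i s (\<lambda>j. fst x (e, j)) (\<lambda>j. snd x (e, j))) \<in> borel_measurable (clocks E l \<Otimes>\<^sub>M clocks E l)"
    by (intro measurable_splice measurable_clocks_pair r(2)) simp
  then show "(\<lambda>x. (case x of (w, w') \<Rightarrow> splice_clocks E s w w') r) \<in> measurable (clocks E l \<Otimes>\<^sub>M clocks E l) (expo l)"
    using r by (simp add: splice_clocks_def case_prod_unfold)
qed (auto simp: splice_clocks_def PiE_iff split: prod.splits if_splits)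

text \<open>The Markov property at time s for the whole family: by independence of the pairs the
  probability of a rectangle factors, and each factor is given by
  \<open>nn_integral_splice\<close>.\<close>

lemma distr_splice_clocks:
  assumes "finite E" "0 < l" "0 \<le> s"
  shows "distr (clocks E l \<Otimes>\<^sub>M clocks E l) (clocks E l) (\<lambda>(w, w'). splice_clocks E s w w') = clocks E l"
    (is "distr (?C \<Otimes>\<^sub>M ?C) _ ?f = _")
proof (rule clocks_eqI[OF assms(1,2)])
  let ?P = "PiM E (\<lambda>_. expo_seq l)"
  let ?u = "\<lambda>x. \<lambda>(e, i)\<in>E \<times> UNIV. x e i"
  interpret S: prob_space "expo_seq l" using assms(2) by (intro prob_space_PiM prob_space_exponential_density)
  interpret C: prob_space ?C using assms(2) by (intro prob_space_PiM prob_space_exponential_density)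
  interpret CC: pair_prob_space ?C ?C ..
  interpret P: prob_space ?P by (rule prob_space_PiM) unfold_locales
  interpret F: product_sigma_finite "\<lambda>_. expo_seq l" by unfold_locales
  note f = measurable_splice_clocks[of E s l]
  note u = measurable_uncurry_clocks[of E l]
  have transfer: "(\<integral>\<^sup>+w. h w \<partial>?C) = (\<integral>\<^sup>+x. h (?u x) \<partial>?P)" if "h \<in> borel_measurable ?C" for h
    using nn_integral_distr[OF u, of h] that distr_uncurry_clocks[OF assms(1,2)] by simp
  show "finite_measure (distr (?C \<Otimes>\<^sub>M ?C) ?C ?f)"
    using CC.prob_space_distr[OF f] by (rule prob_space.finite_measure)
  fix n :: nat and A :: "'a \<times> nat \<Rightarrow> real set" assume A: "\<And>r. A r \<in> sets borel"
  note [measurable] = A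
  let ?R = "{x \<in> space ?C. \<forall>e\<in>E. \<forall>i<n. x (e, i) \<in> A (e, i)}"
  have R: "?R \<in> sets ?C" using assms(1) by measurable
  let ?g = "\<lambda>e y y'. \<Prod>i<n. indicator (A (e, i)) (wait_splice i s y y') :: ennreal"
  have ind: "indicator ?R (splice_clocks E s w w') = (\<Prod>e\<in>E. ?g e (\<lambda>j. w (e, j)) (\<lambda>j. w' (e, j)))"
    if "w \<in> space ?C" "w' \<in> space ?C" for w w'
  proof -
    have mem: "splice_clocks E s w w' \<in> space ?C"
      using measurable_space[OF f, of "(w, w')"] that by (simp add: space_pair_measure)
    have "(\<Prod>e\<in>E. ?g e (\<lambda>j. w (e, j)) (\<lambda>j. w' (e, j)))
        = (\<Prod>r\<in>E \<times> {..<n}. indicator (A r) (splice_clocks E s w w' r))"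
      unfolding prod.cartesian_product by (rule prod.cong) (auto simp: splice_clocks_def)
    also have "\<dots> = indicator {x. \<forall>r\<in>E \<times> {..<n}. x r \<in> A r} (splice_clocks E s w w')"
      using assms(1) by (intro prod_indicator_eq) simp
    also have "\<dots> = indicator ?R (splice_clocks E s w w')"
      using mem by (auto simp: indicator_def)
    finally show ?thesis by simp
  qed
  have gm: "(\<lambda>x. ?g e (\<lambda>j. fst x (e, j)) (\<lambda>j. snd x (e, j))) \<in> borel_measurable (?C \<Otimes>\<^sub>M ?C)" if "e \<in> E" for e
  proof -
    note [measurable] = measurable_clocks_pair[OF that]
    show ?thesis by measurable
  qed
  have Gm: "(\<lambda>x. \<Prod>e\<in>E. ?g e (\<lambda>j. fst x (e, j)) (\<lambda>j. snd x (e, j))) \<in> borel_measurable (?C \<Otimes>\<^sub>M ?C)"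
    by (rule borel_measurable_prod_ennreal) (rule gm)
  have Gm2: "(\<lambda>w'. \<Prod>e\<in>E. ?g e (\<lambda>j. w (e, j)) (\<lambda>j. w' (e, j))) \<in> borel_measurable ?C" if "w \<in> space ?C" for w
    using measurable_compose[OF measurable_Pair1'[OF that] Gm] by simp
  have "emeasure (distr (?C \<Otimes>\<^sub>M ?C) ?C ?f) ?R = (\<integral>\<^sup>+x. indicator ?R x \<partial>distr (?C \<Otimes>\<^sub>M ?C) ?C ?f)"
    using R by simp
  also have "\<dots> = (\<integral>\<^sup>+p. indicator ?R (splice_clocks E s (fst p) (snd p)) \<partial>(?C \<Otimes>\<^sub>M ?C))"
    using f R by (subst nn_integral_distr) (auto simp: case_prod_unfold)
  also have "\<dots> = (\<integral>\<^sup>+p. (\<Prod>e\<in>E. ?g e (\<lambda>j. fst p (e, j)) (\<lambda>j. snd p (e, j))) \<partial>(?C \<Otimes>\<^sub>M ?C))"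
    by (intro nn_integral_cong ind) (auto simp: space_pair_measure)
  also have "\<dots> = (\<integral>\<^sup>+w. \<integral>\<^sup>+w'. (\<Prod>e\<in>E. ?g e (\<lambda>j. w (e, j)) (\<lambda>j. w' (e, j))) \<partial>?C \<partial>?C)"
    using Gm by (subst C.nn_integral_fst[symmetric]) auto
  also have "\<dots> = (\<integral>\<^sup>+w. \<integral>\<^sup>+x'. (\<Prod>e\<in>E. ?g e (\<lambda>j. w (e, j)) (x' e)) \<partial>?P \<partial>?C)"
  proof (intro nn_integral_cong)
    fix w assume "w \<in> space ?C"
    then show "(\<integral>\<^sup>+w'. (\<Prod>e\<in>E. ?g e (\<lambda>j. w (e, j)) (\<lambda>j. w' (e, j))) \<partial>?C)
        = (\<integral>\<^sup>+x'. (\<Prod>e\<in>E. ?g e (\<lambda>j. w (e, j)) (x' e)) \<partial>?P)"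
      by (subst transfer[OF Gm2]) simp_all
  qed
  also have "\<dots> = (\<integral>\<^sup>+w. (\<Prod>e\<in>E. \<integral>\<^sup>+y'. ?g e (\<lambda>j. w (e, j)) y' \<partial>expo_seq l) \<partial>?C)"
    by (intro nn_integral_cong F.product_nn_integral_prod assms(1)) measurable
  also have "\<dots> = (\<integral>\<^sup>+x. (\<Prod>e\<in>E. \<integral>\<^sup>+y'. ?g e (x e) y' \<partial>expo_seq l) \<partial>?P)"
  proof (subst transfer)
    show "(\<lambda>w. \<Prod>e\<in>E. \<integral>\<^sup>+y'. ?g e (\<lambda>j. w (e, j)) y' \<partial>expo_seq l) \<in> borel_measurable ?C"
      by (rule borel_measurable_prod_ennreal) measurable
  qed simp
  also have "\<dots> = (\<Prod>e\<in>E. \<integral>\<^sup>+y. \<integral>\<^sup>+y'. ?g e y y' \<partial>expo_seq l \<partial>expo_seq l)"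
    by (intro F.product_nn_integral_prod assms(1)) measurable
  also have "\<dots> = (\<Prod>e\<in>E. \<Prod>i<n. emeasure (expo l) (A (e, i)))"
    by (intro prod.cong refl nn_integral_splice assms A)
  finally show "emeasure (distr (?C \<Otimes>\<^sub>M ?C) ?C ?f) ?R = (\<Prod>e\<in>E. \<Prod>i<n. emeasure (expo l) (A (e, i)))" .
qed simp

section \<open>The law of the exclusion process\<close>

text \<open>On these clocks the list in \<open>exclusion_perm\<close> enumerates finitely many rings
  without ties. Unboundedness is stated for natural T, which keeps it a countable condition.\<close>

definition regular_clocks :: "'v set \<Rightarrow> ('v set \<times> nat \<Rightarrow> real) \<Rightarrow> bool" where
  "regular_clocks V w \<longleftrightarrow> (\<forall>r\<in>unordered_pairs V \<times> UNIV. 0 < w r)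
    \<and> (\<forall>e\<in>unordered_pairs V. \<forall>T::nat. \<exists>k. real T < ring_time w (e, k))
    \<and> (\<forall>e\<in>unordered_pairs V. \<forall>e'\<in>unordered_pairs V. e \<noteq> e' \<longrightarrow>
        (\<forall>k k'. ring_time w (e, k) \<noteq> ring_time w (e', k')))"

lemma clock_space_eq: "clock_space V = clocks (unordered_pairs V) (1 / real (card V))"
  by (simp add: clock_space_def)

lemma finite_unordered_pairs: "finite V \<Longrightarrow> finite (unordered_pairs V)"
  by (rule finite_subset[of _ "Pow V"]) (auto simp: unordered_pairs_def)

lemma prob_space_clocks: "0 < l \<Longrightarrow> prob_space (clocks E l)"
  by (intro prob_space_PiM prob_space_exponential_density)

lemma measurable_ring_time:
  "e \<in> E \<Longrightarrow> (\<lambda>w. ring_time w (e, k)) \<in> borel_measurable (clocks E l)"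
  unfolding ring_time_def prod.case by (intro borel_measurable_sum measurable_clocks_component)

lemma ring_time_Suc: "ring_time w (e, Suc k) = ring_time w (e, k) + w (e, Suc k)"
  by (simp add: ring_time_def)

lemma AE_expo: "0 < l \<Longrightarrow> AE x in expo l. 0 < x \<and> x \<noteq> c"
proof -
  have "AE x in lborel. 0 < exponential_density l x \<longrightarrow> 0 < x \<and> x \<noteq> c"
    using AE_lborel_singleton[of "0 :: real"] AE_lborel_singleton[of c]
    by eventually_elim (auto simp: exponential_density_def split: if_splits)
  then show ?thesis by (subst AE_density) auto
qed

lemma AE_clocks_pos:
  assumes "0 < l" "countable E"
  shows "AE w in clocks E l. \<forall>r\<in>E \<times> UNIV. 0 < w r"
proof -
  have "AE w in clocks E l. 0 < w r" if "r \<in> E \<times> UNIV" for r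
    using that assms(1) AE_expo[OF assms(1), of 0]
    by (intro AE_PiM_component prob_space_exponential_density) auto
  then show ?thesis using assms(2) by (subst AE_ball_countable) auto
qed

lemma ring_time_ge:
  assumes "\<forall>r\<in>E \<times> UNIV. 0 < w r" "e \<in> E" "i \<le> k"
  shows "w (e, i) \<le> ring_time w (e, k)"
proof -
  have "w (e, i) \<le> (\<Sum>i\<le>k. w (e, i))"
    using assms by (intro member_le_sum) (auto intro: less_imp_le)
  then show ?thesis by (simp add: ring_time_def)
qed

text \<open>Already a single waiting time beyond T occurs almost surely: the first n all stay below
  T with a probability that decays geometrically in n.\<close>

lemma AE_clocks_unbounded:
  assumes "0 < l" "countable E" "e \<in> E"
  shows "AE w in clocks E l. \<exists>k. real T < ring_time w (e, k)"
proof -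
  interpret P: product_prob_space "\<lambda>_. expo l" "E \<times> (UNIV :: nat set)"
    using assms(1) by (rule product_prob_space_expo)
  let ?C = "clocks E l"
  have c: "(\<lambda>w. w (e, i)) \<in> borel_measurable ?C" for i using assms(3) by (rule measurable_clocks_component)
  note [measurable] = c
  let ?q = "emeasure (expo l) {..real T}"
  have q: "?q = ennreal (1 - exp (- l * real T))"
  proof -
    have "{..real T} = UNIV - {real T<..}" by auto
    then have "?q = emeasure (expo l) UNIV - emeasure (expo l) {real T<..}"
      using emeasure_expo_greaterThan[OF assms(1), of "real T"] by (simp add: emeasure_Diff)
    also have "\<dots> = ennreal 1 - ennreal (exp (- l * real T))"
      using emeasure_expo_greaterThan[OF assms(1), of "real T"] emeasure_expo_space[OF assms(1)] by simp
    also have "\<dots> = ennreal (1 - exp (- l * real T))" by (rule ennreal_minus) simp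
    finally show ?thesis .
  qed
  let ?B = "{w \<in> space ?C. \<forall>i. w (e, i) \<le> real T}"
  have "emeasure ?C ?B \<le> ennreal ((1 - exp (- l * real T)) ^ n)" for n
  proof -
    have "emeasure ?C ?B \<le> emeasure ?C {w \<in> space ?C. \<forall>r\<in>{e} \<times> {..<n}. w r \<in> {..real T}}"
      by (intro emeasure_mono) auto
    also have "\<dots> = (\<Prod>r\<in>{e} \<times> {..<n}. ?q)"
      using assms(3) by (intro P.emeasure_PiM_Collect) auto
    also have "\<dots> = ennreal ((1 - exp (- l * real T)) ^ n)"
      using assms(1) by (simp add: q card_cartesian_product ennreal_power)
    finally show ?thesis .
  qed
  moreover have "(\<lambda>n. ennreal ((1 - exp (- l * real T)) ^ n)) \<longlonglongrightarrow> ennreal 0"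
    using assms(1) by (intro tendsto_ennrealI LIMSEQ_power_zero) auto
  ultimately have "emeasure ?C ?B \<le> ennreal 0"
    by (intro LIMSEQ_le_const) auto
  then have null: "?B \<in> null_sets ?C" by (intro null_setsI) auto
  have "AE w in ?C. \<not> (\<forall>i. w (e, i) \<le> real T)"
    by (rule AE_I'[OF null]) auto
  then show ?thesis using AE_clocks_pos[OF assms(1,2)]
  proof eventually_elim
    case (elim w)
    then obtain i where "real T < w (e, i)" by (auto simp: not_le)
    then show ?case using ring_time_ge[OF elim(2) assms(3), of i i] by (intro exI[of _ i]) auto
  qed
qed

text \<open>Given all other coordinates, the coordinate \<open>(e, 0)\<close> translates the ring
  times of e and leaves those of e' alone, so a tie pins it to one value.\<close>

lemma AE_clocks_no_ties:
  assumes "0 < l" "countable E" "e \<in> E" "e' \<in> E" "e \<noteq> e'"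
  shows "AE w in clocks E l. ring_time w (e, k) \<noteq> ring_time w (e', k')"
proof -
  let ?J = "E \<times> UNIV - {(e, 0 :: nat)}"
  let ?X = "expo l" and ?Y = "PiM ?J (\<lambda>_. expo l)"
  interpret X: prob_space ?X using assms(1) by (rule prob_space_exponential_density)
  interpret Y: prob_space ?Y using assms(1) by (intro prob_space_PiM prob_space_exponential_density)
  interpret XY: pair_prob_space ?X ?Y ..
  have ins: "insert (e, 0) ?J = E \<times> UNIV" using assms(3) by auto
  have ins': "insert (e, 0) (E \<times> UNIV) = E \<times> UNIV" using assms(3) by auto
  let ?f = "\<lambda>(x, v). v((e, 0) := x)"
  have D: "distr (?X \<Otimes>\<^sub>M ?Y) (clocks E l) ?f = clocks E l"
    using distr_pair_PiM_eq_PiM[of ?J "\<lambda>_. expo l" "(e, 0)"] assms(1)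
    by (simp add: ins' prob_space_exponential_density)
  have f: "?f \<in> measurable (?X \<Otimes>\<^sub>M ?Y) (clocks E l)"
  proof -
    have "(\<lambda>(v, x). v((e, 0) := x)) \<in> measurable (?Y \<Otimes>\<^sub>M ?X) (clocks E l)"
      using measurable_add_dim[of "(e, 0)" ?J "\<lambda>_. expo l"] by (simp only: ins)
    from measurable_compose[OF measurable_pair_swap' this] show ?thesis
      by (simp add: case_prod_unfold)
  qed
  have S: "{w \<in> space (clocks E l). ring_time w (e, k) \<noteq> ring_time w (e', k')} \<in> sets (clocks E l)"
    by (rule borel_measurable_neq[OF measurable_ring_time[OF assms(3)] measurable_ring_time[OF assms(4)]])
  have e: "ring_time (v((e, 0) := x)) (e, k) = x + (\<Sum>i\<in>{1..k}. v (e, i))" for v :: "'a set \<times> nat \<Rightarrow> real" and x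
  proof -
    have "{..k} = insert 0 {1..k}" by auto
    then show ?thesis by (simp add: ring_time_def)
  qed
  have e': "ring_time (v((e, 0) := x)) (e', k') = ring_time v (e', k')" for v :: "'a set \<times> nat \<Rightarrow> real" and x
    using assms(5) by (simp add: ring_time_def)
  have "AE p in ?X \<Otimes>\<^sub>M ?Y. ring_time (?f p) (e, k) \<noteq> ring_time (?f p) (e', k')"
  proof (rule XY.AE_pair_measure)
    show Sf: "{p \<in> space (?X \<Otimes>\<^sub>M ?Y). ring_time (?f p) (e, k) \<noteq> ring_time (?f p) (e', k')} \<in> sets (?X \<Otimes>\<^sub>M ?Y)"
    proof -
      have "?f -` {w \<in> space (clocks E l). ring_time w (e, k) \<noteq> ring_time w (e', k')} \<inter> space (?X \<Otimes>\<^sub>M ?Y)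
         = {p \<in> space (?X \<Otimes>\<^sub>M ?Y). ring_time (?f p) (e, k) \<noteq> ring_time (?f p) (e', k')}"
        using measurable_space[OF f] by auto
      then show ?thesis using measurable_sets[OF f S] by simp
    qed
    have "(AE x in ?X. AE v in ?Y. ring_time (?f (x, v)) (e, k) \<noteq> ring_time (?f (x, v)) (e', k'))
      \<longleftrightarrow> (AE v in ?Y. AE x in ?X. ring_time (?f (x, v)) (e, k) \<noteq> ring_time (?f (x, v)) (e', k'))"
      using Sf by (intro XY.AE_commute) (simp add: case_prod_unfold)
    moreover have "AE x in ?X. ring_time (?f (x, v)) (e, k) \<noteq> ring_time (?f (x, v)) (e', k')" for v
      using AE_expo[OF assms(1), of "ring_time v (e', k') - (\<Sum>i\<in>{1..k}. v (e, i))"]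
      by eventually_elim (simp add: e e')
    ultimately show "AE x in ?X. AE v in ?Y. ring_time (?f (x, v)) (e, k) \<noteq> ring_time (?f (x, v)) (e', k')"
      by simp
  qed
  then have "AE w in distr (?X \<Otimes>\<^sub>M ?Y) (clocks E l) ?f. ring_time w (e, k) \<noteq> ring_time w (e', k')"
    by (subst AE_distr_iff[OF f S])
  then show ?thesis by (simp only: D)
qed

lemma AE_regular_clocks:
  assumes "finite V" "V \<noteq> {}"
  shows "AE w in clock_space V. regular_clocks V w"
proof -
  let ?E = "unordered_pairs V"
  have l: "0 < 1 / real (card V)" using assms by (simp add: card_gt_0_iff)
  have E: "countable ?E" using finite_unordered_pairs[OF assms(1)] by (rule countable_finite)
  let ?C = "clocks ?E (1 / real (card V))"
  have 2: "AE w in ?C. \<forall>e\<in>?E. \<forall>T::nat. \<exists>k. real T < ring_time w (e, k)"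
    unfolding AE_ball_countable[OF E] AE_all_countable using AE_clocks_unbounded[OF l E] by blast
  have "AE w in ?C. e \<noteq> e' \<longrightarrow> (\<forall>k k'. ring_time w (e, k) \<noteq> ring_time w (e', k'))"
    if "e \<in> ?E" "e' \<in> ?E" for e e'
  proof (cases "e = e'")
    case False
    then have "AE w in ?C. \<forall>k k'. ring_time w (e, k) \<noteq> ring_time w (e', k')"
      unfolding AE_all_countable using AE_clocks_no_ties[OF l E that] by blast
    then show ?thesis by eventually_elim simp
  qed simp
  then have "AE w in ?C. \<forall>e\<in>?E. \<forall>e'\<in>?E. e \<noteq> e' \<longrightarrow> (\<forall>k k'. ring_time w (e, k) \<noteq> ring_time w (e', k'))"
    unfolding AE_ball_countable[OF E] by blast
  with AE_clocks_pos[OF l E] 2 show ?thesis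
    unfolding clock_space_eq regular_clocks_def by eventually_elim blast
qed

lemma sets_regular_clocks:
  assumes "finite V"
  shows "{w \<in> space (clock_space V). regular_clocks V w} \<in> sets (clock_space V)"
proof -
  let ?E = "unordered_pairs V"
  have E: "finite ?E" using finite_unordered_pairs[OF assms(1)] .
  then have [simp]: "countable ?E" "countable (?E \<times> (UNIV :: nat set))" by (auto intro: countable_finite)
  have 1: "{w \<in> space (clock_space V). 0 < w r} \<in> sets (clock_space V)" if "r \<in> ?E \<times> UNIV" for r
  proof -
    obtain e i where r: "r = (e, i)" "e \<in> ?E" using \<open>r \<in> _\<close> by auto
    have [measurable]: "(\<lambda>w. w (e, i)) \<in> borel_measurable (clock_space V)"
      unfolding clock_space_eq by (rule measurable_clocks_component[OF r(2)])
    show ?thesis unfolding r by measurable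
  qed
  have rt: "(\<lambda>w. ring_time w (e, k)) \<in> borel_measurable (clock_space V)" if "e \<in> ?E" for e k
    unfolding clock_space_eq using that by (rule measurable_ring_time)
  have 2: "{w \<in> space (clock_space V). real T < ring_time w (e, k)} \<in> sets (clock_space V)" if "e \<in> ?E" for e k T
    using rt[OF that, of k] by measurable
  have 3: "{w \<in> space (clock_space V). ring_time w (e, k) \<noteq> ring_time w (e', k')} \<in> sets (clock_space V)"
    if "e \<in> ?E" "e' \<in> ?E" for e e' k k'
    by (rule borel_measurable_neq[OF rt[OF that(1)] rt[OF that(2)]])
  have 4: "{w \<in> space (clock_space V). e \<noteq> e' \<longrightarrow> (\<forall>k k'. ring_time w (e, k) \<noteq> ring_time w (e', k'))} \<in> sets (clock_space V)"
    if "e \<in> ?E" "e' \<in> ?E" for e e'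
  proof (cases "e = e'")
    case False
    have "{w \<in> space (clock_space V). \<forall>k k'. ring_time w (e, k) \<noteq> ring_time w (e', k')} \<in> sets (clock_space V)"
      by (intro sets.sets_Collect_countable_All 3 that)
    then show ?thesis using False by simp
  qed simp
  have "{w \<in> space (clock_space V). \<forall>e\<in>?E. \<forall>i. 0 < w (e, i)} \<in> sets (clock_space V)"
    by (rule sets.sets_Collect_finite_All[OF _ E], rule sets.sets_Collect_countable_All) (rule 1, simp)
  moreover have "{w \<in> space (clock_space V). \<forall>e\<in>?E. \<forall>T::nat. \<exists>k. real T < ring_time w (e, k)} \<in> sets (clock_space V)"
    by (rule sets.sets_Collect_finite_All[OF _ E], rule sets.sets_Collect_countable_All,
        rule sets.sets_Collect_countable_Ex) (rule 2)
  moreover have "{w \<in> space (clock_space V). \<forall>e\<in>?E. \<forall>e'\<in>?E. e \<noteq> e' \<longrightarrow>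
      (\<forall>k k'. ring_time w (e, k) \<noteq> ring_time w (e', k'))} \<in> sets (clock_space V)"
    by (rule sets.sets_Collect_finite_All[OF _ E], rule sets.sets_Collect_finite_All[OF _ E]) (rule 4)
  ultimately have "{w \<in> space (clock_space V). (\<forall>e\<in>?E. \<forall>i. 0 < w (e, i)) \<and> (\<forall>e\<in>?E. \<forall>T::nat. \<exists>k. real T < ring_time w (e, k))
      \<and> (\<forall>e\<in>?E. \<forall>e'\<in>?E. e \<noteq> e' \<longrightarrow> (\<forall>k k'. ring_time w (e, k) \<noteq> ring_time w (e', k')))} \<in> sets (clock_space V)"
    by (intro sets.sets_Collect_conj)
  then show ?thesis unfolding regular_clocks_def by (simp add: Ball_def)
qed

section \<open>Chronological lists of rings\<close>

lemma (in linorder) sorted_key_list_of_set_eqI: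
  assumes "sorted_wrt (<) (map f l)" "set l = A"
  shows "sorted_key_list_of_set f A = l"
proof -
  have d: "distinct (map f l)" "sorted (map f l)" using assms(1) by (auto simp: strict_sorted_iff)
  interpret folding_insort_key "(\<le>)" "(<)" "set l" f
    by unfold_locales (use d in \<open>simp add: distinct_map\<close>)
  show ?thesis using idem_if_sorted_distinct[of l] d assms(2) by (simp add: distinct_map)
qed

lemma (in linorder) sorted_key_list_of_set_strict:
  assumes "inj_on f A" "finite A"
  shows "sorted_wrt (<) (map f (sorted_key_list_of_set f A))" "set (sorted_key_list_of_set f A) = A"
proof -
  interpret folding_insort_key "(\<le>)" "(<)" A f by unfold_locales (rule assms(1))
  show "sorted_wrt (<) (map f (sorted_key_list_of_set f A))" by (rule strict_sorted_key_list_of_set) simp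
  show "set (sorted_key_list_of_set f A) = A" using assms(2) by simp
qed

context
  fixes V :: "'v set" and w :: "'v set \<times> nat \<Rightarrow> real"
  assumes finV: "finite V" and reg: "regular_clocks V w"
begin

lemma ring_time_strict_mono:
  assumes "e \<in> unordered_pairs V" "k < k'"
  shows "ring_time w (e, k) < ring_time w (e, k')"
proof -
  have "strict_mono (\<lambda>k. ring_time w (e, k))"
    using reg assms(1) by (intro strict_monoI_Suc) (auto simp: regular_clocks_def ring_time_Suc)
  then show ?thesis using assms(2) by (rule strict_monoD)
qed

lemma inj_on_ring_time: "inj_on (ring_time w) (unordered_pairs V \<times> UNIV)"
proof (rule inj_onI, clarify)
  fix e k e' k' assume *: "e \<in> unordered_pairs V" "e' \<in> unordered_pairs V" "ring_time w (e, k) = ring_time w (e', k')"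
  then have "e = e'" using reg unfolding regular_clocks_def by blast
  moreover have "k = k'"
  proof (rule ccontr)
    assume "k \<noteq> k'"
    then have "k < k' \<or> k' < k" by auto
    then show False using ring_time_strict_mono[of e] * \<open>e = e'\<close> by fastforce
  qed
  ultimately show "e = e' \<and> k = k'" by simp
qed

lemma finite_rings_until: "finite (rings_until V t w)"
proof -
  have "\<exists>K. t < ring_time w (e, K)" if "e \<in> unordered_pairs V" for e
  proof -
    obtain T :: nat where "t < real T" using reals_Archimedean2 by blast
    moreover obtain K where "real T < ring_time w (e, K)" using reg \<open>e \<in> unordered_pairs V\<close> unfolding regular_clocks_def by blast
    ultimately show ?thesis by (intro exI[of _ K]) linarith
  qed
  then obtain K where K: "\<And>e. e \<in> unordered_pairs V \<Longrightarrow> t < ring_time w (e, K e)" by metis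
  have "rings_until V t w \<subseteq> (SIGMA e:unordered_pairs V. {..K e})"
  proof
    fix r assume "r \<in> rings_until V t w"
    then obtain e k where r: "r = (e, k)" "e \<in> unordered_pairs V" "ring_time w (e, k) \<le> t"
      by (auto simp: rings_until_def)
    then have "\<not> K e < k" using K[of e] ring_time_strict_mono[of e "K e" k] by force
    then show "r \<in> (SIGMA e:unordered_pairs V. {..K e})" using r by auto
  qed
  then show ?thesis using finite_unordered_pairs[OF finV] finite_subset by blast
qed

lemma ordered_rings:
  "sorted_wrt (<) (map (ring_time w) (sorted_key_list_of_set (ring_time w) (rings_until V t w)))"
  "set (sorted_key_list_of_set (ring_time w) (rings_until V t w)) = rings_until V t w"
proof -
  have "inj_on (ring_time w) (rings_until V t w)"
    by (rule inj_on_subset[OF inj_on_ring_time]) (auto simp: rings_until_def)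
  from sorted_key_list_of_set_strict[OF this finite_rings_until]
  show "sorted_wrt (<) (map (ring_time w) (sorted_key_list_of_set (ring_time w) (rings_until V t w)))"
    "set (sorted_key_list_of_set (ring_time w) (rings_until V t w)) = rings_until V t w" .
qed

end

definition run_swaps :: "('v set \<times> nat) list \<Rightarrow> 'v \<Rightarrow> 'v" where
  "run_swaps l = fold (\<lambda>(e, k) \<sigma>. swap_pair e \<circ> \<sigma>) l id"

lemma run_swaps_fold:
  fixes \<tau> :: "'v \<Rightarrow> 'v"
  shows "fold (\<lambda>(e, k) \<sigma>. swap_pair e \<circ> \<sigma>) l \<tau> = run_swaps l \<circ> \<tau>"
proof (induction l arbitrary: \<tau>)
  case (Cons r l)
  let ?F = "\<lambda>(e, k) \<sigma>. swap_pair e \<circ> \<sigma>"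
  have step: "fold ?F (r # l) \<tau> = run_swaps l \<circ> (swap_pair (fst r) \<circ> \<tau>)" for \<tau> :: "'v \<Rightarrow> 'v"
  proof -
    have "fold ?F (r # l) \<tau> = fold ?F l (swap_pair (fst r) \<circ> \<tau>)" by (simp add: case_prod_unfold)
    also have "\<dots> = run_swaps l \<circ> (swap_pair (fst r) \<circ> \<tau>)" by (rule Cons)
    finally show ?thesis .
  qed
  show ?case unfolding step run_swaps_def[of "r # l"] step[of id] by (simp only: comp_id o_assoc)
qed (simp add: run_swaps_def)

lemma run_swaps_append: "run_swaps (l @ l') = run_swaps l' \<circ> run_swaps l"
  using run_swaps_fold[of l' "run_swaps l"] by (simp add: run_swaps_def)

lemma run_swaps_map: "(\<And>r. fst (h r) = fst r) \<Longrightarrow> run_swaps (map h l) = run_swaps l"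
  unfolding run_swaps_def fold_map by (intro fold_cong) (auto simp: case_prod_unfold fun_eq_iff)

lemma swap_pair_permutes: "e \<in> unordered_pairs V \<Longrightarrow> swap_pair e permutes V"
  by (auto simp: unordered_pairs_def swap_pair_doubleton intro: permutes_swap_id)

lemma run_swaps_permutes:
  "fst ` set l \<subseteq> unordered_pairs V \<Longrightarrow> run_swaps l permutes V"
proof (induction l)
  case Nil
  then show ?case using permutes_id[of V] by (simp add: run_swaps_def id_def)
next
  case (Cons r l)
  have "run_swaps (r # l) = run_swaps l \<circ> swap_pair (fst r)"
    using run_swaps_append[of "[r]" l] by (simp add: run_swaps_def case_prod_unfold)
  moreover have "run_swaps l permutes V" "swap_pair (fst r) permutes V"
    using Cons by (auto intro: swap_pair_permutes)
  ultimately show ?case by (simp only: permutes_compose)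
qed

lemma exclusion_perm_eqI:
  assumes "sorted_wrt (<) (map (ring_time w) l)" "set l = rings_until V t w"
  shows "exclusion_perm V t w = run_swaps l"
  unfolding exclusion_perm_def sorted_key_list_of_set_eqI[OF assms] run_swaps_def ..

lemma exclusion_perm_permutes:
  assumes "finite V" "regular_clocks V w"
  shows "exclusion_perm V t w permutes V"
  using ordered_rings[OF assms, of t] exclusion_perm_eqI[OF ordered_rings[OF assms]]
  by (auto intro!: run_swaps_permutes simp: rings_until_def)

text \<open>The spliced clocks ring as w does up to s and then as w' does up to t. Only the index of
  a later ring changes, by the number \<open>n e\<close> of rings of w up to s, and the
  transposition does not depend on the index.\<close>

lemma exclusion_perm_splice:
  assumes "finite V" and w: "regular_clocks V w" and w': "regular_clocks V w'" and st: "0 \<le> s" "0 \<le> t"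
  shows "exclusion_perm V (s + t) (splice_clocks (unordered_pairs V) s w w')
    = exclusion_perm V t w' \<circ> exclusion_perm V s w"
proof -
  let ?E = "unordered_pairs V" and ?v = "splice_clocks (unordered_pairs V) s w w'"
  define n where "n e = (LEAST k. s < ring_time w (e, k))" for e
  have ex: "\<exists>k. s < ring_time w (e, k)" if "e \<in> ?E" for e
  proof -
    obtain T :: nat where "s < real T" using reals_Archimedean2 by blast
    moreover obtain K where "real T < ring_time w (e, K)" using w \<open>e \<in> ?E\<close> unfolding regular_clocks_def by blast
    ultimately show ?thesis by (intro exI[of _ K]) linarith
  qed
  have n1: "s < ring_time w (e, n e)" if "e \<in> ?E" for e
    unfolding n_def using ex[OF that] by (rule LeastI_ex)
  have n2: "ring_time w (e, k) \<le> s" if "k < n e" for e k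
    using not_less_Least[of k "\<lambda>k. s < ring_time w (e, k)"] that by (auto simp: n_def)
  have le_s: "ring_time w (e, k) \<le> s \<longleftrightarrow> k < n e" if "e \<in> ?E" for e k
  proof
    assume *: "ring_time w (e, k) \<le> s"
    show "k < n e"
    proof (rule ccontr)
      assume "\<not> k < n e"
      then have "ring_time w (e, n e) \<le> ring_time w (e, k)"
        using ring_time_strict_mono[OF assms(1) w that, of "n e" k] by (cases "k = n e") auto
      then show False using n1[OF that] * by linarith
    qed
  qed (rule n2)
  have v: "(\<forall>k<n e. ring_time ?v (e, k) = ring_time w (e, k)) \<and> (\<forall>k. ring_time ?v (e, n e + k) = s + ring_time w' (e, k))"
    if e: "e \<in> ?E" for e
    using splice_sums[of "n e" "\<lambda>j. w (e, j)" s "\<lambda>j. w' (e, j)"] n1[OF e] n2[of _ e] e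
    by (simp add: ring_time_def splice_clocks_def)
  \<comment> \<open>Strict positivity separates the two lists: a ring of w may fall exactly at s,
    every delayed ring of w' falls later.\<close>
  have pos': "0 < ring_time w' r" if "r \<in> ?E \<times> UNIV" for r
  proof -
    obtain e k where r: "r = (e, k)" "e \<in> ?E" using \<open>r \<in> _\<close> by auto
    have "\<forall>r\<in>?E \<times> UNIV. 0 < w' r" using w' by (simp add: regular_clocks_def)
    then have "0 < w' (e, k)" "w' (e, k) \<le> ring_time w' (e, k)" using r ring_time_ge[of ?E w' e k k] by auto
    then show ?thesis using r by simp
  qed
  define l l' where "l = sorted_key_list_of_set (ring_time w) (rings_until V s w)"
    and "l' = sorted_key_list_of_set (ring_time w') (rings_until V t w')"
  define h where "h r = (fst r, n (fst r) + snd r)" for r :: "'a set \<times> nat"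
  have l: "sorted_wrt (<) (map (ring_time w) l)" "set l = rings_until V s w"
    unfolding l_def by (rule ordered_rings[OF assms(1) w])+
  have l': "sorted_wrt (<) (map (ring_time w') l')" "set l' = rings_until V t w'"
    unfolding l'_def by (rule ordered_rings[OF assms(1) w'])+
  have tl: "ring_time ?v r = ring_time w r \<and> ring_time w r \<le> s" if "r \<in> set l" for r
  proof -
    obtain e k where r: "r = (e, k)" "e \<in> ?E" "ring_time w (e, k) \<le> s"
      using \<open>r \<in> set l\<close> l(2) by (auto simp: rings_until_def)
    then show ?thesis using v[of e] le_s[of e k] by auto
  qed
  have th: "ring_time ?v (h r) = s + ring_time w' r" if "r \<in> ?E \<times> UNIV" for r
    using that v[of "fst r"] by (auto simp: h_def)
  have l'E: "set l' \<subseteq> ?E \<times> UNIV" using l'(2) by (auto simp: rings_until_def)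
  have "sorted_wrt (<) (map (ring_time ?v) (l @ map h l'))"
  proof -
    have eq: "map (ring_time ?v) (l @ map h l') = map (ring_time w) l @ map (\<lambda>r. s + ring_time w' r) l'"
      using tl th l'E by auto
    have "sorted_wrt (<) (map (\<lambda>r. s + ring_time w' r) l')"
      using l'(1) by (simp add: sorted_wrt_map)
    moreover have "ring_time w a < s + ring_time w' b" if "a \<in> set l" "b \<in> set l'" for a b
    proof -
      have "0 < ring_time w' b" using pos' l'E that(2) by blast
      then show ?thesis using tl[OF that(1)] by linarith
    qed
    ultimately show ?thesis unfolding eq using l(1) by (simp add: sorted_wrt_append)
  qed
  moreover have "set (l @ map h l') = rings_until V (s + t) ?v"
  proof
    show "set (l @ map h l') \<subseteq> rings_until V (s + t) ?v"
    proof
      fix r assume "r \<in> set (l @ map h l')"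
      then consider "r \<in> set l" | r' where "r' \<in> set l'" "r = h r'" by auto
      then show "r \<in> rings_until V (s + t) ?v"
      proof cases
        case 1
        then show ?thesis using tl[OF 1] l(2) st by (auto simp: rings_until_def)
      next
        case 2
        then show ?thesis using th[of r'] l'(2) by (auto simp: rings_until_def h_def)
      qed
    qed
    show "rings_until V (s + t) ?v \<subseteq> set (l @ map h l')"
    proof
      fix r assume "r \<in> rings_until V (s + t) ?v"
      then obtain e k where r: "r = (e, k)" "e \<in> ?E" "ring_time ?v (e, k) \<le> s + t" by (auto simp: rings_until_def)
      show "r \<in> set (l @ map h l')"
      proof (cases "k < n e")
        case True
        then have "r \<in> set l" using le_s[OF r(2)] l(2) r by (auto simp: rings_until_def)
        then show ?thesis by simp
      next
        case False
        then obtain j where j: "k = n e + j" using le_Suc_ex by (metis not_less)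
        then have "(e, j) \<in> set l'" using v[OF r(2)] r l'(2) by (auto simp: rings_until_def)
        then have "h (e, j) \<in> h ` set l'" by (rule imageI)
        then show ?thesis using r j by (simp add: h_def)
      qed
    qed
  qed
  ultimately have "exclusion_perm V (s + t) ?v = run_swaps (l @ map h l')" by (rule exclusion_perm_eqI)
  also have "\<dots> = run_swaps l' \<circ> run_swaps l" by (simp add: run_swaps_append run_swaps_map h_def)
  also have "\<dots> = exclusion_perm V t w' \<circ> exclusion_perm V s w"
    using exclusion_perm_eqI[OF l] exclusion_perm_eqI[OF l'] by simp
  finally show ?thesis .
qed

section \<open>The random permutation: measurability and semigroup property\<close>

definition perm_event :: "'v set \<Rightarrow> real \<Rightarrow> ('v \<Rightarrow> 'v) \<Rightarrow> ('v set \<times> nat \<Rightarrow> real) set" where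
  "perm_event V t \<sigma> = {w \<in> space (clock_space V). regular_clocks V w \<and> exclusion_perm V t w = \<sigma>}"

definition perm_law :: "'v set \<Rightarrow> real \<Rightarrow> ('v \<Rightarrow> 'v) \<Rightarrow> real" where
  "perm_law V t \<sigma> = measure (clock_space V) (perm_event V t \<sigma>)"

lemma prob_space_clock_space:
  assumes "finite V" "V \<noteq> {}"
  shows "prob_space (clock_space V)"
  unfolding clock_space_eq using assms by (intro prob_space_clocks) (simp add: card_gt_0_iff)

lemma insort_key_cong:
  fixes f g :: "'a \<Rightarrow> 'b::linorder"
  assumes "\<And>x y. x \<in> S \<Longrightarrow> y \<in> S \<Longrightarrow> f x \<le> f y \<longleftrightarrow> g x \<le> g y" "a \<in> S" "set l \<subseteq> S"
  shows "insort_key f a l = insort_key g a l"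
  using assms(3) by (induction l) (auto simp: assms(1,2))

lemma sorted_key_list_of_set_fold:
  "sorted_key_list_of_set f A = Finite_Set.fold (insort_key f) [] A"
proof -
  interpret folding_on "{}" "insort_key f" "[]" by unfold_locales auto
  show ?thesis unfolding sorted_key_list_of_set_def by (rule eq_fold)
qed

lemma sorted_key_list_of_set_infinite: "infinite A \<Longrightarrow> sorted_key_list_of_set f A = []"
  by (simp add: sorted_key_list_of_set_fold Finite_Set.fold_def)

text \<open>Insertion sort sees the keys through comparisons only. Injectivity is not assumed, since
  ties have to be covered; equality of the fold graphs suffices even where the fold is not
  unique.\<close>

lemma sorted_key_list_of_set_cong:
  fixes f g :: "'a \<Rightarrow> 'b::linorder"
  assumes "\<And>x y. x \<in> S \<Longrightarrow> y \<in> S \<Longrightarrow> f x \<le> f y \<longleftrightarrow> g x \<le> g y"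
  shows "sorted_key_list_of_set f S = sorted_key_list_of_set g S"
proof -
  have one: "fold_graph (insort_key g) [] A l \<and> set l \<subseteq> A"
    if "fold_graph (insort_key f) [] A l" "A \<subseteq> S"
      "\<And>x y. x \<in> S \<Longrightarrow> y \<in> S \<Longrightarrow> f x \<le> f y \<longleftrightarrow> g x \<le> g y" for A l and f g :: "'a \<Rightarrow> 'b"
    using that(1,2)
  proof induction
    case emptyI
    show ?case by (auto intro: fold_graph.emptyI)
  next
    case (insertI x A y)
    then have IH: "fold_graph (insort_key g) [] A y" "set y \<subseteq> A" by auto
    have "insort_key f x y = insort_key g x y"
      using that(3) by (rule insort_key_cong[of S]) (use insertI.prems IH(2) in auto)
    then show ?case using fold_graph.insertI[OF insertI.hyps(1) IH(1)] IH(2) by (auto simp: set_insort_key)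
  qed
  have "fold_graph (insort_key f) [] S l = fold_graph (insort_key g) [] S l" for l
    using one[of f S l g] one[of g S l f] assms by blast
  then show ?thesis unfolding sorted_key_list_of_set_fold Finite_Set.fold_def by presburger
qed

text \<open>The integrals in the definition of \<open>CGXS\<close> run over all clocks, including those with infinitely many rings
  before time \<open>t\<close> or with ties. There too the permutation depends only on countably many events: on the
  set of rings and on their order.\<close>

lemma measurable_exclusion_perm:
  assumes "finite V" and F: "\<And>\<sigma>. F \<sigma> \<in> measurable M N" and q: "q \<in> measurable M (clock_space V)"
  shows "(\<lambda>x. F (exclusion_perm V t (q x)) x) \<in> measurable M N"
proof -
  let ?C = "clock_space V" and ?I = "unordered_pairs V \<times> (UNIV :: nat set)" and ?R = "rings_until V t"
  have I: "countable ?I" using finite_unordered_pairs[OF assms(1)] by (intro countable_SIGMA) (auto intro: countable_finite)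
  have rt: "(\<lambda>w. ring_time w r) \<in> borel_measurable ?C" if "r \<in> ?I" for r
    using that measurable_ring_time[of "fst r" "unordered_pairs V" "snd r"] unfolding clock_space_eq by auto
  define \<rho> where "\<rho> w = {(r, r') \<in> ?R w \<times> ?R w. ring_time w r \<le> ring_time w r'}" for w
  \<comment> \<open>Infinitely many rings give the empty list, hence the identity, just as no ring
    does; both cases share the key of empty sets.\<close>
  define key where "key w = (if finite (?R w) then (?R w, \<rho> w) else ({}, {}))" for w
  define \<Phi> where "\<Phi> i = (if \<exists>w. finite (?R w) \<and> key w = i
    then exclusion_perm V t (SOME w. finite (?R w) \<and> key w = i) else id)" for i
  have \<Phi>: "exclusion_perm V t w = \<Phi> (key w)" for w
  proof (cases "\<exists>w'. finite (?R w') \<and> key w' = key w")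
    case True
    define w' where "w' = (SOME w'. finite (?R w') \<and> key w' = key w)"
    have w': "finite (?R w')" "key w' = key w" using someI_ex[OF True] by (simp_all add: w'_def)
    have "exclusion_perm V t w = exclusion_perm V t w'"
    proof (cases "finite (?R w)")
      case fin: True
      then have eq: "?R w = ?R w'" "\<rho> w = \<rho> w'" using w' by (simp_all add: key_def)
      have "ring_time w r \<le> ring_time w r' \<longleftrightarrow> ring_time w' r \<le> ring_time w' r'" if "r \<in> ?R w" "r' \<in> ?R w" for r r'
      proof -
        have "(r, r') \<in> \<rho> w \<longleftrightarrow> (r, r') \<in> \<rho> w'" by (simp add: eq)
        then show ?thesis using that eq(1) by (simp add: \<rho>_def)
      qed
      then have "sorted_key_list_of_set (ring_time w) (?R w) = sorted_key_list_of_set (ring_time w') (?R w)"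
        by (rule sorted_key_list_of_set_cong)
      then show ?thesis by (simp add: exclusion_perm_def eq(1))
    next
      case False
      then have "?R w' = {}" using w' by (simp add: key_def)
      then show ?thesis using False
        by (simp add: exclusion_perm_def sorted_key_list_of_set_infinite) (simp add: sorted_key_list_of_set_fold)
    qed
    then show ?thesis using True by (simp add: \<Phi>_def w'_def)
  next
    case False
    then have "infinite (?R w)" by blast
    then have "exclusion_perm V t w = id" by (simp add: exclusion_perm_def sorted_key_list_of_set_infinite)
    then show ?thesis unfolding \<Phi>_def if_not_P[OF False] .
  qed
  define J where "J = (SIGMA S:{S. S \<subseteq> ?I \<and> finite S}. Pow (S \<times> S))"
  have J: "countable J"
    unfolding J_def
  proof (rule countable_SIGMA)
    show "countable {S. S \<subseteq> ?I \<and> finite S}"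
      using countable_Collect_finite_subset[OF I] by (simp add: conj_commute)
    show "countable (Pow (S \<times> S))" if "S \<in> {S. S \<subseteq> ?I \<and> finite S}" for S
      using that by (auto intro: countable_finite)
  qed
  have RI: "?R w \<subseteq> ?I" for w by (auto simp: rings_until_def)
  have key_in: "key w \<in> J" for w using RI[of w] by (auto simp: key_def J_def \<rho>_def)
  have RS: "{w \<in> space ?C. ?R w = S} \<in> sets ?C" if "S \<subseteq> ?I" for S
  proof -
    have "{w \<in> space ?C. \<forall>r\<in>?I. (r \<in> S) = (ring_time w r \<le> t)} \<in> sets ?C"
    proof (rule sets.sets_Collect_countable_All'[OF _ I])
      fix r assume r: "r \<in> ?I"
      have "{w \<in> space ?C. ring_time w r \<le> t} \<in> sets ?C" by (rule borel_measurable_le[OF rt[OF r]]) simp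
      moreover have "{w \<in> space ?C. t < ring_time w r} \<in> sets ?C" by (rule borel_measurable_less[OF _ rt[OF r]]) simp
      ultimately show "{w \<in> space ?C. (r \<in> S) = (ring_time w r \<le> t)} \<in> sets ?C"
        by (cases "r \<in> S") (simp_all add: not_le)
    qed
    moreover have "?R w = S \<longleftrightarrow> (\<forall>r\<in>?I. (r \<in> S) = (ring_time w r \<le> t))" for w
      using that unfolding rings_until_def by blast
    ultimately show ?thesis by simp
  qed
  have fin: "{w \<in> space ?C. finite (?R w)} \<in> sets ?C"
  proof -
    have "{w \<in> space ?C. finite (?R w)} = (\<Union>S\<in>{S. S \<subseteq> ?I \<and> finite S}. {w \<in> space ?C. ?R w = S})"
      using RI by auto
    moreover have "countable {S. S \<subseteq> ?I \<and> finite S}"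
      using countable_Collect_finite_subset[OF I] by (simp add: conj_commute)
    ultimately show ?thesis using RS by (auto intro!: sets.countable_UN')
  qed
  have level: "{w \<in> space ?C. ?R w = S \<and> \<rho> w = T} \<in> sets ?C" if "S \<subseteq> ?I" "finite S" "T \<subseteq> S \<times> S" for S T
  proof -
    have "{w \<in> space ?C. \<forall>r\<in>S. \<forall>r'\<in>S. ((r, r') \<in> T) = (ring_time w r \<le> ring_time w r')} \<in> sets ?C"
    proof (intro sets.sets_Collect_finite_All[OF _ that(2)])
      fix r r' assume "r \<in> S" "r' \<in> S"
      then have r: "r \<in> ?I" "r' \<in> ?I" using that(1) by blast+
      have "{w \<in> space ?C. ring_time w r \<le> ring_time w r'} \<in> sets ?C" by (rule borel_measurable_le[OF rt[OF r(1)] rt[OF r(2)]])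
      moreover have "{w \<in> space ?C. ring_time w r' < ring_time w r} \<in> sets ?C" by (rule borel_measurable_less[OF rt[OF r(2)] rt[OF r(1)]])
      ultimately show "{w \<in> space ?C. ((r, r') \<in> T) = (ring_time w r \<le> ring_time w r')} \<in> sets ?C"
        by (cases "(r, r') \<in> T") (simp_all add: not_le)
    qed
    with RS[OF that(1)] have "{w \<in> space ?C. ?R w = S} \<inter>
        {w \<in> space ?C. \<forall>r\<in>S. \<forall>r'\<in>S. ((r, r') \<in> T) = (ring_time w r \<le> ring_time w r')} \<in> sets ?C"
      by (rule sets.Int)
    moreover have "\<rho> w = T \<longleftrightarrow> (\<forall>r\<in>S. \<forall>r'\<in>S. ((r, r') \<in> T) = (ring_time w r \<le> ring_time w r'))" if "?R w = S" for w
      unfolding \<rho>_def that using \<open>T \<subseteq> S \<times> S\<close> by auto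
    then have "{w \<in> space ?C. ?R w = S \<and> \<rho> w = T} = {w \<in> space ?C. ?R w = S} \<inter>
        {w \<in> space ?C. \<forall>r\<in>S. \<forall>r'\<in>S. ((r, r') \<in> T) = (ring_time w r \<le> ring_time w r')}" by blast
    ultimately show ?thesis by simp
  qed
  have key: "key \<in> measurable ?C (count_space J)"
  proof (subst measurable_count_space_eq_countable[OF J], intro conjI ballI)
    show "key \<in> space ?C \<rightarrow> J" using key_in by auto
    fix i assume "i \<in> J"
    then obtain S T where i: "i = (S, T)" "S \<subseteq> ?I" "finite S" "T \<subseteq> S \<times> S" by (auto simp: J_def)
    have "key w = i \<longleftrightarrow> ?R w = S \<and> \<rho> w = T \<or> i = ({}, {}) \<and> infinite (?R w)" for w
      using i(1,3) by (cases "finite (?R w)") (simp_all add: key_def, metis)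
    then have "key -` {i} \<inter> space ?C = {w \<in> space ?C. ?R w = S \<and> \<rho> w = T} \<union>
        (if i = ({}, {}) then space ?C - {w \<in> space ?C. finite (?R w)} else {})"
      by auto
    then show "key -` {i} \<inter> space ?C \<in> sets ?C" using level[OF i(2-4)] fin by auto
  qed
  have "(\<lambda>x. F (\<Phi> (key (q x))) x) \<in> measurable M N"
    by (rule measurable_compose_countable'[OF F measurable_compose[OF q key] J])
  then show ?thesis by (simp add: \<Phi>)
qed

lemma sets_perm_event:
  assumes "finite V"
  shows "perm_event V t \<sigma> \<in> sets (clock_space V)"
proof -
  let ?C = "clock_space V"
  have "(\<lambda>w. exclusion_perm V t w) \<in> measurable ?C (count_space UNIV)"
    by (rule measurable_exclusion_perm[OF assms]) auto
  from measurable_sets[OF this, of "{\<sigma>}"]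
  have "(\<lambda>w. exclusion_perm V t w) -` {\<sigma>} \<inter> space ?C \<in> sets ?C" by simp
  with sets_regular_clocks[OF assms]
  have "{w \<in> space ?C. regular_clocks V w} \<inter> ((\<lambda>w. exclusion_perm V t w) -` {\<sigma>} \<inter> space ?C) \<in> sets ?C"
    by (rule sets.Int)
  moreover have "perm_event V t \<sigma> = {w \<in> space ?C. regular_clocks V w} \<inter> ((\<lambda>w. exclusion_perm V t w) -` {\<sigma>} \<inter> space ?C)"
    by (auto simp: perm_event_def)
  ultimately show ?thesis by simp
qed

lemma perm_weights_perm_law:
  assumes "finite V" "V \<noteq> {}"
  shows "perm_weights V (perm_law V t)"
proof -
  interpret prob_space "clock_space V" by (rule prob_space_clock_space[OF assms])
  let ?P = "{\<sigma>. \<sigma> permutes V}"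
  have fin: "finite ?P" using assms(1) by (rule finite_permutations)
  have "(\<Sum>\<sigma>\<in>?P. perm_law V t \<sigma>) = measure (clock_space V) (\<Union>\<sigma>\<in>?P. perm_event V t \<sigma>)"
    unfolding perm_law_def using fin sets_perm_event[OF assms(1)]
    by (intro finite_measure_finite_Union[symmetric]) (auto simp: disjoint_family_on_def perm_event_def)
  also have "\<dots> = 1"
  proof (rule prob_eq_1[THEN iffD2])
    show "(\<Union>\<sigma>\<in>?P. perm_event V t \<sigma>) \<in> events" using fin sets_perm_event[OF assms(1)] by auto
    show "AE w in clock_space V. w \<in> (\<Union>\<sigma>\<in>?P. perm_event V t \<sigma>)"
      using AE_regular_clocks[OF assms] AE_space
      by eventually_elim (auto simp: perm_event_def intro: exclusion_perm_permutes[OF assms(1)])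
  qed
  finally show ?thesis by (auto simp: perm_weights_def perm_law_def)
qed

lemma measure_pair_Times:
  assumes "prob_space M" "prob_space N" "A \<in> sets M" "B \<in> sets N"
  shows "measure (M \<Otimes>\<^sub>M N) (A \<times> B) = measure M A * measure N B"
proof -
  interpret N: prob_space N by fact
  show ?thesis
    using N.emeasure_pair_measure_Times[OF assms(3,4)] by (simp add: measure_def enn2real_mult)
qed

text \<open>Chapman-Kolmogorov: a clock family is distributed like the splice at s of two
  independent ones, and the permutation of a splice is the composition of the two
  permutations.\<close>

lemma perm_law_add:
  assumes "finite V" "V \<noteq> {}" "0 \<le> s" "0 \<le> t"
  shows "perm_law V (s + t) \<tau>
    = (\<Sum>p | p \<in> {\<sigma>. \<sigma> permutes V} \<times> {\<sigma>. \<sigma> permutes V} \<and> snd p \<circ> fst p = \<tau>. perm_law V s (fst p) * perm_law V t (snd p))"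
proof -
  let ?C = "clock_space V" and ?P = "{\<sigma>. \<sigma> permutes V}" and ?E = "unordered_pairs V"
  let ?f = "\<lambda>(w, w'). splice_clocks ?E s w w'"
  interpret C: prob_space ?C by (rule prob_space_clock_space[OF assms(1,2)])
  interpret CC: pair_prob_space ?C ?C ..
  have l: "0 < 1 / real (card V)" using assms by (simp add: card_gt_0_iff)
  have f: "?f \<in> measurable (?C \<Otimes>\<^sub>M ?C) ?C"
    unfolding clock_space_eq by (rule measurable_splice_clocks)
  have D: "distr (?C \<Otimes>\<^sub>M ?C) ?C ?f = ?C"
    unfolding clock_space_eq by (rule distr_splice_clocks[OF finite_unordered_pairs[OF assms(1)] l assms(3)])
  define Q where "Q = {p \<in> ?P \<times> ?P. snd p \<circ> fst p = \<tau>}"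
  have finQ: "finite Q" using finite_permutations[OF assms(1)] by (auto simp: Q_def)
  let ?R = "\<lambda>p. perm_event V s (fst p) \<times> perm_event V t (snd p)"
  have R: "?R p \<in> sets (?C \<Otimes>\<^sub>M ?C)" for p using sets_perm_event[OF assms(1)] by auto
  have ev: "perm_event V (s + t) \<tau> \<in> sets ?C" by (rule sets_perm_event[OF assms(1)])
  have "perm_law V (s + t) \<tau> = measure (distr (?C \<Otimes>\<^sub>M ?C) ?C ?f) (perm_event V (s + t) \<tau>)"
    by (simp add: D perm_law_def)
  also have "\<dots> = measure (?C \<Otimes>\<^sub>M ?C) (?f -` perm_event V (s + t) \<tau> \<inter> space (?C \<Otimes>\<^sub>M ?C))"
    by (rule measure_distr[OF f ev])
  also have "\<dots> = measure (?C \<Otimes>\<^sub>M ?C) (\<Union>p\<in>Q. ?R p)"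
  proof (rule CC.finite_measure_eq_AE)
    show "?f -` perm_event V (s + t) \<tau> \<inter> space (?C \<Otimes>\<^sub>M ?C) \<in> CC.events" by (rule measurable_sets[OF f ev])
    show "(\<Union>p\<in>Q. ?R p) \<in> CC.events" using finQ R by auto
    have reg: "AE p in ?C \<Otimes>\<^sub>M ?C. regular_clocks V (fst p) \<and> regular_clocks V (snd p)"
    proof (rule CC.AE_pair_measure)
      have "{p \<in> space (?C \<Otimes>\<^sub>M ?C). regular_clocks V (fst p) \<and> regular_clocks V (snd p)}
          = {w \<in> space ?C. regular_clocks V w} \<times> {w \<in> space ?C. regular_clocks V w}"
        by (auto simp: space_pair_measure)
      then show "{p \<in> space (?C \<Otimes>\<^sub>M ?C). regular_clocks V (fst p) \<and> regular_clocks V (snd p)} \<in> sets (?C \<Otimes>\<^sub>M ?C)"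
        using sets_regular_clocks[OF assms(1)] by simp
      show "AE w in ?C. AE w' in ?C. regular_clocks V (fst (w, w')) \<and> regular_clocks V (snd (w, w'))"
        using AE_regular_clocks[OF assms(1,2)]
      proof eventually_elim
        case (elim w)
        show ?case using AE_regular_clocks[OF assms(1,2)] by eventually_elim (use elim in simp)
      qed
    qed
    have "AE w in distr (?C \<Otimes>\<^sub>M ?C) ?C ?f. regular_clocks V w"
      unfolding D by (rule AE_regular_clocks[OF assms(1,2)])
    then have "AE p in ?C \<Otimes>\<^sub>M ?C. regular_clocks V (?f p)" by (rule AE_distrD[OF f])
    with reg show "AE p in ?C \<Otimes>\<^sub>M ?C. p \<in> ?f -` perm_event V (s + t) \<tau> \<inter> space (?C \<Otimes>\<^sub>M ?C) \<longleftrightarrow> p \<in> (\<Union>p\<in>Q. ?R p)"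
      using AE_space
    proof eventually_elim
      case (elim p)
      obtain w w' where p: "p = (w, w')" by (cases p)
      have r: "regular_clocks V w" "regular_clocks V w'" "regular_clocks V (splice_clocks ?E s w w')"
        using elim p by auto
      have sp: "w \<in> space ?C" "w' \<in> space ?C" "splice_clocks ?E s w w' \<in> space ?C"
        using elim(3) measurable_space[OF f elim(3)] p by (auto simp: space_pair_measure)
      have "exclusion_perm V s w permutes V" "exclusion_perm V t w' permutes V"
        using exclusion_perm_permutes[OF assms(1)] r by auto
      then show ?case
        using exclusion_perm_splice[OF assms(1) r(1,2) assms(3,4)] r sp elim(3)
        unfolding p Q_def perm_event_def by auto
    qed
  qed
  also have "\<dots> = (\<Sum>p\<in>Q. measure (?C \<Otimes>\<^sub>M ?C) (?R p))"
    using finQ R by (intro CC.finite_measure_finite_Union) (auto simp: disjoint_family_on_def perm_event_def)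
  also have "\<dots> = (\<Sum>p\<in>Q. perm_law V s (fst p) * perm_law V t (snd p))"
    unfolding perm_law_def using sets_perm_event[OF assms(1)] C.prob_space_axioms
    by (intro sum.cong refl measure_pair_Times)
  finally show ?thesis by (simp add: Q_def)
qed

lemma perm_avg_perm_law_add:
  assumes "finite V" "V \<noteq> {}" "0 \<le> s" "0 \<le> t"
  shows "perm_avg V (perm_law V (s + t)) g = perm_avg V (perm_law V s) (perm_avg V (perm_law V t) g)"
proof
  fix A
  let ?P = "{\<sigma>. \<sigma> permutes V}"
  let ?c = "\<lambda>p. snd p \<circ> fst p :: 'a \<Rightarrow> 'a" and ?h = "\<lambda>p. perm_law V s (fst p) * perm_law V t (snd p)"
  have fin: "finite ?P" using assms(1) by (rule finite_permutations)
  have "perm_avg V (perm_law V (s + t)) g A = (\<Sum>\<tau>\<in>?P. \<Sum>p | p \<in> ?P \<times> ?P \<and> ?c p = \<tau>. ?h p * g (?c p ` A))"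
    unfolding perm_avg_def perm_law_add[OF assms] by (simp add: sum_distrib_right)
  also have "\<dots> = (\<Sum>p\<in>?P \<times> ?P. ?h p * g (?c p ` A))"
    using fin by (intro sum.group) (auto intro: permutes_compose)
  also have "\<dots> = (\<Sum>\<sigma>\<in>?P. \<Sum>\<sigma>'\<in>?P. perm_law V s \<sigma> * perm_law V t \<sigma>' * g (\<sigma>' ` \<sigma> ` A))"
    by (simp add: sum.cartesian_product case_prod_unfold image_comp)
  also have "\<dots> = perm_avg V (perm_law V s) (perm_avg V (perm_law V t) g) A"
    by (simp add: perm_avg_def sum_distrib_left mult.assoc)
  finally show "perm_avg V (perm_law V (s + t)) g A = perm_avg V (perm_law V s) (perm_avg V (perm_law V t) g) A" .
qed

lemma perm_avg_perm_law_iterate: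
  assumes "finite V" "V \<noteq> {}" "0 \<le> h"
  shows "perm_avg V (perm_law V (real (Suc j) * h)) g = (perm_avg V (perm_law V h) ^^ Suc j) g"
proof (induction j)
  case (Suc j)
  have "real (Suc (Suc j)) * h = h + real (Suc j) * h" by (simp add: algebra_simps)
  then have "perm_avg V (perm_law V (real (Suc (Suc j)) * h)) g
      = perm_avg V (perm_law V h) (perm_avg V (perm_law V (real (Suc j) * h)) g)"
    using perm_avg_perm_law_add[OF assms(1,2), of h "real (Suc j) * h" g] assms(3) by simp
  then show ?case using Suc by simp
qed simp

section \<open>Short times and the swap energy\<close>

lemma measure_clocks_rect:
  assumes "finite E" "0 < l" "\<And>r. A r \<in> sets borel"
  shows "measure (clocks E l) {x \<in> space (clocks E l). \<forall>e\<in>E. \<forall>i<n. x (e, i) \<in> A (e, i)}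
    = (\<Prod>e\<in>E. \<Prod>i<n. measure (expo l) (A (e, i)))"
proof -
  interpret X: prob_space "expo l" using assms(2) by (rule prob_space_exponential_density)
  have "emeasure (clocks E l) {x \<in> space (clocks E l). \<forall>e\<in>E. \<forall>i<n. x (e, i) \<in> A (e, i)}
      = ennreal (\<Prod>e\<in>E. \<Prod>i<n. measure (expo l) (A (e, i)))"
    using emeasure_clocks_rect[OF assms(1,2), of A n] assms(3)
    by (simp add: X.emeasure_eq_measure prod_ennreal prod_nonneg)
  then show ?thesis by (intro measure_eq_emeasure_eq_ennreal prod_nonneg) auto
qed

lemma measure_expo:
  assumes "0 < l" "0 \<le> h"
  shows "measure (expo l) {h<..} = exp (- l * h)" "measure (expo l) {..h} = 1 - exp (- l * h)"
    "measure (expo l) UNIV = 1"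
proof -
  interpret X: prob_space "expo l" using assms(1) by (rule prob_space_exponential_density)
  show 1: "measure (expo l) {h<..} = exp (- l * h)"
    using emeasure_expo_greaterThan[OF assms] by (intro measure_eq_emeasure_eq_ennreal) auto
  have "UNIV - {h<..} = {..h}" by auto
  then show "measure (expo l) {..h} = 1 - exp (- l * h)" using X.prob_compl[of "{h<..}"] 1 by simp
  show "measure (expo l) UNIV = 1" using X.prob_space by simp
qed

text \<open>The identity occurs if no clock rings up to time h, a transposition if its clock rings
  exactly once and no other does. Here q is the probability that a given clock stays silent.\<close>

lemma perm_law_lower:
  assumes "finite V" "V \<noteq> {}" "0 \<le> h" and q: "q = exp (- (h / card V))"
  shows "q ^ card (unordered_pairs V) \<le> perm_law V h id"
    and "x \<in> V \<Longrightarrow> y \<in> V \<Longrightarrow> x \<noteq> y \<Longrightarrow>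
      (1 - q) * q ^ card (unordered_pairs V) \<le> perm_law V h (Transposition.transpose x y)"
proof -
  let ?C = "clock_space V" and ?E = "unordered_pairs V" and ?l = "1 / real (card V)"
  interpret C: prob_space ?C by (rule prob_space_clock_space[OF assms(1,2)])
  have l: "0 < ?l" using assms by (simp add: card_gt_0_iff)
  have E: "finite ?E" using assms(1) by (rule finite_unordered_pairs)
  have pos: "\<forall>r\<in>?E \<times> UNIV. 0 < w r" if "regular_clocks V w" for w
    using that by (simp add: regular_clocks_def)
  have meas: "measure (expo ?l) {h<..} = q" "measure (expo ?l) {..h} = 1 - q" "measure (expo ?l) UNIV = 1"
    using measure_expo[OF l assms(3)] by (simp_all add: q)
  have "q ^ card ?E = measure ?C {w \<in> space ?C. \<forall>e\<in>?E. \<forall>i<1. w (e, i) \<in> {h<..}}"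
    unfolding clock_space_eq using measure_clocks_rect[OF E l, of "\<lambda>_. {h<..}" 1] by (simp add: meas)
  also have "\<dots> \<le> perm_law V h id"
    unfolding perm_law_def
  proof (rule C.finite_measure_mono_AE[OF _ sets_perm_event[OF assms(1)]])
    show "AE w in ?C. w \<in> {w \<in> space ?C. \<forall>e\<in>?E. \<forall>i<1. w (e, i) \<in> {h<..}} \<longrightarrow> w \<in> perm_event V h id"
      using AE_regular_clocks[OF assms(1,2)]
    proof eventually_elim
      case (elim w)
      show ?case
      proof
        assume w: "w \<in> {w \<in> space ?C. \<forall>e\<in>?E. \<forall>i<1. w (e, i) \<in> {h<..}}"
        have "h < ring_time w (e, k)" if "e \<in> ?E" for e k
          using w that ring_time_ge[OF pos[OF elim] that, of 0 k] by force
        then have "rings_until V h w = {}" by (force simp: rings_until_def not_le[symmetric])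
        then have "exclusion_perm V h w = id"
          using exclusion_perm_eqI[of w "[]" V h] by (simp add: run_swaps_def)
        then show "w \<in> perm_event V h id" using w elim by (simp add: perm_event_def)
      qed
    qed
  qed
  finally show "q ^ card ?E \<le> perm_law V h id" .
  show "(1 - q) * q ^ card ?E \<le> perm_law V h (Transposition.transpose x y)" if xy: "x \<in> V" "y \<in> V" "x \<noteq> y"
  proof -
    define e0 where "e0 = {x, y}"
    have e0: "e0 \<in> ?E" using xy by (auto simp: e0_def unordered_pairs_def)
    \<comment> \<open>The second waiting time of e0 alone is asked to exceed h. This forces a single
      ring and keeps the event a rectangle: 1 - q for the first time of e0, q for its second and for
      the first of every other pair.\<close>
    define B where "B r = (if fst r = e0 then (if snd r = 0 then {..h} else {h<..})
      else (if snd r = 0 then {h<..} else UNIV))" for r :: "'a set \<times> nat"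
    have B: "B r \<in> sets borel" for r by (auto simp: B_def)
    have "(1 - q) * q ^ card ?E = (\<Prod>e\<in>?E. \<Prod>i<2. measure (expo ?l) (B (e, i)))"
    proof -
      have "(\<Prod>i<2. measure (expo ?l) (B (e, i))) = (if e = e0 then 1 - q else 1) * q" for e
        by (simp add: B_def numeral_2_eq_2 meas)
      then have "(\<Prod>e\<in>?E. \<Prod>i<2. measure (expo ?l) (B (e, i))) = (\<Prod>e\<in>?E. if e = e0 then 1 - q else 1) * q ^ card ?E"
        by (simp add: prod.distrib)
      also have "(\<Prod>e\<in>?E. if e = e0 then 1 - q else 1) = 1 - q" using E e0 by simp
      finally show ?thesis by simp
    qed
    also have "\<dots> = measure ?C {w \<in> space ?C. \<forall>e\<in>?E. \<forall>i<2. w (e, i) \<in> B (e, i)}"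
      unfolding clock_space_eq by (rule measure_clocks_rect[OF E l B, symmetric])
    also have "\<dots> \<le> perm_law V h (Transposition.transpose x y)"
      unfolding perm_law_def
    proof (rule C.finite_measure_mono_AE[OF _ sets_perm_event[OF assms(1)]])
      show "AE w in ?C. w \<in> {w \<in> space ?C. \<forall>e\<in>?E. \<forall>i<2. w (e, i) \<in> B (e, i)} \<longrightarrow>
          w \<in> perm_event V h (Transposition.transpose x y)"
        using AE_regular_clocks[OF assms(1,2)]
      proof eventually_elim
        case (elim w)
        show ?case
        proof
          assume w: "w \<in> {w \<in> space ?C. \<forall>e\<in>?E. \<forall>i<2. w (e, i) \<in> B (e, i)}"
          then have w0: "w (e, i) \<in> B (e, i)" if "e \<in> ?E" "i < 2" for e i using that by auto
          have first: "w (e0, 0) \<le> h" and second: "h < w (e0, 1)" using w0[OF e0, of 0] w0[OF e0, of 1] by (auto simp: B_def)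
          have other: "h < w (e, 0)" if "e \<in> ?E" "e \<noteq> e0" for e using w0[OF that(1), of 0] that(2) by (auto simp: B_def)
          have "rings_until V h w = {(e0, 0)}"
          proof
            show "rings_until V h w \<subseteq> {(e0, 0)}"
            proof
              fix r assume "r \<in> rings_until V h w"
              then obtain e k where r: "r = (e, k)" "e \<in> ?E" "ring_time w (e, k) \<le> h" by (auto simp: rings_until_def)
              have "e = e0" using other[OF r(2)] ring_time_ge[OF pos[OF elim] r(2), of 0 k] r(3) by force
              moreover have "k = 0"
              proof (rule ccontr)
                assume "k \<noteq> 0"
                then have "w (e0, 1) \<le> ring_time w (e0, k)" by (intro ring_time_ge[OF pos[OF elim] e0]) simp
                then show False using second r(3) \<open>e = e0\<close> by simp
              qed
              ultimately show "r \<in> {(e0, 0)}" using r by simp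
            qed
            show "{(e0, 0)} \<subseteq> rings_until V h w" using e0 first by (simp add: rings_until_def ring_time_def)
          qed
          then have "exclusion_perm V h w = run_swaps [(e0, 0)]"
            by (intro exclusion_perm_eqI) simp_all
          also have "\<dots> = Transposition.transpose x y"
            using swap_pair_doubleton[OF xy(3)] by (simp add: run_swaps_def e0_def)
          finally show "w \<in> perm_event V h (Transposition.transpose x y)" using w elim by (simp add: perm_event_def)
        qed
      qed
    qed
    finally show ?thesis .
  qed
qed

text \<open>Time 1 is cut into M steps. As M grows, M p0 p1 tends to 1 / \<open>card V\<close>; an M
  for which it exceeds half of that makes the bound 4 of \<open>swap_energy_iterate\<close> into 8
  \<open>card V\<close>.\<close>

lemma swap_energy_perm_law:
  assumes "finite V" "V \<noteq> {}" and g: "\<And>A. A \<subseteq> V \<Longrightarrow> 0 \<le> g A \<and> g A \<le> 1"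
  shows "swap_energy V (perm_avg V (perm_law V 1) g) \<le> 8 * card V"
proof -
  let ?N = "real (card V)" and ?k = "card (unordered_pairs V)"
  let ?q = "\<lambda>M. exp (- (1 / real M / ?N))"
  have N: "0 < ?N" using assms by (simp add: card_gt_0_iff)
  have "(\<lambda>M. real M * (?q M ^ ?k * ((1 - ?q M) * ?q M ^ ?k))) \<longlonglongrightarrow> 1 / ?N"
  proof -
    have 1: "(\<lambda>M. ?q M ^ ?k) \<longlonglongrightarrow> 1 ^ ?k"
    proof (rule tendsto_power)
      show "?q \<longlonglongrightarrow> 1" using N by real_asymp
    qed
    have "(\<lambda>M. real M * (1 - ?q M)) \<longlonglongrightarrow> inverse ?N" using N by real_asymp
    then have 2: "(\<lambda>M. real M * (1 - ?q M)) \<longlonglongrightarrow> 1 / ?N" by (simp add: inverse_eq_divide)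
    have "(\<lambda>M. (real M * (1 - ?q M)) * (?q M ^ ?k * ?q M ^ ?k)) \<longlonglongrightarrow> 1 / ?N * (1 ^ ?k * 1 ^ ?k)"
      by (intro tendsto_mult 1 2)
    then show ?thesis by (simp add: mult_ac)
  qed
  then have "eventually (\<lambda>M. 1 / (2 * ?N) < real M * (?q M ^ ?k * ((1 - ?q M) * ?q M ^ ?k))) sequentially"
    using N by (intro order_tendstoD(1)) (auto simp: field_simps)
  then obtain M where M: "M > 0" "1 / (2 * ?N) < real M * (?q M ^ ?k * ((1 - ?q M) * ?q M ^ ?k))"
    by (auto simp: eventually_sequentially) (metis le_Suc_eq less_Suc_eq_0_disj linear zero_less_Suc)
  let ?h = "1 / real M" and ?p0 = "?q M ^ ?k" and ?p1 = "(1 - ?q M) * ?q M ^ ?k"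
  let ?F = "perm_avg V (perm_law V 1) g"
  obtain j where j: "M = Suc j" using M(1) by (cases M) auto
  have F: "?F = (perm_avg V (perm_law V ?h) ^^ M) g"
    using perm_avg_perm_law_iterate[OF assms(1,2), of ?h j g] unfolding j[symmetric] using M(1) by simp
  have q: "0 \<le> ?q M" "?q M \<le> 1" using N by simp_all
  have "real M * (?p0 * ?p1) * swap_energy V ?F \<le> 4 * cube_avg V (\<lambda>A. (g A)\<^sup>2)"
    unfolding F using q
    by (intro swap_energy_iterate assms(1) perm_weights_perm_law perm_law_lower assms(2)) auto
  also have "\<dots> \<le> 4 * 1"
    using g assms(1) by (intro mult_left_mono cube_avg_le_const) (auto simp: power_le_one)
  finally have le: "real M * (?p0 * ?p1) * swap_energy V ?F \<le> 4" by simp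
  have "0 \<le> swap_energy V ?F" unfolding swap_energy_def by (intro sum_nonneg cube_avg_nonneg) auto
  then have "1 / (2 * ?N) * swap_energy V ?F \<le> real M * (?p0 * ?p1) * swap_energy V ?F"
    using M(2) by (intro mult_right_mono) auto
  then have "1 / (2 * ?N) * swap_energy V ?F \<le> 4" using le by linarith
  then show ?thesis using N by (simp add: field_simps)
qed

section \<open>From the process to averages over the cube\<close>

definition set_fun :: "'v set \<Rightarrow> (('v \<Rightarrow> bool) \<Rightarrow> real) \<Rightarrow> 'v set \<Rightarrow> real" where
  "set_fun V F A = F (\<lambda>x\<in>V. x \<in> A)"

lemma bij_betw_configs: "bij_betw (\<lambda>A. \<lambda>x\<in>V. x \<in> A) (Pow V) (configs V)"
proof (rule bij_betwI[where g = "\<lambda>\<eta>. {x \<in> V. \<eta> x}"])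
  show "(\<lambda>x\<in>V. x \<in> {x \<in> V. \<eta> x}) = \<eta>" if "\<eta> \<in> configs V" for \<eta>
    using that by (auto simp: configs_def fun_eq_iff PiE_def extensional_def)
qed (auto simp: configs_def)

text \<open>Up to a null set the integrand is a finite combination of indicators of products of a
  single configuration with a \<open>perm_event\<close>. Equating the integrals calls for
  measurability on that null set too, supplied by \<open>measurable_exclusion_perm\<close>.\<close>

lemma integral_exclusion_space:
  fixes k :: "('v \<Rightarrow> bool) \<Rightarrow> ('v \<Rightarrow> 'v) \<Rightarrow> real"
  assumes "finite V" "V \<noteq> {}"
  shows "(LINT \<omega>|exclusion_space V. k (fst \<omega>) (exclusion_perm V t (snd \<omega>)))
    = cube_avg V (\<lambda>A. \<Sum>\<sigma> | \<sigma> permutes V. perm_law V t \<sigma> * k (\<lambda>x\<in>V. x \<in> A) \<sigma>)"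
proof -
  let ?C = "clock_space V" and ?P = "{\<sigma>. \<sigma> permutes V}" and ?S = "configs V"
  let ?M = "measure_pmf (pmf_of_set ?S)" and ?X = "exclusion_space V"
  interpret C: prob_space ?C by (rule prob_space_clock_space[OF assms])
  interpret MC: pair_prob_space ?M ?C ..
  have X: "?X = ?M \<Otimes>\<^sub>M ?C" by (simp add: exclusion_space_def)
  have S: "finite ?S" "?S \<noteq> {}" "card ?S = 2 ^ card V"
    using bij_betw_finite[OF bij_betw_configs[of V]] bij_betw_same_card[OF bij_betw_configs[of V]] assms(1)
    by (auto simp: card_Pow configs_def PiE_eq_empty_iff)
  have fin: "finite ?P" using assms(1) by (rule finite_permutations)
  let ?R = "\<lambda>\<eta> \<sigma>. {\<eta>} \<times> perm_event V t \<sigma>"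
  have R: "?R \<eta> \<sigma> \<in> sets ?X" for \<eta> \<sigma> unfolding X using sets_perm_event[OF assms(1)] by auto
  have mR: "measure ?X (?R \<eta> \<sigma>) = perm_law V t \<sigma> / 2 ^ card V" if "\<eta> \<in> ?S" for \<eta> \<sigma>
  proof -
    have "measure ?X (?R \<eta> \<sigma>) = measure ?M {\<eta>} * measure ?C (perm_event V t \<sigma>)"
      unfolding X by (intro measure_pair_Times sets_perm_event assms(1) C.prob_space_axioms prob_space_measure_pmf) simp
    also have "measure ?M {\<eta>} = 1 / 2 ^ card V"
      using S that by (simp add: measure_pmf_single)
    finally show ?thesis by (simp add: perm_law_def)
  qed
  let ?simple = "\<lambda>\<omega>. \<Sum>\<eta>\<in>?S. \<Sum>\<sigma>\<in>?P. k \<eta> \<sigma> * indicator (?R \<eta> \<sigma>) \<omega>"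
  have "AE \<omega> in ?X. k (fst \<omega>) (exclusion_perm V t (snd \<omega>)) = ?simple \<omega>"
  proof -
    have "AE \<omega> in ?M \<Otimes>\<^sub>M ?C. fst \<omega> \<in> ?S \<and> regular_clocks V (snd \<omega>)"
    proof (rule MC.AE_pair_measure)
      have "{\<omega> \<in> space (?M \<Otimes>\<^sub>M ?C). fst \<omega> \<in> ?S \<and> regular_clocks V (snd \<omega>)}
          = ?S \<times> {w \<in> space ?C. regular_clocks V w}" by (auto simp: space_pair_measure)
      then show "{\<omega> \<in> space (?M \<Otimes>\<^sub>M ?C). fst \<omega> \<in> ?S \<and> regular_clocks V (snd \<omega>)} \<in> sets (?M \<Otimes>\<^sub>M ?C)"
        using sets_regular_clocks[OF assms(1)] by simp
      show "AE \<eta> in ?M. AE w in ?C. fst (\<eta>, w) \<in> ?S \<and> regular_clocks V (snd (\<eta>, w))"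
        using AE_regular_clocks[OF assms] S by (intro AE_pmfI) auto
    qed
    then show ?thesis unfolding X using AE_space
    proof eventually_elim
      case (elim \<omega>)
      let ?\<pi> = "exclusion_perm V t (snd \<omega>)"
      have pi: "?\<pi> \<in> ?P" using elim exclusion_perm_permutes[OF assms(1)] by auto
      have "indicator (?R \<eta> \<sigma>) \<omega> = (if \<eta> = fst \<omega> \<and> \<sigma> = ?\<pi> then 1 else 0 :: real)" for \<eta> \<sigma>
        using elim by (cases \<omega>) (auto simp: perm_event_def space_pair_measure indicator_def)
      then have "?simple \<omega> = (\<Sum>\<eta>\<in>?S. \<Sum>\<sigma>\<in>?P. if \<eta> = fst \<omega> then if \<sigma> = ?\<pi> then k \<eta> \<sigma> else 0 else 0)"
        by (intro sum.cong refl) auto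
      also have "\<dots> = (\<Sum>\<eta>\<in>?S. if \<eta> = fst \<omega> then k \<eta> ?\<pi> else 0)"
        using fin pi by (intro sum.cong refl) auto
      also have "\<dots> = k (fst \<omega>) ?\<pi>" using S elim by simp
      finally show ?case by simp
    qed
  qed
  note AE_eq = this
  have int: "integrable ?X (\<lambda>\<omega>. indicator (?R \<eta> \<sigma>) \<omega> :: real)" for \<eta> \<sigma>
    unfolding X using R[unfolded X] by (intro integrable_real_indicator) (auto simp: MC.emeasure_finite less_top[symmetric])
  have bm: "?simple \<in> borel_measurable ?X"
    by (intro borel_measurable_integrable Bochner_Integration.integrable_sum integrable_mult_right int)
  have "(\<lambda>\<omega>. k (fst \<omega>) (exclusion_perm V t (snd \<omega>))) \<in> borel_measurable ?X"
  proof (rule measurable_exclusion_perm[OF assms(1), where F = "\<lambda>\<sigma> \<omega>. k (fst \<omega>) \<sigma>" and q = snd])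
    show "snd \<in> measurable ?X ?C" unfolding X by (rule measurable_snd)
    have "(\<lambda>\<eta>. k \<eta> \<sigma>) \<in> borel_measurable ?M" for \<sigma> by simp
    then show "(\<lambda>\<omega>. k (fst \<omega>) \<sigma>) \<in> borel_measurable ?X" for \<sigma>
      unfolding X by (rule measurable_compose[OF measurable_fst])
  qed
  from integral_cong_AE[OF this bm AE_eq]
  have "(LINT \<omega>|?X. k (fst \<omega>) (exclusion_perm V t (snd \<omega>))) = (LINT \<omega>|?X. ?simple \<omega>)" .
  also have "\<dots> = (\<Sum>\<eta>\<in>?S. \<Sum>\<sigma>\<in>?P. k \<eta> \<sigma> * measure ?X (?R \<eta> \<sigma>))"
    using int R sets.sets_into_space[OF R] by (simp add: Bochner_Integration.integral_sum Int_absorb2)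
  also have "\<dots> = (\<Sum>\<eta>\<in>?S. (\<Sum>\<sigma>\<in>?P. perm_law V t \<sigma> * k \<eta> \<sigma>) / 2 ^ card V)"
    by (intro sum.cong refl) (simp add: mR sum_divide_distrib mult.commute)
  also have "\<dots> = (\<Sum>A\<in>Pow V. (\<Sum>\<sigma>\<in>?P. perm_law V t \<sigma> * k (\<lambda>x\<in>V. x \<in> A) \<sigma>) / 2 ^ card V)"
    by (rule sum.reindex_bij_betw[OF bij_betw_configs, symmetric])
  finally show ?thesis by (simp add: cube_avg_def sum_divide_distrib)
qed

section \<open>Decay of correlations\<close>

lemma perm_avg_affine:
  assumes "perm_weights V \<mu>"
  shows "perm_avg V \<mu> (\<lambda>A. 2 * F A - 1) A = 2 * perm_avg V \<mu> F A - 1"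
  using assms by (simp add: perm_avg_def perm_weights_def right_diff_distrib sum_subtractf sum_distrib_left mult_ac)

lemma exclusion_covariance:
  fixes C :: "('v \<Rightarrow> bool) set"
  assumes "finite V" "V \<noteq> {}"
  defines "f \<equiv> \<lambda>\<eta>. 2 * indicator C \<eta> - 1 :: real" and "F \<equiv> set_fun V (indicator C)"
  shows "(LINT \<omega>|exclusion_space V. f (fst \<omega>) * f (exclusion_config V t \<omega>)) - (LINT \<omega>|exclusion_space V. f (fst \<omega>))\<^sup>2
    = 4 * (cube_avg V (\<lambda>A. F A * perm_avg V (perm_law V t) F A) - (cube_avg V F)\<^sup>2)"
proof -
  let ?\<mu> = "perm_law V t" and ?G = "\<lambda>A. 2 * F A - 1"
  let ?P = "perm_avg V ?\<mu>"
  have \<mu>: "perm_weights V ?\<mu>" by (rule perm_weights_perm_law[OF assms(1,2)])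
  have G: "f (\<lambda>x\<in>V. x \<in> A) = ?G A" for A by (simp add: f_def F_def set_fun_def)
  have "(LINT \<omega>|exclusion_space V. f (fst \<omega>) * f (exclusion_config V t \<omega>))
      = (LINT \<omega>|exclusion_space V. (\<lambda>\<eta> \<sigma>. f \<eta> * f (\<lambda>x\<in>V. \<eta> (inv \<sigma> x))) (fst \<omega>) (exclusion_perm V t (snd \<omega>)))"
    by (simp add: exclusion_config_def case_prod_unfold)
  also have "\<dots> = cube_avg V (\<lambda>A. \<Sum>\<sigma> | \<sigma> permutes V. ?\<mu> \<sigma> *
      (f (\<lambda>x\<in>V. x \<in> A) * f (\<lambda>x\<in>V. (\<lambda>x\<in>V. x \<in> A) (inv \<sigma> x))))"
    by (rule integral_exclusion_space[OF assms(1,2)])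
  also have "\<dots> = cube_avg V (\<lambda>A. ?G A * ?P ?G A)"
  proof (rule cube_avg_cong)
    fix A assume "A \<subseteq> V"
    have "(\<lambda>x\<in>V. (\<lambda>x\<in>V. x \<in> A) (inv \<sigma> x)) = (\<lambda>x\<in>V. x \<in> \<sigma> ` A)" if s: "\<sigma> permutes V" for \<sigma>
    proof (rule restrict_ext)
      fix x assume "x \<in> V"
      then have "inv \<sigma> x \<in> V" using permutes_inv[OF s] by (simp add: permutes_in_image)
      moreover have "inv \<sigma> x \<in> A \<longleftrightarrow> x \<in> \<sigma> ` A"
        using permutes_inverses[OF s] by (metis imageE image_eqI)
      ultimately show "(\<lambda>x\<in>V. x \<in> A) (inv \<sigma> x) = (x \<in> \<sigma> ` A)" by simp
    qed
    then have "(\<Sum>\<sigma> | \<sigma> permutes V. ?\<mu> \<sigma> * (f (\<lambda>x\<in>V. x \<in> A) * f (\<lambda>x\<in>V. (\<lambda>x\<in>V. x \<in> A) (inv \<sigma> x))))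
        = (\<Sum>\<sigma> | \<sigma> permutes V. ?\<mu> \<sigma> * (?G A * ?G (\<sigma> ` A)))"
      by (intro sum.cong refl) (simp add: G)
    also have "\<dots> = ?G A * ?P ?G A" by (simp add: perm_avg_def sum_distrib_left mult_ac)
    finally show "(\<Sum>\<sigma> | \<sigma> permutes V. ?\<mu> \<sigma> * (f (\<lambda>x\<in>V. x \<in> A) * f (\<lambda>x\<in>V. (\<lambda>x\<in>V. x \<in> A) (inv \<sigma> x))))
        = ?G A * ?P ?G A" .
  qed
  also have "\<dots> = cube_avg V (\<lambda>A. 4 * (F A * ?P F A) - 2 * F A - (2 * ?P F A - 1))"
    unfolding perm_avg_affine[OF \<mu>] by (intro cube_avg_cong) (simp add: algebra_simps)
  also have "\<dots> = 4 * cube_avg V (\<lambda>A. F A * ?P F A) - 2 * cube_avg V F - (2 * cube_avg V F - 1)"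
    using \<mu> assms(1) by (simp add: cube_avg_diff cube_avg_cmult cube_avg_const cube_avg_perm_avg)
  finally have 1: "(LINT \<omega>|exclusion_space V. f (fst \<omega>) * f (exclusion_config V t \<omega>))
      = 4 * cube_avg V (\<lambda>A. F A * ?P F A) - 2 * cube_avg V F - (2 * cube_avg V F - 1)" .
  have "(LINT \<omega>|exclusion_space V. f (fst \<omega>))
      = cube_avg V (\<lambda>A. \<Sum>\<sigma> | \<sigma> permutes V. ?\<mu> \<sigma> * f (\<lambda>x\<in>V. x \<in> A))"
    using integral_exclusion_space[OF assms(1,2), of "\<lambda>\<eta> \<sigma>. f \<eta>"] by simp
  also have "\<dots> = cube_avg V ?G"
    using \<mu> by (simp add: G sum_distrib_right[symmetric] perm_weights_def)
  also have "\<dots> = 2 * cube_avg V F - 1"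
    using assms(1) by (simp add: cube_avg_diff cube_avg_cmult cube_avg_const)
  finally have 2: "(LINT \<omega>|exclusion_space V. f (fst \<omega>)) = 2 * cube_avg V F - 1" .
  show ?thesis unfolding 1 2 by (simp add: power2_eq_square algebra_simps)
qed

text \<open>Order of choices: \<rho> from the target error, K from \<rho>, then n large, with R
  depending on n. Only the finitely many levels up to K occur, so convergence at each single level
  suffices.\<close>

lemma CGXS_events_monotone:
  fixes V :: "nat \<Rightarrow> 'v set" and C :: "nat \<Rightarrow> ('v \<Rightarrow> bool) set"
  defines "F \<equiv> \<lambda>n. set_fun (V n) (indicator (C n))"
  assumes fin: "\<And>n. finite (V n)" and card: "filterlim (\<lambda>n. real (card (V n))) at_top sequentially"
    and mono: "\<And>n A i. A \<subseteq> V n \<Longrightarrow> i \<in> V n \<Longrightarrow> F n A \<le> F n (insert i A)"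
    and level: "\<And>k. 0 < k \<Longrightarrow> (\<lambda>n. level_weight (V n) (F n) k) \<longlonglongrightarrow> 0"
  shows "CGXS_events V C"
  unfolding CGXS_events_def CGXS_def
proof (intro exI[of _ 1] conjI)
  let ?X = "\<lambda>n. (LINT \<omega>|exclusion_space (V n). (2 * indicator (C n) (fst \<omega>) - 1) * (2 * indicator (C n) (exclusion_config (V n) 1 \<omega>) - 1))
          - (LINT \<omega>|exclusion_space (V n). 2 * indicator (C n) (fst \<omega>) - 1)\<^sup>2 :: real"
  show "?X \<longlonglongrightarrow> 0"
  proof (rule tendstoI)
    fix \<epsilon> :: real assume "0 < \<epsilon>"
    \<comment> \<open>The covariance of the indicators ends up below 4 \<rho>, and passing to signs
      multiplies it by 4.\<close>
    define \<rho> where "\<rho> = \<epsilon> / 16"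
    have \<rho>: "0 < \<rho>" using \<open>0 < \<epsilon>\<close> by (simp add: \<rho>_def)
    \<comment> \<open>20 = 2 * 8 + 4, where 8 is the constant of
      \<open>swap_energy_perm_law\<close>.\<close>
    have "(\<lambda>K. sqrt ((4 / \<rho>\<^sup>2 + 20) / (2 * real (Suc K)))) \<longlonglongrightarrow> sqrt 0"
      by (intro tendsto_real_sqrt) real_asymp
    then have "eventually (\<lambda>K. sqrt ((4 / \<rho>\<^sup>2 + 20) / (2 * real (Suc K))) < \<rho>) sequentially"
      using \<rho> by (intro order_tendstoD(2)) auto
    then obtain K where K: "sqrt ((4 / \<rho>\<^sup>2 + 20) / (2 * real (Suc K))) < \<rho>"
      using eventually_happens trivial_limit_sequentially by blast
    have "(\<lambda>n. sqrt (\<Sum>k=1..K. level_weight (V n) (F n) k)) \<longlonglongrightarrow> sqrt (\<Sum>k=1..K. 0)"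
      by (intro tendsto_real_sqrt tendsto_sum level) auto
    then have ev1: "eventually (\<lambda>n. sqrt (\<Sum>k=1..K. level_weight (V n) (F n) k) < \<rho>) sequentially"
      using \<rho> by (intro order_tendstoD(2)) auto
    have "((\<lambda>x. 1 / sqrt x) \<longlongrightarrow> 0) at_top" by real_asymp
    from filterlim_compose[OF this card]
    have ev2: "eventually (\<lambda>n. 1 / sqrt (real (card (V n))) < \<rho>) sequentially"
      using \<rho> by (rule order_tendstoD(2))
    have ev3: "eventually (\<lambda>n. 0 < real (card (V n))) sequentially"
      using card unfolding filterlim_at_top_dense by blast
    show "eventually (\<lambda>n. dist (?X n) 0 < \<epsilon>) sequentially"
      using ev1 ev2 ev3
    proof eventually_elim
      case (elim n)
      let ?V = "V n" and ?N = "real (card (V n))"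
      have V: "finite ?V" "?V \<noteq> {}" using fin elim(3) by auto
      have sN: "0 < sqrt ?N" using elim(3) by simp
      \<comment> \<open>At this scale the shift of the mean is about \<rho>, while
        \<open>card V\<close> over the square of R stays below 1 / \<rho>^2.\<close>
      define R where "R = nat \<lceil>\<rho> * sqrt ?N\<rceil>"
      have R: "\<rho> * sqrt ?N \<le> real R" "real R \<le> \<rho> * sqrt ?N + 1"
        unfolding R_def using \<rho> sN by (auto simp: of_nat_ceiling) linarith?
      have R0: "0 < real R" using R(1) \<rho> sN by (smt (verit) mult_pos_pos)
      have "real R / sqrt ?N \<le> (\<rho> * sqrt ?N + 1) / sqrt ?N" using R(2) sN by (intro divide_right_mono) auto
      also have "\<dots> = \<rho> + 1 / sqrt ?N" using sN by (simp add: add_divide_distrib)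
      finally have b1: "real R / sqrt ?N < 2 * \<rho>" using elim(2) by simp
      have "(\<rho> * sqrt ?N)\<^sup>2 \<le> (real R)\<^sup>2" using R(1) \<rho> sN by (intro power_mono) auto
      then have "\<rho>\<^sup>2 * ?N \<le> (real R)\<^sup>2" by (simp add: power_mult_distrib)
      then have "4 * ?N / (real R)\<^sup>2 \<le> 4 / \<rho>\<^sup>2" using R0 \<rho> by (simp add: field_simps)
      then have "sqrt ((4 * ?N / (real R)\<^sup>2 + 2 * 8 + 4) / (2 * real (Suc K))) \<le> sqrt ((4 / \<rho>\<^sup>2 + 20) / (2 * real (Suc K)))"
        by (intro real_sqrt_le_mono divide_right_mono) auto
      then have b2: "sqrt ((4 * ?N / (real R)\<^sup>2 + 2 * 8 + 4) / (2 * real (Suc K))) < \<rho>" using K by linarith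
      have "\<bar>cube_avg ?V (\<lambda>A. F n A * perm_avg ?V (perm_law ?V 1) (F n) A) - (cube_avg ?V (F n))\<^sup>2\<bar>
          \<le> R / sqrt (card ?V) + sqrt (\<Sum>k=1..K. level_weight ?V (F n) k)
            + sqrt ((4 * real (card ?V) / (real R)\<^sup>2 + 2 * 8 + 4) / (2 * real (Suc K)))"
      proof (rule monotone_covariance_le[OF V])
        show "0 \<le> F n A \<and> F n A \<le> 1" for A by (simp add: F_def set_fun_def indicator_def)
        show "swap_energy ?V (perm_avg ?V (perm_law ?V 1) g) \<le> 8 * real (card ?V)"
          if "\<And>A. A \<subseteq> ?V \<Longrightarrow> 0 \<le> g A \<and> g A \<le> 1" for g
          using swap_energy_perm_law[OF V that] by simp
      qed (use R0 mono perm_weights_perm_law[OF V] in auto)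
      also have "\<dots> < 4 * \<rho>" using b1 b2 elim(1) by linarith
      finally have "\<bar>4 * (cube_avg ?V (\<lambda>A. F n A * perm_avg ?V (perm_law ?V 1) (F n) A) - (cube_avg ?V (F n))\<^sup>2)\<bar> < 16 * \<rho>"
        by (simp add: abs_mult)
      then show ?case using exclusion_covariance[OF V, of "C n" 1] by (simp add: F_def \<rho>_def dist_real_def)
    qed
  qed
qed simp

section \<open>Crossings of the triangular lattice\<close>

definition tri :: "int \<times> int \<Rightarrow> real \<times> real" where
  "tri u = (of_int (fst u) + of_int (snd u) / 2, of_int (snd u) * sqrt 3 / 2)"

lemma tri_lattice_eq: "tri_lattice = range tri"
proof
  show "tri_lattice \<subseteq> range tri"
  proof
    fix x assume "x \<in> tri_lattice"
    then obtain m k where "x = tri (m, k)" by (auto simp: tri_lattice_def tri_def)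
    then show "x \<in> range tri" by blast
  qed
qed (auto simp: tri_lattice_def tri_def)

lemma inj_tri: "inj tri"
  by (auto simp: inj_on_def tri_def prod_eq_iff)

text \<open>The squared distance is the form p^2 + p q + q^2 in the coordinate differences, which
  takes the value 1 at the six directions of \<open>hex_adj\<close> only.\<close>

lemma tri_adj_hex:
  assumes "tri_adj (tri u) (tri v)"
  shows "hex_adj u v"
proof -
  define p q where "p = fst v - fst u" and "q = snd v - snd u"
  have "1 = (dist (tri u) (tri v))\<^sup>2" using assms by (simp add: tri_adj_def)
  also have "\<dots> = (of_int p + of_int q / 2)\<^sup>2 + (of_int q * sqrt 3 / 2)\<^sup>2"
    by (simp add: dist_prod_def tri_def dist_real_def p_def q_def) (simp add: power2_eq_square field_simps)
  also have "\<dots> = (of_int p)\<^sup>2 + of_int p * of_int q + (of_int q)\<^sup>2"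
    by (simp add: power_mult_distrib power_divide) (simp add: power2_eq_square field_simps)
  also have "\<dots> = of_int (p\<^sup>2 + p * q + q\<^sup>2)" by simp
  finally have eq: "p\<^sup>2 + p * q + q\<^sup>2 = 1" by (metis of_int_eq_1_iff)
  \<comment> \<open>From the identity 4 (x^2 + x y + y^2) = (2 x + y)^2 + 3 y^2.\<close>
  have small: "\<bar>y\<bar> \<le> 1" if "x\<^sup>2 + x * y + y\<^sup>2 = 1" for x y :: int
  proof (rule ccontr)
    assume "\<not> \<bar>y\<bar> \<le> 1"
    then have "2 * 2 \<le> \<bar>y\<bar> * \<bar>y\<bar>" by (intro mult_mono) auto
    moreover have "(2 * x + y)\<^sup>2 + 3 * (y * y) = 4" using that by (simp add: power2_eq_square algebra_simps)
    moreover have "0 \<le> (2 * x + y)\<^sup>2" by simp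
    ultimately show False by (simp add: abs_mult[symmetric])
  qed
  have "\<bar>q\<bar> \<le> 1" "\<bar>p\<bar> \<le> 1" using small[of p q] small[of q p] eq by (simp_all add: algebra_simps)
  then have "p \<in> {-1, 0, 1}" "q \<in> {-1, 0, 1}" by auto
  then show ?thesis using eq by (auto simp: hex_adj_def p_def[symmetric] q_def[symmetric])
qed

lemma symp_tri_adj: "symp tri_adj"
  by (auto simp: symp_def tri_adj_def dist_commute)

lemma tri_adj_fst: "tri_adj u v \<Longrightarrow> \<bar>fst u - fst v\<bar> \<le> 1"
  using dist_fst_le[of u v] by (simp add: tri_adj_def dist_real_def)

lemma tri_fst_hdist: "\<bar>fst (tri u) - fst (tri v)\<bar> \<le> 2 * real_of_int (hdist u v)"
proof -
  have "\<bar>fst v - fst u\<bar> \<le> hdist u v" "\<bar>snd v - snd u\<bar> \<le> hdist u v" by (auto simp: hdist_def)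
  then have "\<bar>real_of_int (fst v) - of_int (fst u)\<bar> \<le> hdist u v" "\<bar>real_of_int (snd v) - of_int (snd u)\<bar> \<le> hdist u v"
    by (metis of_int_abs of_int_diff of_int_le_iff)+
  then show ?thesis by (simp add: tri_def)
qed

lemma conn_tri:
  assumes "conn tri_adj (tri ` A) (tri u) (tri v)"
  shows "conn hex_adj A u v"
proof -
  have "conn hex_adj (inv tri ` tri ` A) (inv tri (tri u)) (inv tri (tri v))"
  proof (rule conn_image[OF assms])
    fix x y assume xy: "tri_adj x y"
    then obtain u v where "x = tri u" "y = tri v" by (auto simp: tri_adj_def tri_lattice_eq)
    then show "hex_adj (inv tri x) (inv tri y)" using xy tri_adj_hex by (simp add: inj_tri)
  qed
  then show ?thesis by (simp add: inj_tri image_image)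
qed

definition box_coords :: "real \<Rightarrow> real \<Rightarrow> nat \<Rightarrow> (int \<times> int) set" where
  "box_coords a b n = tri -` box_sites a b n"

lemma box_sites_eq: "box_sites a b n = tri ` box_coords a b n"
proof -
  have "box_sites a b n \<subseteq> range tri" by (auto simp: box_sites_def tri_lattice_eq)
  then show ?thesis by (simp add: box_coords_def image_vimage_eq Int_absorb2)
qed

lemma finite_box_coords: "finite (box_coords a b n)"
proof (rule finite_subset)
  show "box_coords a b n \<subseteq> {- \<lceil>b * real n\<rceil>..\<lceil>a * real n\<rceil>} \<times> {0..\<lceil>2 * (b * real n)\<rceil>}"
  proof
    fix u assume "u \<in> box_coords a b n"
    then have *: "0 \<le> real_of_int (fst u) + real_of_int (snd u) / 2" "real_of_int (fst u) + real_of_int (snd u) / 2 \<le> a * real n"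
      "0 \<le> real_of_int (snd u) * sqrt 3 / 2" "real_of_int (snd u) * sqrt 3 / 2 \<le> b * real n"
      by (auto simp: box_coords_def box_sites_def tri_def)
    have k: "0 \<le> snd u" using *(3) by (simp add: zero_le_mult_iff)
    have "real_of_int (snd u) * 1 \<le> real_of_int (snd u) * sqrt 3" using k by (intro mult_left_mono) auto
    then have "real_of_int (snd u) \<le> 2 * (b * real n)" "- (b * real n) \<le> real_of_int (fst u)" "real_of_int (fst u) \<le> a * real n"
      using * k by auto
    then have "snd u \<le> \<lceil>2 * (b * real n)\<rceil>" "- \<lceil>b * real n\<rceil> \<le> fst u" "fst u \<le> \<lceil>a * real n\<rceil>"
      by linarith+
    then show "u \<in> {- \<lceil>b * real n\<rceil>..\<lceil>a * real n\<rceil>} \<times> {0..\<lceil>2 * (b * real n)\<rceil>}" using k by (cases u) auto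
  qed
qed simp

lemma finite_box_sites: "finite (box_sites a b n)"
  by (simp add: box_sites_eq finite_box_coords)

text \<open>The bottom row alone has enough sites for the cardinality to diverge.\<close>

lemma card_box_sites_ge:
  assumes "0 < a" "0 < b"
  shows "a * real n \<le> real (card (box_sites a b n))"
proof -
  let ?X = "(\<lambda>m. tri (m, 0)) ` {0..\<lfloor>a * real n\<rfloor>}"
  have "?X \<subseteq> box_sites a b n"
  proof (rule image_subsetI)
    fix m assume "m \<in> {0..\<lfloor>a * real n\<rfloor>}"
    then have "0 \<le> real_of_int m" "real_of_int m \<le> a * real n" by (simp_all add: le_floor_iff)
    moreover have "tri (m, 0) = (real_of_int m, 0)" by (simp add: tri_def)
    moreover have "tri (m, 0) \<in> tri_lattice" by (simp add: tri_lattice_eq)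
    ultimately show "tri (m, 0) \<in> box_sites a b n" using assms by (simp add: box_sites_def)
  qed
  then have "card ?X \<le> card (box_sites a b n)" by (rule card_mono[OF finite_box_sites])
  moreover have "card ?X = nat (\<lfloor>a * real n\<rfloor> + 1)"
    by (subst card_image) (auto simp: inj_on_def tri_def)
  moreover have "0 \<le> \<lfloor>a * real n\<rfloor>" using assms by simp
  ultimately have "real_of_int (\<lfloor>a * real n\<rfloor> + 1) \<le> real (card (box_sites a b n))" by linarith
  then show ?thesis by linarith
qed

lemma conn_iff_path:
  "conn E X u v \<longleftrightarrow> (\<exists>p. p \<noteq> [] \<and> successively E p \<and> set p \<subseteq> X \<and> hd p = u \<and> last p = v)"
proof
  assume "conn E X u v"
  then show "\<exists>p. p \<noteq> [] \<and> successively E p \<and> set p \<subseteq> X \<and> hd p = u \<and> last p = v"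
  proof (induction rule: conn_induct)
    case refl
    then show ?case by (intro exI[of _ "[u]"]) simp
  next
    case (step v w)
    then obtain p where "p \<noteq> []" "successively E p" "set p \<subseteq> X" "hd p = u" "last p = v" by blast
    then show ?case using step by (intro exI[of _ "p @ [w]"]) (auto simp: successively_append_iff)
  qed
next
  have "conn E X (hd p) (last p)" if "p \<noteq> []" "successively E p" "set p \<subseteq> X" for p
    using that
  proof (induction p rule: rev_induct)
    case (snoc w p)
    show ?case
    proof (cases "p = []")
      case True
      then show ?thesis using snoc.prems by (auto intro: conn_refl)
    next
      case False
      then have "conn E X (hd p) (last p)" "E (last p) w" "w \<in> X"
        using snoc by (auto simp: successively_append_iff)
      then show ?thesis using conn_step[of E X "hd p" "last p" w] False by simp
    qed
  qed simp
  then show "\<exists>p. p \<noteq> [] \<and> successively E p \<and> set p \<subseteq> X \<and> hd p = u \<and> last p = v \<Longrightarrow> conn E X u v" by blast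
qed

definition crosses :: "real \<Rightarrow> nat \<Rightarrow> (real \<times> real) set \<Rightarrow> bool" where
  "crosses a n A \<longleftrightarrow> (\<exists>u v. conn tri_adj A u v \<and>
     (\<exists>w. tri_adj u w \<and> fst w < 0) \<and> (\<exists>w. tri_adj v w \<and> fst w > a * real n))"

lemma set_fun_lr_crossing:
  assumes "A \<subseteq> box_sites a b n"
  shows "set_fun (box_sites a b n) (indicator (lr_crossing a b n)) A = of_bool (crosses a n A)"
proof -
  let ?V = "box_sites a b n"
  have "(\<lambda>x\<in>?V. x \<in> A) \<in> lr_crossing a b n \<longleftrightarrow> (\<exists>p. p \<noteq> [] \<and> successively tri_adj p \<and> set p \<subseteq> A \<and>
         (\<exists>u. tri_adj (hd p) u \<and> fst u < 0) \<and> (\<exists>u. tri_adj (last p) u \<and> fst u > a * real n))"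
  proof -
    have "(\<forall>v\<in>set p. v \<in> ?V \<and> (\<lambda>x\<in>?V. x \<in> A) v) \<longleftrightarrow> set p \<subseteq> A" for p using assms by auto
    moreover have "(\<lambda>x\<in>?V. x \<in> A) \<in> configs ?V" by (simp add: configs_def)
    ultimately show ?thesis unfolding lr_crossing_def by simp
  qed
  also have "\<dots> \<longleftrightarrow> crosses a n A" unfolding crosses_def conn_iff_path by blast
  finally show ?thesis by (simp add: set_fun_def indicator_def)
qed

section \<open>Exploration from a vertical strip\<close>

definition strip :: "(real \<times> real) set \<Rightarrow> nat \<Rightarrow> (real \<times> real) set" where
  "strip V c = {v \<in> V. \<bar>fst v - real c\<bar> \<le> 1}"

text \<open>An edge changes the first coordinate by at most 1, so a path cannot jump over the strip.
  The ends of a crossing lie within 1 of the sides, and the range of c keeps the centre line between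
  them.\<close>

lemma crosses_meets_strip:
  assumes "conn tri_adj A u v" "A \<subseteq> V" "1 \<le> c" "real c \<le> a * real n - 1"
    and "tri_adj u w" "fst w < 0" "tri_adj v w'" "fst w' > a * real n"
  shows "\<exists>z\<in>strip V c. conn tri_adj A z u \<and> conn tri_adj A z v"
proof -
  have u: "fst u < real c" using tri_adj_fst[OF assms(5)] assms(3,6) by simp
  have "fst v < real c \<or> (\<exists>z\<in>strip V c. conn tri_adj A u z)"
    using assms(1)
  proof (induction rule: conn_induct)
    case (step v w)
    show ?case
    proof (cases "\<exists>z\<in>strip V c. conn tri_adj A u z")
      case False
      then have "fst v < real c" using step by blast
      then have "fst w < real c \<or> w \<in> strip V c"
        using tri_adj_fst[OF \<open>tri_adj v w\<close>] \<open>w \<in> A\<close> assms(2) by (auto simp: strip_def)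
      then show ?thesis using conn_step[OF \<open>conn tri_adj A u v\<close> \<open>tri_adj v w\<close> \<open>w \<in> A\<close>] by blast
    qed simp
  qed (use u in simp)
  moreover have "\<not> fst v < real c" using tri_adj_fst[OF assms(7)] assms(4,8) by simp
  ultimately obtain z where z: "z \<in> strip V c" "conn tri_adj A u z" by blast
  have zu: "conn tri_adj A z u" by (rule conn_sym[OF symp_tri_adj z(2)])
  show ?thesis using z(1) zu conn_trans[OF zu assms(1)] by blast
qed

text \<open>Every crossing lies in a cluster of the strip, before and after the flip, so an unread
  site cannot decide it.\<close>

lemma crosses_flip:
  assumes "A \<subseteq> V" "i \<in> V" "i \<notin> explored tri_adj V (strip V c) A" "1 \<le> c" "real c \<le> a * real n - 1"
  shows "crosses a n (flip i A) \<longleftrightarrow> crosses a n A"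
proof -
  have one: "crosses a n (flip i A)"
    if A: "A \<subseteq> V" "i \<notin> explored tri_adj V (strip V c) A" "crosses a n A" for A
  proof -
    obtain u v w w' where *: "conn tri_adj A u v" "tri_adj u w" "fst w < 0" "tri_adj v w'" "fst w' > a * real n"
      using A(3) unfolding crosses_def by blast
    then obtain z where z: "z \<in> strip V c" "conn tri_adj A z u" "conn tri_adj A z v"
      using crosses_meets_strip[OF *(1) A(1) assms(4,5) *(2-5)] by blast
    then have "conn tri_adj (flip i A) z u" "conn tri_adj (flip i A) z v"
      by (simp_all only: conn_flip_off[OF A(1) assms(2) A(2) z(1)])
    then have "conn tri_adj (flip i A) u v" using conn_sym[OF symp_tri_adj] conn_trans by metis
    then show ?thesis using * unfolding crosses_def by blast
  qed
  have "explored tri_adj V (strip V c) (flip i A) = explored tri_adj V (strip V c) A"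
    by (rule stopping_set_flip[OF stopping_set_explored assms(1-3)])
  then show ?thesis
    using one[OF assms(1,3)] one[of "flip i A"] flip_subset[OF assms(2,1)] assms(3) by auto
qed

text \<open>A site read far from the strip is joined to it or has a neighbour that is, which makes 7
  candidates for an arm. In 2 r + 3 one unit pays for the neighbour and one for the half-width of
  the strip; the rest uses that the first coordinate moves by at most 2 per unit of
  \<open>hdist\<close>.\<close>

lemma explored_strip_prob_le:
  fixes V :: "(real \<times> real) set"
  assumes V: "V = tri ` W" "finite W" and "i \<in> V" and far: "real (2 * r + 3) < \<bar>fst i - real c\<bar>"
  shows "cube_prob V (\<lambda>A. i \<in> explored tri_adj V (strip V c) A) \<le> 7 * arm_prob r"
proof -
  obtain j where j: "i = tri j" "j \<in> W" using assms by auto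
  define X where "X = insert j {u \<in> W. hex_adj j u}"
  have X: "finite X" "card X \<le> 7"
  proof -
    show "finite X" using V(2) by (simp add: X_def)
    have "card X \<le> Suc (card {u \<in> W. hex_adj j u})" unfolding X_def by (rule card_insert_le_m1) simp_all
    then show "card X \<le> 7" using hex_degree[of W j] by simp
  qed
  have "cube_prob V (\<lambda>A. i \<in> explored tri_adj V (strip V c) A)
      = cube_prob W (\<lambda>A. i \<in> explored tri_adj V (strip V c) (tri ` A))"
    unfolding cube_prob_def V(1) by (rule cube_avg_image[symmetric]) (rule inj_on_subset[OF inj_tri subset_UNIV])
  also have "\<dots> \<le> (\<Sum>u\<in>X. cube_prob W (arm u r))"
  proof (rule cube_prob_UN[OF X(1)])
    fix A assume A: "A \<subseteq> W" and i: "i \<in> explored tri_adj V (strip V c) (tri ` A)"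
    have "i \<notin> strip V c" using far by (simp add: strip_def)
    then have "i \<in> cluster tri_adj (strip V c) (tri ` A) \<or> (\<exists>x\<in>cluster tri_adj (strip V c) (tri ` A). tri_adj x i)"
      using i by (auto simp: explored_def)
    then obtain x where x: "x \<in> cluster tri_adj (strip V c) (tri ` A)" "x = i \<or> tri_adj x i" by blast
    then obtain y where y: "y \<in> strip V c" "conn tri_adj (tri ` A) y x" by (auto simp: cluster_def)
    obtain u where u: "x = tri u" "u \<in> A" using conn_right[OF y(2)] by auto
    obtain z where z: "y = tri z" using conn_left[OF y(2)] by auto
    have uX: "u \<in> X"
    proof (cases "x = i")
      case True
      then have "u = j" using u j inj_tri by (simp add: inj_eq)
      then show ?thesis by (simp add: X_def)
    next
      case False
      then have "tri_adj (tri j) (tri u)" using x(2) u j symp_tri_adj by (auto dest: sympD)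
      then show ?thesis using tri_adj_hex u A by (auto simp: X_def)
    qed
    have xi: "\<bar>fst x - fst i\<bar> \<le> 1" using x(2) tri_adj_fst[of x i] by (cases "x = i") simp_all
    have "\<bar>fst y - real c\<bar> \<le> 1" using y(1) by (simp add: strip_def)
    moreover have "real (2 * r + 3) = real (2 * r + 1) + 2" by simp
    ultimately have "real (2 * r + 1) < \<bar>fst x - fst y\<bar>" using far xi by linarith
    also have "\<dots> \<le> 2 * real_of_int (hdist u z)" unfolding u z by (rule tri_fst_hdist)
    finally have "int r \<le> hdist u z" by linarith
    moreover have "conn hex_adj A u z"
      using conn_sym[OF symp_tri_adj y(2)] unfolding u z by (rule conn_tri)
    ultimately have "arm u r A" using armI by blast
    then show "\<exists>u\<in>X. arm u r A" using uX by blast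
  qed
  also have "\<dots> \<le> (\<Sum>u\<in>X. arm_prob r)" using V(2) by (intro sum_mono arm_prob_ge)
  also have "\<dots> \<le> 7 * arm_prob r"
    using X(2) by (simp add: mult_right_mono arm_prob_def cube_prob_nonneg)
  finally show ?thesis .
qed

lemma card_near_le:
  fixes x :: real
  assumes "finite C"
  shows "card {c \<in> C. \<bar>x - real c\<bar> \<le> real D} \<le> 2 * D + 2"
proof -
  let ?I = "{\<lfloor>x\<rfloor> - int D..\<lfloor>x\<rfloor> + int D + 1}"
  have "{c \<in> C. \<bar>x - real c\<bar> \<le> real D} \<subseteq> nat ` ?I"
  proof
    fix c assume "c \<in> {c \<in> C. \<bar>x - real c\<bar> \<le> real D}"
    then have "\<bar>x - real c\<bar> \<le> real D" by simp
    then have "\<lfloor>x\<rfloor> - int D \<le> int c" "int c \<le> \<lfloor>x\<rfloor> + int D + 1" by linarith+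
    then have "nat (int c) \<in> nat ` ?I" by (intro imageI) simp
    then show "c \<in> nat ` ?I" by simp
  qed
  then have "card {c \<in> C. \<bar>x - real c\<bar> \<le> real D} \<le> card (nat ` ?I)" by (intro card_mono) auto
  also have "\<dots> \<le> card ?I" by (rule card_image_le) simp
  finally show ?thesis by simp
qed

text \<open>The strip is centred at a uniform c between 1 and L. At most 2 (2 r + 3) + 2 = 4 r + 8
  values of c are close to a given site; for the others the one-arm bound applies.\<close>

lemma level_weight_crossing:
  fixes a b :: real
  defines "V \<equiv> box_sites a b" and "F \<equiv> \<lambda>n. set_fun (box_sites a b n) (indicator (lr_crossing a b n))"
  assumes "0 < k" "0 < L" "real L \<le> a * real n - 1"
  shows "level_weight (V n) (F n) k \<le> real k * ((4 * real r + 8) / real L + 7 * arm_prob r)"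
proof (rule level_weight_revealment[where C = "{1..L}" and J = "\<lambda>c. explored tri_adj (V n) (strip (V n) c)"])
  let ?J = "\<lambda>c. explored tri_adj (V n) (strip (V n) c)"
  have VF: "F n A = of_bool (crosses a n A)" if "A \<subseteq> V n" for A
    using set_fun_lr_crossing that unfolding V_def F_def by blast
  have p: "0 \<le> arm_prob r" by (simp add: arm_prob_def cube_prob_nonneg)
  have finV: "finite (V n)" by (simp add: V_def finite_box_sites)
  then show "finite (V n)" .
  show "0 \<le> (4 * real r + 8) / real L + 7 * arm_prob r" using p by simp
  show "stopping_set (V n) (?J c)" for c by (rule stopping_set_explored)
  show "F n (flip i A) = F n A" if "c \<in> {1..L}" "A \<subseteq> V n" "i \<in> V n" "i \<notin> ?J c A" for c A i
    using that crosses_flip[OF that(2-4), of a n] VF[OF that(2)] VF[OF flip_subset[OF that(3,2)]] assms(5) by simp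
  show "\<bar>F n A\<bar> \<le> 1" if "A \<subseteq> V n" for A using VF[OF that] by simp
  show "(\<Sum>c\<in>{1..L}. cube_prob (V n) (\<lambda>A. i \<in> ?J c A)) \<le> ((4 * real r + 8) / real L + 7 * arm_prob r) * real (card {1..L})"
    if i: "i \<in> V n" for i
  proof -
    let ?D = "2 * r + 3"
    have "cube_prob (V n) (\<lambda>A. i \<in> ?J c A) \<le> of_bool (\<bar>fst i - real c\<bar> \<le> real ?D) + 7 * arm_prob r" for c
    proof (cases "\<bar>fst i - real c\<bar> \<le> real ?D")
      case True
      then show ?thesis using cube_prob_le_1[OF finV, of "\<lambda>A. i \<in> ?J c A"] p by simp
    next
      case False
      then have "cube_prob (V n) (\<lambda>A. i \<in> ?J c A) \<le> 7 * arm_prob r"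
        using explored_strip_prob_le[OF _ finite_box_coords i, of a b n r c] by (simp add: V_def box_sites_eq)
      then show ?thesis by simp
    qed
    then have "(\<Sum>c\<in>{1..L}. cube_prob (V n) (\<lambda>A. i \<in> ?J c A))
        \<le> (\<Sum>c\<in>{1..L}. of_bool (\<bar>fst i - real c\<bar> \<le> real ?D) + 7 * arm_prob r)"
      by (rule sum_mono)
    also have "\<dots> = real (card {c \<in> {1..L}. \<bar>fst i - real c\<bar> \<le> real ?D}) + real L * (7 * arm_prob r)"
      by (simp add: sum.distrib Int_def del: of_nat_add of_nat_mult)
    also have "\<dots> \<le> real (2 * ?D + 2) + real L * (7 * arm_prob r)"
      by (intro add_right_mono) (simp only: of_nat_le_iff card_near_le[OF finite_atLeastAtMost])
    also have "\<dots> = ((4 * real r + 8) / real L + 7 * arm_prob r) * real (card {1..L})"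
      using \<open>0 < L\<close> by (simp add: field_simps)
    finally show ?thesis .
  qed
qed (use assms in auto)

lemma level_weight_crossing_tendsto:
  fixes a b :: real
  assumes "0 < a" "0 < k"
  shows "(\<lambda>n. level_weight (box_sites a b n) (set_fun (box_sites a b n) (indicator (lr_crossing a b n))) k) \<longlonglongrightarrow> 0"
    (is "?W \<longlonglongrightarrow> 0")
proof (rule tendstoI)
  fix \<epsilon> :: real assume "0 < \<epsilon>"
  define \<delta> where "\<delta> = \<epsilon> / (2 * real k)"
  have \<delta>: "0 < \<delta>" using \<open>0 < \<epsilon>\<close> assms(2) by (simp add: \<delta>_def)
  have "eventually (\<lambda>r. arm_prob r < \<delta> / 7) sequentially"
    using \<delta> by (intro order_tendstoD(2)[OF arm_prob_tendsto]) simp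
  then obtain r where r: "arm_prob r < \<delta> / 7" using eventually_happens trivial_limit_sequentially by blast
  let ?L = "\<lambda>n. nat \<lfloor>a * real n - 1\<rfloor>"
  have "filterlim ?L at_top sequentially" using assms(1) by real_asymp
  then have L: "filterlim (\<lambda>n. real (?L n)) at_top sequentially"
    by (rule filterlim_compose[OF filterlim_real_sequentially])
  have "((\<lambda>x. (4 * real r + 8) / x) \<longlongrightarrow> 0) at_top" by real_asymp
  from filterlim_compose[OF this L]
  have ev1: "eventually (\<lambda>n. (4 * real r + 8) / real (?L n) < \<delta>) sequentially"
    using \<delta> by (rule order_tendstoD(2))
  have ev2: "eventually (\<lambda>n. 0 < real (?L n)) sequentially"
    using L unfolding filterlim_at_top_dense by blast
  show "eventually (\<lambda>n. dist (?W n) 0 < \<epsilon>) sequentially"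
    using ev1 ev2
  proof eventually_elim
    case (elim n)
    have "?W n \<le> real k * ((4 * real r + 8) / real (?L n) + 7 * arm_prob r)"
      using elim(2) by (intro level_weight_crossing assms(2)) linarith+
    also have "\<dots> < real k * (2 * \<delta>)" using r elim(1) assms(2) by (intro mult_strict_left_mono) auto
    also have "\<dots> = \<epsilon>" using assms(2) by (simp add: \<delta>_def)
    finally have "?W n < \<epsilon>" .
    moreover have "0 \<le> ?W n" by (rule level_weight_nonneg)
    ultimately show ?case by (simp add: dist_real_def)
  qed
qed

theorem theorem1p19:
  fixes a b :: real
  assumes "a > 0" and "b > 0"
  shows "CGXS_events (box_sites a b) (lr_crossing a b)"
proof (rule CGXS_events_monotone)
  show "finite (box_sites a b n)" for n by (rule finite_box_sites)
  show "filterlim (\<lambda>n. real (card (box_sites a b n))) at_top sequentially"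
  proof (rule filterlim_at_top_mono)
    show "filterlim (\<lambda>n. a * real n) at_top sequentially" using assms(1) by real_asymp
    show "eventually (\<lambda>n. a * real n \<le> real (card (box_sites a b n))) sequentially"
      using card_box_sites_ge[OF assms] by simp
  qed
  show "set_fun (box_sites a b n) (indicator (lr_crossing a b n)) A
      \<le> (set_fun (box_sites a b n) (indicator (lr_crossing a b n)) (insert i A) :: real)"
    if "A \<subseteq> box_sites a b n" "i \<in> box_sites a b n" for n A i
  proof -
    have "crosses a n A \<Longrightarrow> crosses a n (insert i A)"
      unfolding crosses_def using conn_mono[of tri_adj A _ _ "insert i A"] by blast
    then show ?thesis using that by (simp add: set_fun_lr_crossing)
  qed
  show "(\<lambda>n. level_weight (box_sites a b n) (set_fun (box_sites a b n) (indicator (lr_crossing a b n))) k) \<longlonglongrightarrow> 0"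
    if "0 < k" for k
    by (rule level_weight_crossing_tendsto[OF assms(1) that])
qed

end
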